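(* Let $E$ be a finite graph and $K$ a field with involution. Then the following are equivalent. (1) The Leavitt path algebra $L_K(E)$ is a graded quasi-Baer $\ast$-ring. (2) For each nonempty hereditary and saturated subset $H$ of $E^0$, no cycle outside $H$ leads to $H$ or no cycle outside $H^{tc}$ leads to $H^{tc}$. (3) For each nonempty hereditary and saturated subset $H$ of $E^0$, no vertex of a cycle of $E$ with vertices in $E^0\setminus(H\cup H^{tc})$ emits a path to $H$ and a path to $H^{tc}$. (4) For each nonempty hereditary and saturated subset $H$ of $E^0$, the saturated closure of $H^{\perp}\cup H^{\perp\perp}$ is $E^0$. (5) For each nonempty hereditary and saturated subset $H$ of $E^0$, $H^{\perp}\vee H^{\perp\perp}=E^0$.
   Context: Graphs. A directed graph $E=(E^0,E^1,r,s)$ has vertex set $E^0$, edge set $E^1$ and range and source maps $r,s:E^1\to E^0$. It is finite if $E^0$ and $E^1$ are finite. A vertex $v$ is regular ($v\in\mathrm{Reg}(E)$) if $s^{-1}(v)$ is nonempty and finite. $\mathrm{Path}(E)$ is the set of finite paths $\mu=\mu_1\cdots\mu_k$ with $r(\mu_i)=s(\mu_{i+1})$, $s(\mu)=s(\mu_1)$, $r(\mu)=r(\mu_k)$, $|\mu|=k$ (vertices are paths of length $0$). Write $v\geq w$ if some path has source $v$ and range $w$; $T(v)=\{w\mid v\geq w\}$. $H\subseteq E^0$ is hereditary if $v\in H$, $v\geq w$ imply $w\in H$; a hereditary $H$ is saturated if $v\in H$ whenever $v$ is regular and $r(s^{-1}(v))\subseteq H$. The saturated closure of a hereditary set is the smallest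 hereditary and saturated subset of $E^0$ containing it. For a hereditary and saturated set $H$, $H^{tc}=H^{\perp}=\{u\in E^0\mid H\cap T(u)=\emptyset\}$ (again hereditary and saturated), and $H^{\perp\perp}=(H^{\perp})^{\perp}$, with the same formula used if $H^\perp$ is empty. $\vee$ is the join in the lattice of hereditary and saturated subsets of $E^0$ ordered by inclusion (the smallest hereditary and saturated set containing both). A cycle outside $H$ is a cycle all of whose vertices lie in $E^0\setminus H$; it leads to $H$ if there is a path from one of its vertices to a vertex of $H$. Leavitt path algebra. $L_K(E)$ is the $K$-algebra generated by $\{v\mid v\in E^0\}$, $\{e, e^*\mid e\in E^1\}$ subject to: $vw=\delta_{v,w}v$ for $v,w\in E^0$; $s(e)e=e\,r(e)=e$; $r(e)e^*=e^*s(e)=e^*$; $e^*e'=\delta_{e,e'}r(e)$; $\sum_{s(e)=v}ee^*=v$ for every $v\in\mathrm{Reg}(E)$. With $\overline{\phantom{x}}$ the involution of $K$, the involution on $L_K(E)$ is $(\sum_i k_i\alpha_i\beta_i^* )^*=\sum_i\overline{k_i}\beta_i\alpha_i^*$. The $\mathbb{Z}$-grading is $L_K(E)_n=\{\sum_i k_i\alpha_i\beta_i^*\mid \alpha_i,\beta_i\in\mathrm{Path}(E),\ k_i\in K,\ |\alpha_i|-|\beta_i|=n\text{ for all }i\}$. Rings. An involution on a ring is an additive map $\ast$ with $(xy)^*=y^*x^*$ and $(x^* )^*=x$; a projection is an element $p=p^2=p^*$. In a $\Gamma$-graded ring $R=\bigoplus_{g}R_g$, homogeneous elements are those of $\bigcup_g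 R_g$, and an ideal $I$ is graded if $I=\bigoplus_g(I\cap R_g)$. A graded $\ast$-ring has an involution with $R_g^*\subseteq R_{g^{-1}}$ for all $g$. A graded $\ast$-ring $R$ is a graded quasi-Baer $\ast$-ring if for every graded (two-sided) ideal $I$, the right annihilator $r_R(I)=\{r\in R\mid xr=0\ \forall x\in I\}$ equals $pR$ for some homogeneous projection $p$. *)

theory Defs
  imports
    "Graph_Theory.Arc_Walk"
    "HOL-Algebra.QuotRing"
    "HOL-Algebra.Lattice"
    "HOL-Library.Poly_Mapping"
begin

section \<open>Graphs\<close>

text \<open>
  Directed graphs are \<^typ>\<open>('v, 'e) pre_digraph\<close>: \<^const>\<open>tail\<close> is the source map and
  \<^const>\<open>head\<close> the range map. Loops and parallel edges are allowed. A path is a pair of its source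
  and its list of edges; the list is empty for a path of length zero.
\<close>

definition regular_vertex :: "('v, 'e) pre_digraph \<Rightarrow> 'v \<Rightarrow> bool" where
  "regular_vertex E v \<longleftrightarrow> v \<in> verts E \<and> out_arcs E v \<noteq> {} \<and> finite (out_arcs E v)"

definition paths :: "('v, 'e) pre_digraph \<Rightarrow> ('v \<times> 'e list) set" where
  "paths E = {(u, p). \<exists>w. pre_digraph.awalk E u p w}"

definition emits_path :: "('v, 'e) pre_digraph \<Rightarrow> 'v \<Rightarrow> 'v \<Rightarrow> bool" where
  "emits_path E v w \<longleftrightarrow> (\<exists>p. pre_digraph.awalk E v p w)"

definition tree :: "('v, 'e) pre_digraph \<Rightarrow> 'v \<Rightarrow> 'v set" where
  "tree E v = {w. emits_path E v w}"

definition hereditary :: "('v, 'e) pre_digraph \<Rightarrow> 'v set \<Rightarrow> bool" where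
  "hereditary E H \<longleftrightarrow> H \<subseteq> verts E \<and> (\<forall>v\<in>H. \<forall>w. emits_path E v w \<longrightarrow> w \<in> H)"

definition saturated :: "('v, 'e) pre_digraph \<Rightarrow> 'v set \<Rightarrow> bool" where
  "saturated E H \<longleftrightarrow> (\<forall>v. regular_vertex E v \<and> head E ` out_arcs E v \<subseteq> H \<longrightarrow> v \<in> H)"

definition hersat :: "('v, 'e) pre_digraph \<Rightarrow> 'v set \<Rightarrow> bool" where
  "hersat E H \<longleftrightarrow> hereditary E H \<and> saturated E H"

definition saturated_closure :: "('v, 'e) pre_digraph \<Rightarrow> 'v set \<Rightarrow> 'v set" where
  "saturated_closure E X = \<Inter> {H. hersat E H \<and> X \<subseteq> H}"

definition perp :: "('v, 'e) pre_digraph \<Rightarrow> 'v set \<Rightarrow> 'v set" where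
  "perp E H = {u \<in> verts E. H \<inter> tree E u = {}}"

definition hersat_lattice :: "('v, 'e) pre_digraph \<Rightarrow> 'v set gorder" where
  "hersat_lattice E = \<lparr>carrier = {H. hersat E H}, eq = (=), le = (\<subseteq>)\<rparr>"

definition cycle_verts :: "('v, 'e) pre_digraph \<Rightarrow> 'e list \<Rightarrow> 'v set" where
  "cycle_verts E c = tail E ` set c"

definition cycle_outside :: "('v, 'e) pre_digraph \<Rightarrow> 'v set \<Rightarrow> 'e list \<Rightarrow> bool" where
  "cycle_outside E H c \<longleftrightarrow> pre_digraph.cycle E c \<and> cycle_verts E c \<subseteq> verts E - H"

definition cycle_leads_to :: "('v, 'e) pre_digraph \<Rightarrow> 'e list \<Rightarrow> 'v set \<Rightarrow> bool" where
  "cycle_leads_to E c H \<longleftrightarrow> (\<exists>v\<in>cycle_verts E c. \<exists>w\<in>H. emits_path E v w)"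


section \<open>Graded rings with involution\<close>

definition ring_involution :: "('a, 'm) ring_scheme \<Rightarrow> ('a \<Rightarrow> 'a) \<Rightarrow> bool" where
  "ring_involution R star \<longleftrightarrow>
     (\<forall>x\<in>carrier R. star x \<in> carrier R \<and> star (star x) = x) \<and>
     (\<forall>x\<in>carrier R. \<forall>y\<in>carrier R.
        star (x \<oplus>\<^bsub>R\<^esub> y) = star x \<oplus>\<^bsub>R\<^esub> star y \<and>
        star (x \<otimes>\<^bsub>R\<^esub> y) = star y \<otimes>\<^bsub>R\<^esub> star x)"

definition decomposition ::
  "('a, 'm) ring_scheme \<Rightarrow> ('g \<Rightarrow> 'a set) \<Rightarrow> 'a \<Rightarrow> ('g \<Rightarrow> 'a) \<Rightarrow> bool" where
  "decomposition R S x f \<longleftrightarrow>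
     (\<forall>g. f g \<in> S g) \<and> finite {g. f g \<noteq> \<zero>\<^bsub>R\<^esub>} \<and>
     x = finsum R f {g. f g \<noteq> \<zero>\<^bsub>R\<^esub>}"

definition internal_direct_sum ::
  "('a, 'm) ring_scheme \<Rightarrow> 'a set \<Rightarrow> ('g \<Rightarrow> 'a set) \<Rightarrow> bool" where
  "internal_direct_sum R M S \<longleftrightarrow>
     (\<forall>g. additive_subgroup (S g) R) \<and>
     (\<forall>x\<in>M. \<exists>!f. decomposition R S x f) \<and>
     (\<forall>x f. decomposition R S x f \<longrightarrow> x \<in> M)"

definition graded_ring :: "('a, 'm) ring_scheme \<Rightarrow> ('g::group_add \<Rightarrow> 'a set) \<Rightarrow> bool" where
  "graded_ring R G \<longleftrightarrow>
     ring R \<and> internal_direct_sum R (carrier R) G \<and>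
     (\<forall>g h. \<forall>x\<in>G g. \<forall>y\<in>G h. x \<otimes>\<^bsub>R\<^esub> y \<in> G (g + h))"

definition graded_ideal ::
  "('a, 'm) ring_scheme \<Rightarrow> ('g \<Rightarrow> 'a set) \<Rightarrow> 'a set \<Rightarrow> bool" where
  "graded_ideal R G I \<longleftrightarrow> ideal I R \<and> internal_direct_sum R I (\<lambda>g. I \<inter> G g)"

definition graded_star_ring ::
  "('a, 'm) ring_scheme \<Rightarrow> ('g::group_add \<Rightarrow> 'a set) \<Rightarrow> ('a \<Rightarrow> 'a) \<Rightarrow> bool" where
  "graded_star_ring R G star \<longleftrightarrow>
     graded_ring R G \<and> ring_involution R star \<and> (\<forall>g. star ` G g \<subseteq> G (- g))"

definition homogeneous_elements :: "('g \<Rightarrow> 'a set) \<Rightarrow> 'a set" where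
  "homogeneous_elements G = (\<Union>g. G g)"

definition projection :: "('a, 'm) ring_scheme \<Rightarrow> ('a \<Rightarrow> 'a) \<Rightarrow> 'a \<Rightarrow> bool" where
  "projection R star p \<longleftrightarrow> p \<in> carrier R \<and> p \<otimes>\<^bsub>R\<^esub> p = p \<and> star p = p"

definition right_annihilator :: "('a, 'm) ring_scheme \<Rightarrow> 'a set \<Rightarrow> 'a set" where
  "right_annihilator R I = {r \<in> carrier R. \<forall>x\<in>I. x \<otimes>\<^bsub>R\<^esub> r = \<zero>\<^bsub>R\<^esub>}"

definition graded_quasi_Baer_star_ring ::
  "('a, 'm) ring_scheme \<Rightarrow> ('g::group_add \<Rightarrow> 'a set) \<Rightarrow> ('a \<Rightarrow> 'a) \<Rightarrow> bool" where
  "graded_quasi_Baer_star_ring R G star \<longleftrightarrow>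
     graded_star_ring R G star \<and>
     (\<forall>I. graded_ideal R G I \<longrightarrow>
        (\<exists>p \<in> homogeneous_elements G. projection R star p \<and>
           right_annihilator R I = (\<lambda>r. p \<otimes>\<^bsub>R\<^esub> r) ` carrier R))"


section \<open>Free algebras\<close>

text \<open>
  Words form the free monoid, written additively, so that the product of \<^type>\<open>poly_mapping\<close> makes
  \<^typ>\<open>'g list \<Rightarrow>\<^sub>0 'k\<close> the free unital algebra (noncommutative polynomials).
\<close>

instantiation list :: (type) monoid_add
begin

definition zero_list :: "'a list" where
  "zero_list = []"

definition plus_list :: "'a list \<Rightarrow> 'a list \<Rightarrow> 'a list" where
  "plus_list xs ys = xs @ ys"

instance
  by standard (simp_all add: zero_list_def plus_list_def)

end

definition free_algebra :: "'g set \<Rightarrow> ('g list \<Rightarrow>\<^sub>0 'k::field) ring" where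
  "free_algebra X =
     \<lparr>carrier = {f. Poly_Mapping.keys f \<subseteq> lists X}, mult = (*), one = 1, zero = 0, add = (+)\<rparr>"

lemma free_algebra_ring: "ring (free_algebra X :: ('g list \<Rightarrow>\<^sub>0 'k::field) ring)"
proof (rule ringI)
  show "abelian_group (free_algebra X :: ('g list \<Rightarrow>\<^sub>0 'k) ring)"
  proof (rule abelian_groupI)
    fix f :: "'g list \<Rightarrow>\<^sub>0 'k"
    assume f: "f \<in> carrier (free_algebra X)"
    show "\<exists>h\<in>carrier (free_algebra X). h \<oplus>\<^bsub>free_algebra X\<^esub> f = \<zero>\<^bsub>free_algebra X\<^esub>"
      using f by (intro bexI[of _ "- f"]) (auto simp: free_algebra_def)
  qed (use Poly_Mapping.keys_add in \<open>fastforce simp: free_algebra_def add_ac\<close>)+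
  have "f * h \<in> carrier (free_algebra X)"
    if "f \<in> carrier (free_algebra X)" "h \<in> carrier (free_algebra X)" for f h :: "'g list \<Rightarrow>\<^sub>0 'k"
    using that Poly_Mapping.keys_mult[of f h] by (fastforce simp: free_algebra_def plus_list_def)
  then show "Group.monoid (free_algebra X :: ('g list \<Rightarrow>\<^sub>0 'k) ring)"
    by unfold_locales (auto simp: free_algebra_def zero_list_def mult.assoc)
qed (auto simp: free_algebra_def distrib_left distrib_right)


section \<open>Leavitt path algebras\<close>

datatype ('v, 'e) lpa_gen = Vertex 'v | Edge 'e | Ghost 'e

type_synonym ('v, 'e, 'k) lpa_free = "('v, 'e) lpa_gen list \<Rightarrow>\<^sub>0 'k"

definition lpa_gens :: "('v, 'e) pre_digraph \<Rightarrow> ('v, 'e) lpa_gen set" where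
  "lpa_gens E = Vertex ` verts E \<union> Edge ` arcs E \<union> Ghost ` arcs E"

definition word :: "('v, 'e) lpa_gen list \<Rightarrow> ('v, 'e, 'k::field) lpa_free" where
  "word w = Poly_Mapping.single w 1"

definition lpa_relators :: "('v, 'e) pre_digraph \<Rightarrow> ('v, 'e, 'k::field) lpa_free set" where
  "lpa_relators E =
     {word [Vertex v, Vertex w] - (if v = w then word [Vertex v] else 0) | v w.
        v \<in> verts E \<and> w \<in> verts E} \<union>
     {word [Vertex (tail E e), Edge e] - word [Edge e] | e. e \<in> arcs E} \<union>
     {word [Edge e, Vertex (head E e)] - word [Edge e] | e. e \<in> arcs E} \<union>
     {word [Vertex (head E e), Ghost e] - word [Ghost e] | e. e \<in> arcs E} \<union>
     {word [Ghost e, Vertex (tail E e)] - word [Ghost e] | e. e \<in> arcs E} \<union>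
     {word [Ghost e, Edge e'] - (if e = e' then word [Vertex (head E e)] else 0) | e e'.
        e \<in> arcs E \<and> e' \<in> arcs E} \<union>
     {(\<Sum>e\<in>out_arcs E v. word [Edge e, Ghost e]) - word [Vertex v] | v. regular_vertex E v}"

definition lpa_ideal :: "('v, 'e) pre_digraph \<Rightarrow> ('v, 'e, 'k::field) lpa_free set" where
  "lpa_ideal E = genideal (free_algebra (lpa_gens E)) (lpa_relators E)"

definition lpa_class ::
  "('v, 'e) pre_digraph \<Rightarrow> ('v, 'e, 'k::field) lpa_free \<Rightarrow> ('v, 'e, 'k) lpa_free set" where
  "lpa_class E f = lpa_ideal E +>\<^bsub>free_algebra (lpa_gens E)\<^esub> f"

text \<open>
  The presentation is one of algebras without a prescribed unit. The free such algebra consists of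
  the polynomials without constant term, and the ideal of it generated by the relators coincides
  with the ideal they generate in the unital free algebra; this is why the carrier is restricted.
  For finitely many vertices their sum is the unit of the quotient.
\<close>

definition leavitt_path_algebra ::
  "('v, 'e) pre_digraph \<Rightarrow> ('v, 'e, 'k::field) lpa_free set ring" where
  "leavitt_path_algebra E =
     (free_algebra (lpa_gens E) Quot lpa_ideal E)
       \<lparr>carrier := lpa_class E `
          {f \<in> carrier (free_algebra (lpa_gens E)). Poly_Mapping.lookup f [] = 0},
        one := lpa_class E (\<Sum>v\<in>verts E. word [Vertex v])\<rparr>"

fun path_word :: "'v \<times> 'e list \<Rightarrow> ('v, 'e) lpa_gen list" where
  "path_word (u, p) = (if p = [] then [Vertex u] else map Edge p)"

fun ghost_word :: "'v \<times> 'e list \<Rightarrow> ('v, 'e) lpa_gen list" where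
  "ghost_word (u, p) = (if p = [] then [Vertex u] else map Ghost (rev p))"

text \<open>The list of all \<open>(k\<^sub>i, \<alpha>\<^sub>i, \<beta>\<^sub>i)\<close> stands for the element \<open>\<Sum>\<^sub>i k\<^sub>i \<alpha>\<^sub>i \<beta>\<^sub>i\<^sup>*\<close>.\<close>

definition lpa_comb ::
  "('v, 'e) pre_digraph \<Rightarrow> ('k::field \<times> ('v \<times> 'e list) \<times> ('v \<times> 'e list)) list
    \<Rightarrow> ('v, 'e, 'k) lpa_free set" where
  "lpa_comb E ts =
     lpa_class E (\<Sum>(k, \<alpha>, \<beta>)\<leftarrow>ts. Poly_Mapping.single (path_word \<alpha> @ ghost_word \<beta>) k)"

definition lpa_star ::
  "('v, 'e) pre_digraph \<Rightarrow> ('k::field \<Rightarrow> 'k)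
    \<Rightarrow> ('v, 'e, 'k) lpa_free set \<Rightarrow> ('v, 'e, 'k) lpa_free set" where
  "lpa_star E bar x =
     (THE y. \<exists>ts. set ts \<subseteq> UNIV \<times> paths E \<times> paths E \<and> x = lpa_comb E ts \<and>
        y = lpa_comb E (map (\<lambda>(k, \<alpha>, \<beta>). (bar k, \<beta>, \<alpha>)) ts))"

definition lpa_grading ::
  "('v, 'e) pre_digraph \<Rightarrow> int \<Rightarrow> ('v, 'e, 'k::field) lpa_free set set" where
  "lpa_grading E n =
     {lpa_comb E ts | ts. \<forall>(k, \<alpha>, \<beta>)\<in>set ts. \<alpha> \<in> paths E \<and> \<beta> \<in> paths E \<and>
        int (length (snd \<alpha>)) - int (length (snd \<beta>)) = n}"

end

theory Submission
  imports Defs "HOL-Library.Countable_Set"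
begin

text \<open>
  Conditions (2)--(5) are equivalent set by set: a vertex outside \<open>H\<^sup>\<bottom>\<close> emits a path to \<open>H\<close>, and a set of
  vertices of a finite graph in which every vertex emits an edge into the set contains a cycle.

  For (4) \<open>\<Longrightarrow>\<close> (1), every nonzero homogeneous element of the Leavitt path algebra can be multiplied
  by a ghost path on the left and a path on the right so as to become a nonzero multiple of a vertex.
  Hence the annihilator \<open>J\<close> of a graded ideal with vertex set \<open>H\<close> contains \<open>H\<^sup>\<bottom>\<close> and is annihilated by
  \<open>H\<^sup>\<bottom>\<^sup>\<bottom>\<close>; as these generate the unit, \<open>1 = p + q\<close> with \<open>p \<in> J\<close> and \<open>q J = 0 = q\<^sup>* J\<close>, and \<open>p\<close> is the
  projection that generates \<open>J\<close>.

  For (1) \<open>\<Longrightarrow>\<close> (3), a projection \<open>p\<close> that generates a two-sided ideal is central. Conjugating by a long path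
  around a cycle shows that \<open>p v\<close> is a multiple of \<open>v\<close> for a vertex \<open>v\<close> of the cycle, whereas a
  vertex that emits paths to both \<open>H\<close> and \<open>H\<^sup>\<bottom>\<close> allows neither \<open>p v = 0\<close> nor \<open>p v \<noteq> 0\<close>.
\<close>


section \<open>Hereditary and saturated sets\<close>

text \<open>No basis of the algebra is constructed. The one nonvanishing fact that does not come
  from manipulating relations is that vertices are nonzero, obtained from a concrete representation;
  every other nonvanishing statement is reduced to it by multiplication with paths and ghost paths.
  Finiteness of the graph supplies two tools: the vertices sum to a unit, and every vertex that
  emits an edge is regular, so that \<open>v = \<Sum>e e^*\<close> can be used at each non-sink to
  shorten ghost parts. In (4) \<Longrightarrow> (1), condition (4) is silent about the empty set,
  which may occur as the vertex set of an ideal; its orthogonal set is all of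
  \<open>verts E\<close>. Demanding \<open>q^* J = 0\<close> besides \<open>q J = 0\<close> yields
  \<open>p = p^* p\<close>, hence \<open>p = p^*\<close>. In (1) \<Longrightarrow> (3) the path must
  be long because a degree-zero element is a combination of monomials \<open>a b^*\<close> with
  \<open>|a| = |b|\<close> bounded; conjugation by a path at least that long cancels each of them
  down to a vertex or to zero.\<close>

lemma emits_path_trans:
  assumes "wf_digraph E" "emits_path E u v" "emits_path E v w"
  shows "emits_path E u w"
  using assms wf_digraph.awalk_appendI[OF assms(1)] unfolding emits_path_def by blast

lemma emits_path_refl: "v \<in> verts E \<Longrightarrow> emits_path E v v"
  unfolding emits_path_def by (rule exI[of _ "[]"]) (simp add: pre_digraph.awalk_def pre_digraph.cas.simps)

lemma emits_path_arc: "wf_digraph E \<Longrightarrow> e \<in> arcs E \<Longrightarrow> emits_path E (tail E e) (head E e)"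
  unfolding emits_path_def by (metis wf_digraph.arc_implies_awalk)

lemma emits_path_in_verts:
  assumes "wf_digraph E" "emits_path E u v"
  shows "u \<in> verts E" "v \<in> verts E"
  using assms(2) wf_digraph.awalk_hd_in_verts[OF assms(1)] wf_digraph.awalk_last_in_verts[OF assms(1)]
  unfolding emits_path_def by blast+

lemma emits_path_first_arc:
  assumes "wf_digraph E" "emits_path E u v"
  shows "u = v \<or> (\<exists>e\<in>out_arcs E u. emits_path E (head E e) v)"
proof -
  obtain p where p: "pre_digraph.awalk E u p v" using assms unfolding emits_path_def by blast
  show ?thesis
  proof (cases p)
    case Nil
    then show ?thesis using p by (simp add: pre_digraph.awalk_def pre_digraph.cas.simps)
  next
    case (Cons e q)
    then show ?thesis using p wf_digraph.awalk_Cons_iff[OF assms(1), of u e q v]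
      by (auto simp: emits_path_def)
  qed
qed

lemma perp_iff: "u \<in> perp E X \<longleftrightarrow> u \<in> verts E \<and> (\<forall>w\<in>X. \<not> emits_path E u w)"
  unfolding perp_def tree_def by blast

lemma hereditary_disjoint_perp:
  assumes "hereditary E H" "v \<in> H" "emits_path E v w"
  shows "w \<notin> perp E H"
  using assms emits_path_refl[of w E] unfolding hereditary_def perp_iff by blast

lemma subset_perp_perp:
  assumes H: "hereditary E H"
  shows "H \<subseteq> perp E (perp E H)"
proof
  fix v assume v: "v \<in> H"
  then have "v \<in> verts E" using H unfolding hereditary_def by blast
  then show "v \<in> perp E (perp E H)"
    using perp_iff[of v E "perp E H"] hereditary_disjoint_perp[OF H v] by blast
qed

lemma hereditary_perp: "wf_digraph E \<Longrightarrow> hereditary E (perp E X)"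
  unfolding hereditary_def perp_def tree_def
  using emits_path_trans emits_path_in_verts by fast

text \<open>Only one edge back into \<open>X\<close> is demanded, so that the lemma applies to a
  hereditary set as well as to the vertex set of a cycle. If no edge of \<open>v\<close> leads to a
  vertex that reaches \<open>X\<close>, then \<open>v\<close> itself is not in \<open>X\<close> and
  has no nontrivial path to it.\<close>

lemma perp_saturated:
  assumes E: "wf_digraph E"
    and X: "\<And>v. v \<in> X \<Longrightarrow> out_arcs E v \<noteq> {} \<Longrightarrow> \<exists>e\<in>out_arcs E v. head E e \<in> X"
  shows "saturated E (perp E X)"
  unfolding saturated_def
proof (intro allI impI)
  fix v assume v: "regular_vertex E v \<and> head E ` out_arcs E v \<subseteq> perp E X"
  have heads: "\<not> emits_path E (head E e) w" if "e \<in> out_arcs E v" "w \<in> X" for e w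
    using v that unfolding perp_def tree_def by fast
  have "v \<notin> X"
  proof
    assume "v \<in> X"
    then obtain e where "e \<in> out_arcs E v" "head E e \<in> X"
      using X v unfolding regular_vertex_def by blast
    then show False
      using heads emits_path_refl[of "head E e" E] wf_digraph.head_in_verts[OF E] by auto
  qed
  then show "v \<in> perp E X"
    using v heads emits_path_first_arc[OF E] unfolding perp_def tree_def regular_vertex_def by blast
qed

lemma hersat_perp:
  assumes E: "wf_digraph E" and H: "hereditary E H"
  shows "hersat E (perp E H)"
  unfolding hersat_def
proof
  show "hereditary E (perp E H)" by (rule hereditary_perp[OF E])
  show "saturated E (perp E H)"
  proof (rule perp_saturated[OF E])
    fix v assume "v \<in> H" "out_arcs E v \<noteq> {}"
    then obtain e where e: "e \<in> out_arcs E v" by blast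
    then have "head E e \<in> H"
      using H \<open>v \<in> H\<close> emits_path_arc[OF E, of e] unfolding hereditary_def by auto
    then show "\<exists>e\<in>out_arcs E v. head E e \<in> H" using e by blast
  qed
qed

lemma hersat_verts: "wf_digraph E \<Longrightarrow> hersat E (verts E)"
  by (auto simp: hersat_def hereditary_def saturated_def regular_vertex_def dest: emits_path_in_verts(2))

lemma saturated_closure_subset_verts:
  "wf_digraph E \<Longrightarrow> X \<subseteq> verts E \<Longrightarrow> saturated_closure E X \<subseteq> verts E"
  unfolding saturated_closure_def using hersat_verts by blast

lemma hersat_saturated_closure:
  assumes "wf_digraph E" "X \<subseteq> verts E"
  shows "hersat E (saturated_closure E X)"
proof -
  have "hereditary E (saturated_closure E X)"
    using saturated_closure_subset_verts[OF assms]
    unfolding hereditary_def saturated_closure_def hersat_def by blast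
  moreover have "saturated E (saturated_closure E X)"
    unfolding saturated_def
  proof (intro allI impI)
    fix v assume v: "regular_vertex E v \<and> head E ` out_arcs E v \<subseteq> saturated_closure E X"
    show "v \<in> saturated_closure E X"
      unfolding saturated_closure_def
    proof (rule InterI)
      fix H assume H: "H \<in> {H. hersat E H \<and> X \<subseteq> H}"
      then have "saturated_closure E X \<subseteq> H" unfolding saturated_closure_def by blast
      then show "v \<in> H" using v H unfolding hersat_def saturated_def by blast
    qed
  qed
  ultimately show ?thesis unfolding hersat_def by blast
qed

text \<open>The join is a choice among least upper bounds, so the proof shows that the closure is
  the only one.\<close>

lemma join_hersat_lattice:
  assumes "wf_digraph E" "hersat E A" "hersat E B"
  shows "A \<squnion>\<^bsub>hersat_lattice E\<^esub> B = saturated_closure E (A \<union> B)"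
proof -
  let ?S = "saturated_closure E (A \<union> B)"
  have S: "hersat E ?S"
    using assms by (intro hersat_saturated_closure) (auto simp: hersat_def hereditary_def)
  have AB: "A \<union> B \<subseteq> ?S" unfolding saturated_closure_def by blast
  have min: "?S \<subseteq> C" if "hersat E C" "A \<union> B \<subseteq> C" for C
    using that unfolding saturated_closure_def by blast
  have U: "Upper (hersat_lattice E) {A, B} = {C. hersat E C \<and> A \<union> B \<subseteq> C}"
    using assms(2,3) unfolding Upper_def hersat_lattice_def by auto
  have "least (hersat_lattice E) C (Upper (hersat_lattice E) {A, B}) \<longleftrightarrow> C = ?S" for C
  proof
    assume "least (hersat_lattice E) C (Upper (hersat_lattice E) {A, B})"
    then show "C = ?S"
      unfolding U least_def using S AB min[of C] by (auto simp: hersat_lattice_def)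
  next
    assume "C = ?S"
    then show "least (hersat_lattice E) C (Upper (hersat_lattice E) {A, B})"
      unfolding U least_def using S AB min by (auto simp: hersat_lattice_def)
  qed
  then show ?thesis unfolding join_def sup_def by simp
qed


section \<open>Cycles\<close>

text \<open>A closed walk that is not a cycle repeats a vertex after its start; the part between the
  two visits is a shorter closed walk.\<close>

lemma cycle_in_closed_walk:
  assumes E: "wf_digraph E" and p: "wf_digraph.closed_w E p"
  shows "\<exists>c. pre_digraph.cycle E c \<and> set c \<subseteq> set p"
  using p
proof (induct "length p" arbitrary: p rule: less_induct)
  case less
  interpret wf_digraph E by (rule E)
  obtain u where u: "awalk u p u" "p \<noteq> []" using less(2) by (auto simp: closed_w_def)
  show ?case
  proof (cases "distinct (tl (awalk_verts u p))")
    case True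
    then show ?thesis using u unfolding cycle_def by blast
  next
    case False
    obtain e es where es: "p = e # es" using u by (cases p) auto
    then have **: "awalk (head E e) es u" "\<not> distinct (awalk_verts (head E e) es)"
      using u False by (auto simp: awalk_Cons_iff)
    obtain q r s where r: "es = q @ r @ s" "closed_w r"
      using awalk_not_distinct_decomp[OF **] by (auto simp: closed_w_def)
    then obtain c where "cycle c" "set c \<subseteq> set r" using less(1)[of r] es by auto
    then show ?thesis using r es by auto
  qed
qed

lemma cycle_in_sinkless_set:
  assumes E: "fin_digraph E" and v: "v \<in> T" and T: "T \<subseteq> verts E"
    and step: "\<And>u. u \<in> T \<Longrightarrow> \<exists>e\<in>out_arcs E u. head E e \<in> T"
  shows "\<exists>c. pre_digraph.cycle E c \<and> cycle_verts E c \<subseteq> T"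
proof -
  interpret fin_digraph E by (rule E)
  have "\<exists>p w. awalk v p w \<and> length p = n \<and> tail E ` set p \<subseteq> T" if "v \<in> T" for n v
    using that
  proof (induct n arbitrary: v)
    case 0
    then show ?case using T by (intro exI[of _ "[]"] exI[of _ v]) (auto simp: awalk_Nil_iff)
  next
    case (Suc n)
    obtain e where e: "e \<in> out_arcs E v" "head E e \<in> T" using step Suc by blast
    obtain p w where "awalk (head E e) p w" "length p = n" "tail E ` set p \<subseteq> T"
      using Suc(1)[OF e(2)] by blast
    then have "awalk v (e # p) w \<and> length (e # p) = Suc n \<and> tail E ` set (e # p) \<subseteq> T"
      using e Suc(2) by (auto simp: awalk_Cons_iff)
    then show ?case by blast
  qed
  \<comment> \<open>A walk with \<open>card (verts E)\<close> edges visits one vertex more than the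
    graph has, so some vertex is repeated.\<close>
  from this[OF v, of "card (verts E)"] obtain p w
    where p: "awalk v p w" "length p = card (verts E)" "tail E ` set p \<subseteq> T" by blast
  have "\<not> distinct (awalk_verts v p)"
  proof
    assume "distinct (awalk_verts v p)"
    then have "Suc (length p) = card (set (awalk_verts v p))"
      by (simp add: distinct_card length_awalk_verts)
    also have "\<dots> \<le> card (verts E)"
      using p(1) awalk_verts_in_verts by (intro card_mono) (auto simp: awalk_def)
    finally show False using p(2) by simp
  qed
  from awalk_not_distinct_decomp[OF p(1) this] obtain q r s where r: "p = q @ r @ s" "closed_w r"
    by (auto simp: closed_w_def)
  then obtain c where "cycle c" "set c \<subseteq> set r" using cycle_in_closed_walk[OF wf_digraph] by blast
  then show ?thesis using r p(3) unfolding cycle_verts_def by (intro exI[of _ c]) auto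
qed

lemma cycle_emits_path:
  assumes E: "wf_digraph E" and c: "pre_digraph.cycle E c"
    and "u \<in> cycle_verts E c" "v \<in> cycle_verts E c"
  shows "emits_path E u v"
proof -
  interpret wf_digraph E by (rule E)
  obtain x where x: "awalk x c x" using c unfolding cycle_def by blast
  have "emits_path E x w \<and> emits_path E w x" if w: "w \<in> cycle_verts E c" for w
  proof -
    obtain e where "e \<in> set c" "w = tail E e" using w unfolding cycle_verts_def by blast
    then obtain a b where "c = a @ e # b" by (meson split_list)
    then have "awalk x a w" "awalk w (e # b) x"
      using x \<open>w = tail E e\<close> by (auto simp: awalk_Cons_iff)
    then show ?thesis unfolding emits_path_def by blast
  qed
  then show ?thesis using assms emits_path_trans[OF E] by blast
qed

text \<open>Provides the hypothesis of \<open>perp_saturated\<close> for the vertex set of a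
  cycle.\<close>

lemma cycle_verts_step:
  assumes E: "wf_digraph E" and c: "pre_digraph.cycle E c" and v: "v \<in> cycle_verts E c"
  shows "\<exists>e\<in>out_arcs E v. head E e \<in> cycle_verts E c"
proof -
  interpret wf_digraph E by (rule E)
  obtain x where x: "awalk x c x" "c \<noteq> []" using c unfolding cycle_def by blast
  then have xc: "x \<in> cycle_verts E c"
    unfolding cycle_verts_def by (cases c) (auto simp: awalk_Cons_iff)
  obtain e where e: "e \<in> set c" "v = tail E e" using v unfolding cycle_verts_def by blast
  then obtain a b where c_eq: "c = a @ e # b" by (meson split_list)
  have "head E e \<in> cycle_verts E c"
  proof (cases b)
    case Nil
    then have "head E e = x" using x c_eq by (auto simp: awalk_Cons_iff awalk_Nil_iff)
    then show ?thesis using xc by simp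
  next
    case (Cons f b')
    then have "head E e = tail E f" using x c_eq by (auto simp: awalk_Cons_iff)
    then show ?thesis using c_eq Cons unfolding cycle_verts_def by simp
  qed
  moreover have "e \<in> out_arcs E v" using x e by (auto simp: awalk_def)
  ultimately show ?thesis by blast
qed


section \<open>The conditions on the graph\<close>

text \<open>A vertex outside the orthogonal set \<open>H\<^sup>\<bottom>\<close> emits a path to \<open>H\<close>, so a cycle witnessing
  the failure of the second disjunct already leads to both \<open>H\<close> and \<open>H\<^sup>\<bottom>\<close>; the first disjunct
  implies the second one.\<close>

lemma no_cycle_leads_iff_no_cycle_between:
  assumes E: "wf_digraph E" and H: "hersat E H"
  shows "((\<forall>c. cycle_outside E H c \<longrightarrow> \<not> cycle_leads_to E c H) \<or>
      (\<forall>c. cycle_outside E (perp E H) c \<longrightarrow> \<not> cycle_leads_to E c (perp E H))) \<longleftrightarrow>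
    (\<forall>c. cycle_outside E (H \<union> perp E H) c \<longrightarrow>
      (\<forall>v\<in>cycle_verts E c. \<not> ((\<exists>w\<in>H. emits_path E v w) \<and> (\<exists>w\<in>perp E H. emits_path E v w))))"
    (is "?L \<longleftrightarrow> ?R")
proof
  assume ?L
  then show ?R unfolding cycle_outside_def cycle_leads_to_def by blast
next
  assume R: ?R
  have "\<not> cycle_leads_to E c (perp E H)" if c: "cycle_outside E (perp E H) c" for c
  proof
    assume "cycle_leads_to E c (perp E H)"
    then obtain v w where v: "v \<in> cycle_verts E c" "w \<in> perp E H" "emits_path E v w"
      unfolding cycle_leads_to_def by blast
    have cyc: "pre_digraph.cycle E c" "cycle_verts E c \<subseteq> verts E - perp E H"
      using c unfolding cycle_outside_def by auto
    have "w \<notin> H" using v(2) emits_path_refl[of w E] unfolding perp_def tree_def by blast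
    then have "v \<notin> H" using v H unfolding hersat_def hereditary_def by blast
    then have "cycle_verts E c \<inter> H = {}"
      using cycle_emits_path[OF E cyc(1) _ v(1)] H unfolding hersat_def hereditary_def by blast
    moreover have "\<exists>w\<in>H. emits_path E v w" using cyc v(1) unfolding perp_def tree_def by blast
    ultimately show False using R cyc v unfolding cycle_outside_def by blast
  qed
  then show ?L by blast
qed

text \<open>If the closure is too small, its complement contains a cycle, and a vertex in neither
  orthogonal set reaches both \<open>H\<close> and \<open>perp E H\<close>. Conversely, a cycle that
  reaches both is avoided by a whole hereditary and saturated set containing the two orthogonal
  sets.\<close>

lemma no_cycle_between_iff_closure:
  assumes E: "fin_digraph E" and H: "hersat E H"
  shows "(\<forall>c. cycle_outside E (H \<union> perp E H) c \<longrightarrow>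
      (\<forall>v\<in>cycle_verts E c. \<not> ((\<exists>w\<in>H. emits_path E v w) \<and> (\<exists>w\<in>perp E H. emits_path E v w)))) \<longleftrightarrow>
    saturated_closure E (perp E H \<union> perp E (perp E H)) = verts E"
    (is "?L \<longleftrightarrow> ?S = _")
proof
  interpret fin_digraph E by (rule E)
  note wf = wf_digraph
  have sub: "perp E H \<union> perp E (perp E H) \<subseteq> verts E" unfolding perp_def by blast
  have perpS: "perp E H \<union> perp E (perp E H) \<subseteq> ?S" unfolding saturated_closure_def by blast
  have HS: "H \<subseteq> ?S" using subset_perp_perp[of E H] H perpS unfolding hersat_def by blast
  assume L: ?L
  show "?S = verts E"
  proof (rule ccontr)
    assume "?S \<noteq> verts E"
    then obtain v where v: "v \<in> verts E - ?S"
      using saturated_closure_subset_verts[OF wf sub] by blast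
    have "\<exists>c. pre_digraph.cycle E c \<and> cycle_verts E c \<subseteq> verts E - ?S"
    proof (rule cycle_in_sinkless_set[OF E v])
      fix u assume u: "u \<in> verts E - ?S"
      \<comment> \<open>Since \<open>H\<close> lies in the closure and \<open>u\<close> does not,
        the path to \<open>H\<close> is nontrivial; hence \<open>u\<close> is regular, and
        saturation gives an edge that stays outside the closure.\<close>
      have "\<exists>w\<in>H. emits_path E u w" using u perpS perp_iff[of u E H] by blast
      then have "out_arcs E u \<noteq> {}" using emits_path_first_arc[OF wf, of u] u HS by blast
      then have "regular_vertex E u" using u finite_arcs unfolding regular_vertex_def out_arcs_def by auto
      then show "\<exists>e\<in>out_arcs E u. head E e \<in> verts E - ?S"
        using u hersat_saturated_closure[OF wf sub] head_in_verts
        unfolding hersat_def saturated_def by fastforce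
    qed blast
    then obtain c where c: "cycle c" "cycle_verts E c \<subseteq> verts E - ?S" by blast
    then obtain v where v: "v \<in> cycle_verts E c"
      unfolding cycle_verts_def cycle_def by (cases c) auto
    have "cycle_outside E (H \<union> perp E H) c"
      using c HS perpS unfolding cycle_outside_def by blast
    moreover have "\<exists>w\<in>H. emits_path E v w" "\<exists>w\<in>perp E H. emits_path E v w"
      using v c perpS perp_iff[of v E H] perp_iff[of v E "perp E H"] by blast+
    ultimately show False using L v by blast
  qed
next
  interpret fin_digraph E by (rule E)
  note wf = wf_digraph
  assume S: "?S = verts E"
  show ?L
  proof (intro allI impI ballI notI)
    fix c v
    assume c: "cycle_outside E (H \<union> perp E H) c" and v: "v \<in> cycle_verts E c"
      and paths: "(\<exists>w\<in>H. emits_path E v w) \<and> (\<exists>w\<in>perp E H. emits_path E v w)"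
    have cyc: "cycle c" using c unfolding cycle_outside_def by blast
    \<comment> \<open>The vertices that cannot reach the cycle form the set that separates the
      closure from \<open>v\<close>.\<close>
    have hs: "hersat E (perp E (cycle_verts E c))"
      unfolding hersat_def
      using hereditary_perp[OF wf] perp_saturated[OF wf] cycle_verts_step[OF wf cyc] by blast
    have "perp E H \<union> perp E (perp E H) \<subseteq> perp E (cycle_verts E c)"
    proof
      fix u assume u: "u \<in> perp E H \<union> perp E (perp E H)"
      have "\<not> emits_path E u w" if "w \<in> cycle_verts E c" for w
      proof
        assume "emits_path E u w"
        then have "emits_path E u v"
          using emits_path_trans[OF wf] cycle_emits_path[OF wf cyc that v] by blast
        then show False
          using u paths emits_path_trans[OF wf] perp_iff[of u E H] perp_iff[of u E "perp E H"] by blast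
      qed
      then show "u \<in> perp E (cycle_verts E c)" using u by (auto simp: perp_iff[of u])
    qed
    then have "v \<in> perp E (cycle_verts E c)"
      using S hs c v unfolding saturated_closure_def cycle_outside_def by blast
    then show False
      using v emits_path_refl[of v E] perp_iff[of v E "cycle_verts E c"] by blast
  qed
qed


section \<open>Additive maps on free algebras\<close>

text \<open>The coefficient is handed to \<open>\<phi>\<close> instead of being multiplied in,
  because the involution is only semilinear; additivity in the coefficient is all that is asked of
  \<open>\<phi>\<close>.\<close>

definition lin_ext :: "('a \<Rightarrow> 'k \<Rightarrow> 'b::comm_monoid_add) \<Rightarrow> ('a \<Rightarrow>\<^sub>0 'k::zero) \<Rightarrow> 'b" where
  "lin_ext \<phi> f = (\<Sum>w\<in>Poly_Mapping.keys f. \<phi> w (Poly_Mapping.lookup f w))"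

lemma lin_ext_zero [simp]: "lin_ext \<phi> 0 = 0"
  by (simp add: lin_ext_def)

lemma lin_ext_single: "\<phi> w 0 = 0 \<Longrightarrow> lin_ext \<phi> (Poly_Mapping.single w k) = \<phi> w k"
  by (simp add: lin_ext_def)

lemma lin_ext_add:
  fixes f g :: "'a \<Rightarrow>\<^sub>0 'k::monoid_add"
  assumes "\<And>w. \<phi> w 0 = 0" "\<And>w a b. \<phi> w (a + b) = \<phi> w a + \<phi> w b"
  shows "lin_ext \<phi> (f + g) = lin_ext \<phi> f + lin_ext \<phi> g"
  unfolding lin_ext_def using assms by (intro setsum_keys_plus_distrib)

lemma poly_mapping_eq_sum_single:
  fixes f :: "'a \<Rightarrow>\<^sub>0 'k::comm_monoid_add"
  shows "f = (\<Sum>w\<in>Poly_Mapping.keys f. Poly_Mapping.single w (Poly_Mapping.lookup f w))"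
proof (rule poly_mapping_eqI)
  fix w
  have "(\<Sum>x\<in>Poly_Mapping.keys f. Poly_Mapping.lookup (Poly_Mapping.single x (Poly_Mapping.lookup f x)) w) =
      (\<Sum>x\<in>Poly_Mapping.keys f. if x = w then Poly_Mapping.lookup f w else 0)"
    by (intro sum.cong) (auto simp: lookup_single when_def)
  then show "Poly_Mapping.lookup f w =
      Poly_Mapping.lookup (\<Sum>x\<in>Poly_Mapping.keys f. Poly_Mapping.single x (Poly_Mapping.lookup f x)) w"
    by (simp add: lookup_sum in_keys_iff)
qed

text \<open>The monomial case is limited to the support of \<open>f\<close>, so that assumptions
  about \<open>keys f\<close> remain available in the induction.\<close>

lemma poly_mapping_keys_induct:
  fixes f :: "'a \<Rightarrow>\<^sub>0 'k::comm_monoid_add"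
  assumes "P 0" "\<And>w k. w \<in> Poly_Mapping.keys f \<Longrightarrow> P (Poly_Mapping.single w k)"
    "\<And>g h. P g \<Longrightarrow> P h \<Longrightarrow> P (g + h)"
  shows "P f"
proof -
  have "P (\<Sum>w\<in>A. Poly_Mapping.single w (Poly_Mapping.lookup f w))"
    if "finite A" "A \<subseteq> Poly_Mapping.keys f" for A
    using that by (induct rule: finite_induct) (use assms in auto)
  from this[OF finite_keys subset_refl] show ?thesis
    using poly_mapping_eq_sum_single[of f] by simp
qed

lemma additive_map_eqI:
  fixes F G :: "('a \<Rightarrow>\<^sub>0 'k::comm_monoid_add) \<Rightarrow> 'b::monoid_add"
  assumes "F 0 = 0" "G 0 = 0" "\<And>f g. F (f + g) = F f + F g" "\<And>f g. G (f + g) = G f + G g"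
    and "\<And>w k. w \<in> Poly_Mapping.keys f \<Longrightarrow> F (Poly_Mapping.single w k) = G (Poly_Mapping.single w k)"
  shows "F f = G f"
  by (rule poly_mapping_keys_induct[where f = f]) (simp_all add: assms)

lemma single_mult_single:
  "Poly_Mapping.single a k * Poly_Mapping.single b l = Poly_Mapping.single (a @ b) (k * l :: 'k::field)"
  by (simp add: mult_single plus_list_def)

lemma word_mult_word: "word a * word b = (word (a @ b) :: ('v, 'e, 'k::field) lpa_free)"
  by (simp add: word_def single_mult_single)

lemma keys_mult_append:
  "Poly_Mapping.keys (f * g) \<subseteq> {a @ b | a b. a \<in> Poly_Mapping.keys f \<and> b \<in> Poly_Mapping.keys g}"
  for f g :: "'g list \<Rightarrow>\<^sub>0 'k::field"
  using keys_mult[of f g] by (auto simp: plus_list_def)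


section \<open>The ideal of relations\<close>

text \<open>An elementwise description of the ideal of relations, which is itself an intersection of
  ideals; it is the source of the induction rule \<open>lpa_ideal_induct\<close>.\<close>

inductive_set relator_span :: "('v, 'e) pre_digraph \<Rightarrow> ('v, 'e, 'k::field) lpa_free set"
  for E where
  zero: "0 \<in> relator_span E"
| add: "f \<in> relator_span E \<Longrightarrow> g \<in> relator_span E \<Longrightarrow> f + g \<in> relator_span E"
| relator: "r \<in> lpa_relators E \<Longrightarrow> a \<in> lists (lpa_gens E) \<Longrightarrow> b \<in> lists (lpa_gens E) \<Longrightarrow>
    Poly_Mapping.single a k * r * Poly_Mapping.single b l \<in> relator_span E"

locale lpa_graph = fin_digraph E for E :: "('v, 'e) pre_digraph"
begin

abbreviation F :: "('v, 'e, 'k::field) lpa_free ring" where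
  "F \<equiv> free_algebra (lpa_gens E)"

lemma carrier_F: "f \<in> carrier F \<longleftrightarrow> Poly_Mapping.keys f \<subseteq> lists (lpa_gens E)"
  by (simp add: free_algebra_def)

lemma ring_F: "ring (F :: ('v, 'e, 'k::field) lpa_free ring)"
  by (rule free_algebra_ring)

lemma F_simps [simp]:
  "f \<otimes>\<^bsub>F\<^esub> g = f * g" "f \<oplus>\<^bsub>F\<^esub> g = f + g" "\<zero>\<^bsub>F\<^esub> = 0" "\<one>\<^bsub>F\<^esub> = 1"
  by (simp_all add: free_algebra_def)

lemma F_closed:
  fixes f g :: "('v, 'e, 'k::field) lpa_free"
  shows
  "0 \<in> carrier (F :: ('v, 'e, 'k) lpa_free ring)"
  "f \<in> carrier F \<Longrightarrow> g \<in> carrier F \<Longrightarrow> f + g \<in> carrier F"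
  "f \<in> carrier F \<Longrightarrow> - f \<in> carrier F"
  "f \<in> carrier F \<Longrightarrow> g \<in> carrier F \<Longrightarrow> f - g \<in> carrier F"
  "f \<in> carrier F \<Longrightarrow> g \<in> carrier F \<Longrightarrow> f * g \<in> carrier F"
  "w \<in> lists (lpa_gens E) \<Longrightarrow> Poly_Mapping.single w (k :: 'k) \<in> carrier F"
  "w \<in> lists (lpa_gens E) \<Longrightarrow> word w \<in> carrier (F :: ('v, 'e, 'k) lpa_free ring)"
proof -
  interpret ring "F :: ('v, 'e, 'k) lpa_free ring" by (rule ring_F)
  show neg: "- f \<in> carrier F" if "f \<in> carrier F" for f :: "('v, 'e, 'k) lpa_free"
    using that by (simp add: carrier_F)
  show "0 \<in> carrier (F :: ('v, 'e, 'k) lpa_free ring)" by (simp add: carrier_F)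
  show plus: "f + g \<in> carrier F" if "f \<in> carrier F" "g \<in> carrier F" for f g :: "('v, 'e, 'k) lpa_free"
    using add.m_closed that by simp
  show "f - g \<in> carrier F" if "f \<in> carrier F" "g \<in> carrier F" for f g :: "('v, 'e, 'k) lpa_free"
    using plus[of f "- g"] neg that by simp
  show "f * g \<in> carrier F" if "f \<in> carrier F" "g \<in> carrier F" for f g :: "('v, 'e, 'k) lpa_free"
    using m_closed that by simp
  show "w \<in> lists (lpa_gens E) \<Longrightarrow> Poly_Mapping.single w k \<in> carrier F" for w and k :: 'k
    by (simp add: carrier_F)
  show "w \<in> lists (lpa_gens E) \<Longrightarrow> (word w :: ('v, 'e, 'k) lpa_free) \<in> carrier F" for w
    by (simp add: carrier_F word_def)
qed

lemma F_sum_closed: "(\<And>i. i \<in> A \<Longrightarrow> f i \<in> carrier F) \<Longrightarrow> sum f A \<in> carrier F"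
  by (induct A rule: infinite_finite_induct) (auto intro: F_closed)

lemma F_a_inv:
  fixes f :: "('v, 'e, 'k::field) lpa_free"
  shows "f \<in> carrier F \<Longrightarrow> \<ominus>\<^bsub>F\<^esub> f = - f"
proof -
  interpret ring "F :: ('v, 'e, 'k) lpa_free ring" by (rule ring_F)
  show "f \<in> carrier F \<Longrightarrow> \<ominus>\<^bsub>F\<^esub> f = - f" for f :: "('v, 'e, 'k) lpa_free"
    by (rule minus_equality) (auto intro: F_closed)
qed

lemma lpa_gens_simps [simp]:
  "Vertex v \<in> lpa_gens E \<longleftrightarrow> v \<in> verts E"
  "Edge e \<in> lpa_gens E \<longleftrightarrow> e \<in> arcs E"
  "Ghost e \<in> lpa_gens E \<longleftrightarrow> e \<in> arcs E"
  by (auto simp: lpa_gens_def)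

lemma relators_in_carrier: "lpa_relators E \<subseteq> carrier F"
  unfolding lpa_relators_def
  by (auto intro!: F_closed F_sum_closed simp: regular_vertex_def)

lemma ideal_lpa_ideal: "ideal (lpa_ideal E) F"
  unfolding lpa_ideal_def by (rule ring.genideal_ideal[OF ring_F relators_in_carrier])

lemma relator_in_ideal: "r \<in> lpa_relators E \<Longrightarrow> r \<in> lpa_ideal E"
  unfolding lpa_ideal_def using ring.genideal_self[OF ring_F relators_in_carrier] by blast

lemma lpa_ideal_closed:
  fixes f g x :: "('v, 'e, 'k::field) lpa_free"
  shows
  "0 \<in> (lpa_ideal E :: ('v, 'e, 'k) lpa_free set)"
  "f \<in> lpa_ideal E \<Longrightarrow> g \<in> lpa_ideal E \<Longrightarrow> f + g \<in> lpa_ideal E"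
  "f \<in> lpa_ideal E \<Longrightarrow> - f \<in> lpa_ideal E"
  "f \<in> lpa_ideal E \<Longrightarrow> x \<in> carrier F \<Longrightarrow> x * f \<in> lpa_ideal E"
  "f \<in> lpa_ideal E \<Longrightarrow> x \<in> carrier F \<Longrightarrow> f * x \<in> lpa_ideal E"
proof -
  interpret ideal "lpa_ideal E" "F :: ('v, 'e, 'k) lpa_free ring" by (rule ideal_lpa_ideal)
  show "(0 :: ('v, 'e, 'k) lpa_free) \<in> lpa_ideal E"
    using additive_subgroup.zero_closed[OF additive_subgroup_axioms] by simp
  show "f \<in> lpa_ideal E \<Longrightarrow> g \<in> lpa_ideal E \<Longrightarrow> f + g \<in> lpa_ideal E" for f g :: "('v, 'e, 'k) lpa_free"
    using additive_subgroup.a_closed[OF additive_subgroup_axioms] by simp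
  show "- f \<in> lpa_ideal E" if f: "f \<in> lpa_ideal E" for f :: "('v, 'e, 'k) lpa_free"
    using additive_subgroup.a_inv_closed[OF additive_subgroup_axioms f] F_a_inv[OF Icarr[OF f]] by simp
  show "f \<in> lpa_ideal E \<Longrightarrow> x \<in> carrier F \<Longrightarrow> x * f \<in> lpa_ideal E" for f x :: "('v, 'e, 'k) lpa_free"
    using I_l_closed[of f x] by simp
  show "f \<in> lpa_ideal E \<Longrightarrow> x \<in> carrier F \<Longrightarrow> f * x \<in> lpa_ideal E" for f x :: "('v, 'e, 'k) lpa_free"
    using I_r_closed[of f x] by simp
qed

lemma lpa_ideal_diff: "f \<in> lpa_ideal E \<Longrightarrow> g \<in> lpa_ideal E \<Longrightarrow> f - g \<in> lpa_ideal E"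
  using lpa_ideal_closed(2)[of f "- g"] lpa_ideal_closed(3)[of g] by simp

lemma lpa_ideal_sum: "(\<And>i. i \<in> A \<Longrightarrow> f i \<in> lpa_ideal E) \<Longrightarrow> sum f A \<in> lpa_ideal E"
  by (induct A rule: infinite_finite_induct) (auto intro: lpa_ideal_closed)

lemma relator_span_closed:
  fixes f x :: "('v, 'e, 'k::field) lpa_free"
  shows
  "f \<in> relator_span E \<Longrightarrow> - f \<in> relator_span E"
  "f \<in> relator_span E \<Longrightarrow> x \<in> carrier F \<Longrightarrow> x * f \<in> relator_span E"
  "f \<in> relator_span E \<Longrightarrow> x \<in> carrier F \<Longrightarrow> f * x \<in> relator_span E"
proof -
  show "- f \<in> relator_span E" if "f \<in> relator_span E" for f :: "('v, 'e, 'k) lpa_free"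
    using that
  proof induct
    case (relator r a b k l)
    have "- (Poly_Mapping.single a k * r * Poly_Mapping.single b l) =
        Poly_Mapping.single a (- k) * r * Poly_Mapping.single b l"
      by (simp add: single_uminus)
    then show ?case using relator_span.relator[OF relator, of "- k" l] by simp
  next
    case (add f g)
    then show ?case using relator_span.add[of "- f" E "- g"] by simp
  qed (simp add: relator_span.zero)
  show "x * f \<in> relator_span E" if "f \<in> relator_span E" "x \<in> carrier F"
    for f x :: "('v, 'e, 'k) lpa_free"
    using that(1)
  proof induct
    case (relator r a b k l)
    show ?case
    proof (rule poly_mapping_keys_induct[where f = x])
      fix w m assume "w \<in> Poly_Mapping.keys x"
      then have w: "w \<in> lists (lpa_gens E)" using that(2) by (auto simp: carrier_F)
      have "Poly_Mapping.single w m * (Poly_Mapping.single a k * r * Poly_Mapping.single b l) =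
          Poly_Mapping.single (w @ a) (m * k) * r * Poly_Mapping.single b l"
        by (simp add: single_mult_single flip: mult.assoc)
      then show "Poly_Mapping.single w m * (Poly_Mapping.single a k * r * Poly_Mapping.single b l)
          \<in> relator_span E"
        using relator_span.relator[OF relator(1), of "w @ a" b "m * k" l] relator w by auto
    qed (auto intro: relator_span.intros simp: distrib_right)
  qed (auto intro: relator_span.intros simp: distrib_left)
  show "f * x \<in> relator_span E" if "f \<in> relator_span E" "x \<in> carrier F"
    for f x :: "('v, 'e, 'k) lpa_free"
    using that(1)
  proof induct
    case (relator r a b k l)
    show ?case
    proof (rule poly_mapping_keys_induct[where f = x])
      fix w m assume "w \<in> Poly_Mapping.keys x"
      then have w: "w \<in> lists (lpa_gens E)" using that(2) by (auto simp: carrier_F)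
      have "(Poly_Mapping.single a k * r * Poly_Mapping.single b l) * Poly_Mapping.single w m =
          Poly_Mapping.single a k * r * Poly_Mapping.single (b @ w) (l * m)"
        by (simp add: single_mult_single mult.assoc)
      then show "(Poly_Mapping.single a k * r * Poly_Mapping.single b l) * Poly_Mapping.single w m
          \<in> relator_span E"
        using relator_span.relator[OF relator(1), of a "b @ w" k "l * m"] relator w by auto
    qed (auto intro: relator_span.intros simp: distrib_left)
  qed (auto intro: relator_span.intros simp: distrib_right)
qed

lemma relator_span_carrier: "f \<in> relator_span E \<Longrightarrow> f \<in> carrier F"
  by (induct rule: relator_span.induct) (use relators_in_carrier in \<open>auto intro!: F_closed\<close>)

lemma lpa_ideal_subset_relator_span:
  "lpa_ideal E \<subseteq> (relator_span E :: ('v, 'e, 'k::field) lpa_free set)"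
proof -
  have "ideal (relator_span E) (F :: ('v, 'e, 'k) lpa_free ring)"
  proof (rule idealI[OF ring_F])
    interpret ring "F :: ('v, 'e, 'k) lpa_free ring" by (rule ring_F)
    show "subgroup (relator_span E) (add_monoid (F :: ('v, 'e, 'k) lpa_free ring))"
    proof (rule add.subgroupI)
      show "relator_span E \<noteq> ({} :: ('v, 'e, 'k) lpa_free set)" using relator_span.zero by blast
      show "relator_span E \<subseteq> carrier (F :: ('v, 'e, 'k) lpa_free ring)"
        using relator_span_carrier by blast
    qed (auto intro: relator_span.add relator_span_closed simp: F_a_inv relator_span_carrier)
  qed (auto intro: relator_span_closed)
  moreover have "r \<in> relator_span E" if "r \<in> lpa_relators E" for r :: "('v, 'e, 'k) lpa_free"
    using relator_span.relator[OF that lists.Nil lists.Nil, of 1 1] by (simp flip: zero_list_def)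
  ultimately show "lpa_ideal E \<subseteq> (relator_span E :: ('v, 'e, 'k) lpa_free set)"
    unfolding lpa_ideal_def by (intro ring.genideal_minimal[OF ring_F]) blast+
qed

lemma lpa_ideal_induct:
  assumes "f \<in> lpa_ideal E" "P 0" "\<And>f g. P f \<Longrightarrow> P g \<Longrightarrow> P (f + g)"
    and "\<And>r a b k l. r \<in> lpa_relators E \<Longrightarrow> a \<in> lists (lpa_gens E) \<Longrightarrow> b \<in> lists (lpa_gens E) \<Longrightarrow>
      P (Poly_Mapping.single a k * r * Poly_Mapping.single b l)"
  shows "P f"
proof -
  have "f \<in> relator_span E" using assms(1) lpa_ideal_subset_relator_span by blast
  then show ?thesis by induct (use assms in auto)
qed

lemma lpa_class_eq_iff:
  fixes f g :: "('v, 'e, 'k::field) lpa_free"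
  assumes "f \<in> carrier F" "g \<in> carrier F"
  shows "lpa_class E f = lpa_class E g \<longleftrightarrow> f - g \<in> lpa_ideal E"
proof -
  interpret ring "F :: ('v, 'e, 'k) lpa_free ring" by (rule ring_F)
  show ?thesis
    using quotient_eq_iff_same_a_r_cos[OF ideal_lpa_ideal assms] assms
    by (simp add: lpa_class_def a_minus_def F_a_inv)
qed

end


section \<open>The Leavitt path algebra as a quotient of the full free algebra\<close>

definition restrict_gens :: "'g set \<Rightarrow> ('g list \<Rightarrow>\<^sub>0 'k::field) \<Rightarrow> 'g list \<Rightarrow>\<^sub>0 'k" where
  "restrict_gens X = lin_ext (\<lambda>w k. if w \<in> lists X then Poly_Mapping.single w k else 0)"

definition vertex_sum :: "('v, 'e) pre_digraph \<Rightarrow> ('v, 'e, 'k::field) lpa_free" where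
  "vertex_sum E = (\<Sum>v\<in>verts E. word [Vertex v])"

text \<open>This map is a surjective unital ring homomorphism from the free algebra on \<^emph>\<open>all\<close> generators
  to the Leavitt path algebra: generators that do not come from the graph are sent to zero and
  the empty word to the sum of the vertices. Calculations in the Leavitt path algebra thus become
  calculations in a type of class \<^class>\<open>ring_1\<close> without carrier conditions.\<close>

definition lpa_of :: "('v, 'e) pre_digraph \<Rightarrow> ('v, 'e, 'k::field) lpa_free \<Rightarrow> ('v, 'e, 'k) lpa_free set" where
  "lpa_of E f = lpa_class E (vertex_sum E * restrict_gens (lpa_gens E) f)"

lemma restrict_gens_add: "restrict_gens X (f + g) = restrict_gens X f + restrict_gens X g"
  unfolding restrict_gens_def by (rule lin_ext_add) (auto simp: single_add)

lemma restrict_gens_zero [simp]: "restrict_gens X 0 = 0"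
  by (simp add: restrict_gens_def)

lemma restrict_gens_single:
  "restrict_gens X (Poly_Mapping.single w k) = (if w \<in> lists X then Poly_Mapping.single w k else 0)"
  unfolding restrict_gens_def by (subst lin_ext_single) auto

lemma restrict_gens_id: "Poly_Mapping.keys f \<subseteq> lists X \<Longrightarrow> restrict_gens X f = f"
  by (rule additive_map_eqI) (auto simp: restrict_gens_add restrict_gens_single)

lemma restrict_gens_mult: "restrict_gens X (f * g) = restrict_gens X f * restrict_gens X g"
proof (rule additive_map_eqI[where f = f])
  fix a k
  show "restrict_gens X (Poly_Mapping.single a k * g) =
      restrict_gens X (Poly_Mapping.single a k) * restrict_gens X g"
    by (rule additive_map_eqI[where f = g])
      (auto simp: restrict_gens_add restrict_gens_single single_mult_single distrib_left)
qed (auto simp: restrict_gens_add distrib_right)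

lemma keys_restrict_gens: "Poly_Mapping.keys (restrict_gens X f) \<subseteq> lists X"
  by (rule poly_mapping_keys_induct[where f = f])
    (auto simp: restrict_gens_add restrict_gens_single dest!: keys_add[THEN subsetD])

section \<open>The vertex sum as a unit modulo the relations\<close>

context lpa_graph
begin

abbreviation L :: "('v, 'e, 'k::field) lpa_free set ring" where
  "L \<equiv> leavitt_path_algebra E"

abbreviation h :: "('v, 'e, 'k::field) lpa_free \<Rightarrow> ('v, 'e, 'k) lpa_free set" where
  "h \<equiv> lpa_of E"

text \<open>The free algebra without constant terms, whose classes make up the carrier. Every word
  in the support has a first and a last symbol, which is what lets the vertex sum act as a
  unit.\<close>

definition F0 :: "('v, 'e, 'k::field) lpa_free set" where
  "F0 = {f. Poly_Mapping.keys f \<subseteq> lists (lpa_gens E) - {[]}}"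

lemma F0_carrier: "f \<in> F0 \<Longrightarrow> f \<in> carrier F"
  by (auto simp: F0_def carrier_F)

lemma F0_iff: "f \<in> F0 \<longleftrightarrow> f \<in> carrier F \<and> Poly_Mapping.lookup f [] = 0"
  by (auto simp: F0_def carrier_F in_keys_iff)

lemma F0_mult:
  assumes "f \<in> carrier F" "g \<in> F0"
  shows "f * g \<in> F0" "g * f \<in> F0"
  using assms keys_mult_append[of f g] keys_mult_append[of g f]
  unfolding F0_def carrier_F by fastforce+

lemma F0_add: "f \<in> F0 \<Longrightarrow> g \<in> F0 \<Longrightarrow> f + g \<in> F0"
  by (auto simp: F0_iff F_closed lookup_add)

lemma vertex_sum_in_F0: "vertex_sum E \<in> F0"
  unfolding vertex_sum_def F0_iff
  by (auto simp: lookup_sum word_def lookup_single intro!: F_sum_closed F_closed)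

text \<open>A ghost edge runs backwards, so it starts at the range of its edge.\<close>

fun left_vertex :: "('v, 'e) lpa_gen \<Rightarrow> 'v" where
  "left_vertex (Vertex v) = v"
| "left_vertex (Edge e) = tail E e"
| "left_vertex (Ghost e) = head E e"

fun right_vertex :: "('v, 'e) lpa_gen \<Rightarrow> 'v" where
  "right_vertex (Vertex v) = v"
| "right_vertex (Edge e) = head E e"
| "right_vertex (Ghost e) = tail E e"

lemma end_vertices_in_verts:
  "x \<in> lpa_gens E \<Longrightarrow> left_vertex x \<in> verts E" "x \<in> lpa_gens E \<Longrightarrow> right_vertex x \<in> verts E"
  by (cases x; simp)+

lemma vertex_vertex_relator:
  "v \<in> verts E \<Longrightarrow> w \<in> verts E \<Longrightarrow>
    word [Vertex v, Vertex w] - (if v = w then word [Vertex v] else 0) \<in> lpa_ideal E"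
  by (rule relator_in_ideal) (auto simp: lpa_relators_def)

lemma left_vertex_relator:
  "x \<in> lpa_gens E \<Longrightarrow> word [Vertex (left_vertex x), x] - word [x] \<in> lpa_ideal E"
  by (cases x; intro relator_in_ideal) (auto simp: lpa_relators_def)

lemma right_vertex_relator:
  "x \<in> lpa_gens E \<Longrightarrow> word [x, Vertex (right_vertex x)] - word [x] \<in> lpa_ideal E"
  by (cases x; intro relator_in_ideal) (auto simp: lpa_relators_def)

text \<open>The relators only give \<open>x = u x\<close> for the left end \<open>u\<close> of
  \<open>x\<close>. For another vertex \<open>v\<close> the product vanishes because
  \<open>v x = v u x\<close> and \<open>v u = 0\<close>.\<close>

lemma vertex_mult_gen:
  fixes x :: "('v, 'e) lpa_gen"
  assumes v: "v \<in> verts E" and x: "x \<in> lpa_gens E"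
  shows "word [Vertex v, x] - (if v = left_vertex x then word [x] else 0)
    \<in> (lpa_ideal E :: ('v, 'e, 'k::field) lpa_free set)"
proof (cases "v = left_vertex x")
  case True
  then show ?thesis using left_vertex_relator[OF x] by simp
next
  case False
  let ?u = "left_vertex x"
  have "word [Vertex v, x] = word [Vertex v, Vertex ?u] * word [x]
      - word [Vertex v] * (word [Vertex ?u, x] - (word [x] :: ('v, 'e, 'k) lpa_free))"
    by (simp add: algebra_simps word_mult_word)
  moreover have "word [Vertex v, Vertex ?u] \<in> (lpa_ideal E :: ('v, 'e, 'k) lpa_free set)"
    using vertex_vertex_relator[OF v end_vertices_in_verts(1)[OF x]] False by simp
  ultimately show ?thesis
    using False v x
    by (auto intro!: lpa_ideal_diff lpa_ideal_closed(4)[OF left_vertex_relator[OF x]]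
        lpa_ideal_closed(5) F_closed)
qed

lemma gen_mult_vertex:
  fixes x :: "('v, 'e) lpa_gen"
  assumes v: "v \<in> verts E" and x: "x \<in> lpa_gens E"
  shows "word [x, Vertex v] - (if v = right_vertex x then word [x] else 0)
    \<in> (lpa_ideal E :: ('v, 'e, 'k::field) lpa_free set)"
proof (cases "v = right_vertex x")
  case True
  then show ?thesis using right_vertex_relator[OF x] by simp
next
  case False
  let ?u = "right_vertex x"
  have "word [x, Vertex v] = word [x] * word [Vertex ?u, Vertex v]
      - (word [x, Vertex ?u] - (word [x] :: ('v, 'e, 'k) lpa_free)) * word [Vertex v]"
    by (simp add: algebra_simps word_mult_word)
  moreover have "word [Vertex ?u, Vertex v] \<in> (lpa_ideal E :: ('v, 'e, 'k) lpa_free set)"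
    using vertex_vertex_relator[OF end_vertices_in_verts(2)[OF x] v] False by auto
  ultimately show ?thesis
    using False v x
    by (auto intro!: lpa_ideal_diff lpa_ideal_closed(5)[OF right_vertex_relator[OF x]]
        lpa_ideal_closed(4) F_closed)
qed

lemma vertex_sum_left_unit:
  fixes f :: "('v, 'e, 'k::field) lpa_free"
  assumes "f \<in> F0"
  shows "vertex_sum E * f - f \<in> lpa_ideal E"
proof (rule poly_mapping_keys_induct[where f = f])
  fix w :: "('v, 'e) lpa_gen list" and k :: 'k
  assume "w \<in> Poly_Mapping.keys f"
  then have lists_w: "w \<in> lists (lpa_gens E) - {[]}" using assms by (auto simp: F0_def)
  then obtain x u where w: "w = x # u" "x \<in> lpa_gens E" "u \<in> lists (lpa_gens E)"
    using lists_w by (cases w) auto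
  have split: "Poly_Mapping.single w k = word [x] * Poly_Mapping.single u k"
    by (simp add: word_def single_mult_single w)
  have "vertex_sum E * word [x] - word [x] =
      (\<Sum>v\<in>verts E. word [Vertex v, x] - (if v = left_vertex x then word [x] else 0 :: ('v, 'e, 'k) lpa_free))"
    using end_vertices_in_verts(1)[OF w(2)]
    by (simp add: vertex_sum_def sum_distrib_right word_mult_word sum_subtractf)
  also have "\<dots> \<in> lpa_ideal E"
    using vertex_mult_gen[OF _ w(2)] by (intro lpa_ideal_sum)
  finally have "(vertex_sum E * word [x] - word [x]) * Poly_Mapping.single u k \<in> lpa_ideal E"
    using w by (intro lpa_ideal_closed F_closed) auto
  then show "vertex_sum E * Poly_Mapping.single w k - Poly_Mapping.single w k \<in> lpa_ideal E"
    unfolding split by (simp add: algebra_simps)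
next
  fix f g :: "('v, 'e, 'k) lpa_free"
  assume "vertex_sum E * f - f \<in> lpa_ideal E" "vertex_sum E * g - g \<in> lpa_ideal E"
  from lpa_ideal_closed(2)[OF this] show "vertex_sum E * (f + g) - (f + g) \<in> lpa_ideal E"
    by (simp add: algebra_simps)
qed (simp add: lpa_ideal_closed)

lemma vertex_sum_right_unit:
  fixes f :: "('v, 'e, 'k::field) lpa_free"
  assumes "f \<in> F0"
  shows "f * vertex_sum E - f \<in> lpa_ideal E"
proof (rule poly_mapping_keys_induct[where f = f])
  fix w :: "('v, 'e) lpa_gen list" and k :: 'k
  assume "w \<in> Poly_Mapping.keys f"
  then have lists_w: "w \<in> lists (lpa_gens E) - {[]}" using assms by (auto simp: F0_def)
  then obtain x u where w: "w = u @ [x]" "x \<in> lpa_gens E" "u \<in> lists (lpa_gens E)"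
    using lists_w by (cases w rule: rev_cases) auto
  have split: "Poly_Mapping.single w k = Poly_Mapping.single u k * word [x]"
    by (simp add: word_def single_mult_single w)
  have "word [x] * vertex_sum E - word [x] =
      (\<Sum>v\<in>verts E. word [x, Vertex v] - (if v = right_vertex x then word [x] else 0 :: ('v, 'e, 'k) lpa_free))"
    using end_vertices_in_verts(2)[OF w(2)]
    by (simp add: vertex_sum_def sum_distrib_left word_mult_word sum_subtractf)
  also have "\<dots> \<in> lpa_ideal E"
    using gen_mult_vertex[OF _ w(2)] by (intro lpa_ideal_sum)
  finally have "Poly_Mapping.single u k * (word [x] * vertex_sum E - word [x]) \<in> lpa_ideal E"
    using w by (intro lpa_ideal_closed F_closed) auto
  then show "Poly_Mapping.single w k * vertex_sum E - Poly_Mapping.single w k \<in> lpa_ideal E"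
    unfolding split by (simp add: algebra_simps)
next
  fix f g :: "('v, 'e, 'k) lpa_free"
  assume "f * vertex_sum E - f \<in> lpa_ideal E" "g * vertex_sum E - g \<in> lpa_ideal E"
  from lpa_ideal_closed(2)[OF this] show "(f + g) * vertex_sum E - (f + g) \<in> lpa_ideal E"
    by (simp add: algebra_simps)
qed (simp add: lpa_ideal_closed)

lemma restrict_in_carrier: "restrict_gens (lpa_gens E) f \<in> carrier F"
  by (simp add: carrier_F keys_restrict_gens)

lemma normal_in_F0: "vertex_sum E * restrict_gens (lpa_gens E) f \<in> F0"
  by (rule F0_mult(2)[OF restrict_in_carrier vertex_sum_in_F0])

text \<open>The factor \<open>vertex_sum E\<close> in \<open>lpa_of\<close> is absorbed on
  \<open>F0\<close>, where \<open>h\<close> is therefore the quotient map itself.\<close>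

lemma lpa_of_F0:
  assumes "f \<in> F0"
  shows "h f = lpa_class E f"
proof -
  have "restrict_gens (lpa_gens E) f = f"
    using assms by (intro restrict_gens_id) (auto simp: F0_def)
  then show ?thesis
    unfolding lpa_of_def
    using vertex_sum_left_unit[OF assms] F0_carrier[OF assms] F0_carrier[OF vertex_sum_in_F0]
    by (subst lpa_class_eq_iff) (auto intro: F_closed(5))
qed

lemma lpa_of_eq_iff:
  "h f = h g \<longleftrightarrow>
    vertex_sum E * restrict_gens (lpa_gens E) f - vertex_sum E * restrict_gens (lpa_gens E) g \<in> lpa_ideal E"
  unfolding lpa_of_def by (rule lpa_class_eq_iff) (auto intro: F0_carrier normal_in_F0)

lemma carrier_L: "carrier L = range h"
proof -
  have "carrier L = lpa_class E ` F0"
    by (auto simp: leavitt_path_algebra_def F0_iff)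
  also have "\<dots> = range h"
    using lpa_of_F0 normal_in_F0 unfolding lpa_of_def by (fastforce simp: image_iff)
  finally show ?thesis .
qed

section \<open>The map \<open>h\<close> as a ring homomorphism onto the Leavitt path algebra\<close>

lemma lpa_class_plus:
  "f \<in> carrier F \<Longrightarrow> g \<in> carrier F \<Longrightarrow> lpa_class E f \<oplus>\<^bsub>L\<^esub> lpa_class E g = lpa_class E (f + g)"
  using ideal.a_rcos_sum[OF ideal_lpa_ideal, of f g]
  by (simp add: leavitt_path_algebra_def FactRing_def lpa_class_def)

lemma lpa_class_mult:
  "f \<in> carrier F \<Longrightarrow> g \<in> carrier F \<Longrightarrow> lpa_class E f \<otimes>\<^bsub>L\<^esub> lpa_class E g = lpa_class E (f * g)"
  using ideal.rcoset_mult_add[OF ideal_lpa_ideal, of f g]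
  by (simp add: leavitt_path_algebra_def FactRing_def lpa_class_def)

lemma h_add: "h f \<oplus>\<^bsub>L\<^esub> h g = h (f + g)"
  unfolding lpa_of_def
  by (subst lpa_class_plus) (auto intro: F0_carrier normal_in_F0 simp: restrict_gens_add distrib_left)

text \<open>The product of two normalised representatives has a second vertex sum in its middle; it
  is a right unit for the first representative, which lies in \<open>F0\<close>.\<close>

lemma h_mult: "h f \<otimes>\<^bsub>L\<^esub> h g = h (f * g)"
proof -
  let ?f = "restrict_gens (lpa_gens E) f" and ?g = "restrict_gens (lpa_gens E) g"
  have "(vertex_sum E * ?f * vertex_sum E - vertex_sum E * ?f) * ?g \<in> lpa_ideal E"
    by (intro lpa_ideal_closed vertex_sum_right_unit normal_in_F0 restrict_in_carrier)
  then have "lpa_class E (vertex_sum E * ?f * (vertex_sum E * ?g)) = lpa_class E (vertex_sum E * (?f * ?g))"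
    by (subst lpa_class_eq_iff)
      (auto intro!: F_closed F0_carrier[OF vertex_sum_in_F0] restrict_in_carrier simp: algebra_simps)
  then show ?thesis
    unfolding lpa_of_def
    by (subst lpa_class_mult) (auto intro: F0_carrier normal_in_F0 simp: restrict_gens_mult)
qed

lemma h_zero: "\<zero>\<^bsub>L\<^esub> = (h 0 :: ('v, 'e, 'k::field) lpa_free set)"
proof -
  have "lpa_class E 0 = (lpa_ideal E :: ('v, 'e, 'k) lpa_free set)"
    unfolding lpa_class_def
    using ring.a_rcos_zero[OF ring_F ideal_lpa_ideal lpa_ideal_closed(1)] .
  then show ?thesis by (simp add: leavitt_path_algebra_def FactRing_def lpa_of_def)
qed

lemma h_one: "\<one>\<^bsub>L\<^esub> = (h 1 :: ('v, 'e, 'k::field) lpa_free set)"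
proof -
  have "restrict_gens (lpa_gens E) 1 = (1 :: ('v, 'e, 'k) lpa_free)"
    by (rule restrict_gens_id) (simp add: zero_list_def)
  then show "\<one>\<^bsub>L\<^esub> = (h 1 :: ('v, 'e, 'k) lpa_free set)"
    by (simp add: leavitt_path_algebra_def lpa_of_def vertex_sum_def)
qed

lemma h_eq_zero_iff: "h f = h g \<longleftrightarrow> h (f - g) = h 0"
  using restrict_gens_add[of "lpa_gens E" "f - g" g]
  by (simp add: lpa_of_eq_iff algebra_simps)

lemma h_cong_add: "h f = h f' \<Longrightarrow> h g = h g' \<Longrightarrow> h (f + g) = h (f' + g')"
  by (simp flip: h_add)

lemma h_cong_mult: "h f = h f' \<Longrightarrow> h g = h g' \<Longrightarrow> h (f * g) = h (f' * g')"
  by (simp flip: h_mult)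

lemma h_cong_diff: "h f = h f' \<Longrightarrow> h g = h g' \<Longrightarrow> h (f - g) = h (f' - g')"
proof -
  assume "h f = h f'" "h g = h g'"
  then have "h (f - f') = h 0" "h (g' - g) = h 0" using h_eq_zero_iff by metis+
  from h_cong_add[OF this] show ?thesis
    by (subst h_eq_zero_iff) (simp add: algebra_simps)
qed

lemma h_cong_sum: "(\<And>i. i \<in> A \<Longrightarrow> h (f i) = h (g i)) \<Longrightarrow> h (sum f A) = h (sum g A)"
  by (induct A rule: infinite_finite_induct) (auto intro!: h_cong_add)

lemma ring_L: "ring (L :: ('v, 'e, 'k::field) lpa_free set ring)"
proof (rule ringI)
  show "abelian_group (L :: ('v, 'e, 'k) lpa_free set ring)"
  proof (rule abelian_groupI)
    fix x :: "('v, 'e, 'k) lpa_free set"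
    assume "x \<in> carrier L"
    then obtain f where "x = h f" by (auto simp: carrier_L)
    then show "\<exists>y\<in>carrier L. y \<oplus>\<^bsub>L\<^esub> x = \<zero>\<^bsub>L\<^esub>"
      by (intro bexI[of _ "h (- f)"]) (auto simp: carrier_L h_add h_zero)
  qed (auto simp: carrier_L h_add h_zero add_ac)
  show "Group.monoid (L :: ('v, 'e, 'k) lpa_free set ring)"
    by unfold_locales (auto simp: carrier_L h_mult h_one mult.assoc)
qed (auto simp: carrier_L h_add h_mult distrib_left distrib_right)

end


section \<open>Degrees, the involution and a representation\<close>

fun gen_degree :: "('v, 'e) lpa_gen \<Rightarrow> int" where
  "gen_degree (Vertex v) = 0"
| "gen_degree (Edge e) = 1"
| "gen_degree (Ghost e) = - 1"

definition word_degree :: "('v, 'e) lpa_gen list \<Rightarrow> int" where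
  "word_degree w = sum_list (map gen_degree w)"

lemma word_degree_simps [simp]:
  "word_degree [] = 0"
  "word_degree (x # w) = gen_degree x + word_degree w"
  "word_degree (a @ b) = word_degree a + word_degree b"
  "word_degree (map Edge p) = int (length p)"
  "word_degree (map Ghost p) = - int (length p)"
proof -
  show "word_degree (map Edge p) = int (length p)" "word_degree (map Ghost p) = - int (length p)"
    by (induct p) (simp_all add: word_degree_def)
qed (simp_all add: word_degree_def)

definition homogeneous :: "int \<Rightarrow> ('v, 'e, 'k::field) lpa_free \<Rightarrow> bool" where
  "homogeneous n f \<longleftrightarrow> (\<forall>w\<in>Poly_Mapping.keys f. word_degree w = n)"

definition degree_part :: "int \<Rightarrow> ('v, 'e, 'k::field) lpa_free \<Rightarrow> ('v, 'e, 'k) lpa_free" where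
  "degree_part n = lin_ext (\<lambda>w k. if word_degree w = n then Poly_Mapping.single w k else 0)"

lemma homogeneous_word: "homogeneous n (word w) \<longleftrightarrow> word_degree w = n"
  by (simp add: homogeneous_def word_def)

lemma homogeneous_single: "word_degree w = n \<Longrightarrow> homogeneous n (Poly_Mapping.single w k)"
  by (simp add: homogeneous_def)

lemma homogeneous_zero [simp]: "homogeneous n 0"
  by (simp add: homogeneous_def)

lemma homogeneous_add: "homogeneous n f \<Longrightarrow> homogeneous n g \<Longrightarrow> homogeneous n (f + g)"
  using keys_add[of f g] by (auto simp: homogeneous_def)

lemma homogeneous_uminus: "homogeneous n f \<Longrightarrow> homogeneous n (- f)"
  by (auto simp: homogeneous_def)

lemma homogeneous_diff: "homogeneous n f \<Longrightarrow> homogeneous n g \<Longrightarrow> homogeneous n (f - g)"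
  using homogeneous_add[of n f "- g"] homogeneous_uminus[of n g] by simp

lemma homogeneous_sum: "(\<And>i. i \<in> A \<Longrightarrow> homogeneous n (f i)) \<Longrightarrow> homogeneous n (sum f A)"
  by (induct A rule: infinite_finite_induct) (auto intro: homogeneous_add)

lemma homogeneous_mult: "homogeneous m f \<Longrightarrow> homogeneous n g \<Longrightarrow> homogeneous (m + n) (f * g)"
  using keys_mult_append[of f g] by (fastforce simp: homogeneous_def)

lemma degree_part_add: "degree_part n (f + g) = degree_part n f + degree_part n g"
  unfolding degree_part_def by (rule lin_ext_add) (auto simp: single_add)

lemma degree_part_zero [simp]: "degree_part n 0 = 0"
  by (simp add: degree_part_def)

lemma degree_part_single:
  "degree_part n (Poly_Mapping.single w k) = (if word_degree w = n then Poly_Mapping.single w k else 0)"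
  unfolding degree_part_def by (subst lin_ext_single) auto

lemma degree_part_sum: "degree_part n (sum f A) = (\<Sum>i\<in>A. degree_part n (f i))"
  by (induct A rule: infinite_finite_induct) (auto simp: degree_part_add)

lemma degree_part_homogeneous: "homogeneous m f \<Longrightarrow> degree_part n f = (if m = n then f else 0)"
  by (rule poly_mapping_keys_induct[where f = f])
    (auto simp: degree_part_add degree_part_single homogeneous_def)

lemma homogeneous_degree_part: "homogeneous n (degree_part n f)"
  by (rule poly_mapping_keys_induct[where f = f])
    (auto simp: degree_part_add degree_part_single intro: homogeneous_add homogeneous_single)

lemma degree_part_mult_left:
  assumes "homogeneous m x"
  shows "degree_part n (x * f) = x * degree_part (n - m) f"
proof (rule additive_map_eqI[where f = f])
  fix w k
  have "homogeneous (m + word_degree w) (x * Poly_Mapping.single w k)"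
    by (intro homogeneous_mult homogeneous_single assms refl)
  then show "degree_part n (x * Poly_Mapping.single w k) = x * degree_part (n - m) (Poly_Mapping.single w k)"
    by (auto simp: degree_part_homogeneous degree_part_single)
qed (auto simp: degree_part_add distrib_left)

lemma degree_part_mult_right:
  assumes "homogeneous m x"
  shows "degree_part n (f * x) = degree_part (n - m) f * x"
proof (rule additive_map_eqI[where f = f])
  fix w k
  have "homogeneous (word_degree w + m) (Poly_Mapping.single w k * x)"
    by (intro homogeneous_mult homogeneous_single assms refl)
  then show "degree_part n (Poly_Mapping.single w k * x) = degree_part (n - m) (Poly_Mapping.single w k) * x"
    by (auto simp: degree_part_homogeneous degree_part_single)
qed (auto simp: degree_part_add distrib_right)

lemma finite_degree_parts: "finite {n. degree_part n f \<noteq> 0}"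
proof (rule finite_subset)
  show "{n. degree_part n f \<noteq> 0} \<subseteq> word_degree ` Poly_Mapping.keys f"
  proof
    fix n assume n: "n \<in> {n. degree_part n f \<noteq> 0}"
    have "\<exists>w\<in>Poly_Mapping.keys f. word_degree w = n"
    proof (rule ccontr)
      assume no: "\<not> (\<exists>w\<in>Poly_Mapping.keys f. word_degree w = n)"
      have "degree_part n f = 0"
        unfolding degree_part_def lin_ext_def using no by (intro sum.neutral) auto
      then show False using n by simp
    qed
    then show "n \<in> word_degree ` Poly_Mapping.keys f" by blast
  qed
qed simp

lemma sum_degree_parts:
  assumes "finite A" "{n. degree_part n f \<noteq> 0} \<subseteq> A"
  shows "(\<Sum>n\<in>A. degree_part n f) = f"
proof -
  \<comment> \<open>The index set is enlarged so that it contains the degree of every monomial of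
    \<open>f\<close>; the added parts are zero.\<close>
  define B where "B = A \<union> word_degree ` Poly_Mapping.keys f"
  have B: "finite B" using assms by (simp add: B_def)
  have "(\<Sum>n\<in>A. degree_part n f) = (\<Sum>n\<in>B. degree_part n f)"
    using assms B by (intro sum.mono_neutral_left) (auto simp: B_def)
  also have "\<dots> = f"
  proof (rule additive_map_eqI[where f = f])
    fix w k assume "w \<in> Poly_Mapping.keys f"
    then have "word_degree w \<in> B" by (simp add: B_def)
    then show "(\<Sum>n\<in>B. degree_part n (Poly_Mapping.single w k)) = Poly_Mapping.single w k"
      using B by (simp add: degree_part_single)
  qed (auto simp: degree_part_add sum.distrib)
  finally show ?thesis .
qed

lemma degree_part_restrict_gens:
  "degree_part n (restrict_gens X f) = restrict_gens X (degree_part n f)"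
  by (rule additive_map_eqI[where f = f])
    (auto simp: degree_part_add restrict_gens_add degree_part_single restrict_gens_single)

fun gen_star :: "('v, 'e) lpa_gen \<Rightarrow> ('v, 'e) lpa_gen" where
  "gen_star (Vertex v) = Vertex v"
| "gen_star (Edge e) = Ghost e"
| "gen_star (Ghost e) = Edge e"

definition word_star :: "('v, 'e) lpa_gen list \<Rightarrow> ('v, 'e) lpa_gen list" where
  "word_star w = rev (map gen_star w)"

lemma gen_star_gen_star [simp]: "gen_star (gen_star x) = x"
  by (cases x) auto

lemma word_star_simps [simp]:
  "word_star [] = []"
  "word_star (x # w) = word_star w @ [gen_star x]"
  "word_star (a @ b) = word_star b @ word_star a"
  "word_star (word_star w) = w"
  "word_star (map Edge p) = map Ghost (rev p)"
  "word_star (map Ghost p) = map Edge (rev p)"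
  by (simp_all add: word_star_def rev_map comp_def)

lemma word_degree_word_star [simp]: "word_degree (word_star w) = - word_degree w"
proof (induct w)
  case (Cons x w)
  then show ?case by (cases x) auto
qed simp

locale field_involution =
  fixes bar :: "'k::field \<Rightarrow> 'k"
  assumes bar_add: "bar (x + y) = bar x + bar y"
    and bar_mult: "bar (x * y) = bar y * bar x"
    and bar_bar: "bar (bar x) = x"
begin

lemma bar_zero: "bar 0 = 0"
  using bar_add[of 0 0] by (metis add_0 add_right_imp_eq)

lemma bar_one: "bar 1 = 1"
  using bar_mult[of "bar 1" 1] by (simp add: bar_bar)

definition star :: "('v, 'e, 'k) lpa_free \<Rightarrow> ('v, 'e, 'k) lpa_free" where
  "star = lin_ext (\<lambda>w k. Poly_Mapping.single (word_star w) (bar k))"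

lemma star_add: "star (f + g) = star f + star g"
  unfolding star_def by (rule lin_ext_add) (auto simp: bar_zero bar_add single_add)

lemma star_zero [simp]: "star 0 = 0"
  by (simp add: star_def)

lemma star_single: "star (Poly_Mapping.single w k) = Poly_Mapping.single (word_star w) (bar k)"
  unfolding star_def by (subst lin_ext_single) (auto simp: bar_zero)

lemma star_word [simp]: "star (word w) = word (word_star w)"
  by (simp add: word_def star_single bar_one)

lemma star_uminus: "star (- f) = - star f"
  using star_add[of f "- f"] by (simp add: eq_neg_iff_add_eq_0 add.commute)

lemma star_diff: "star (f - g) = star f - star g"
  using star_add[of f "- g"] by (simp add: star_uminus)

lemma star_sum: "star (sum f A) = (\<Sum>i\<in>A. star (f i))"
  by (induct A rule: infinite_finite_induct) (auto simp: star_add)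

lemma star_mult: "star (f * g) = star g * star f"
proof (rule additive_map_eqI[where f = f])
  fix a k
  show "star (Poly_Mapping.single a k * g) = star g * star (Poly_Mapping.single a k)"
    by (rule additive_map_eqI[where f = g])
      (auto simp: star_add star_single single_mult_single distrib_left distrib_right bar_mult)
qed (auto simp: star_add distrib_left distrib_right)

lemma star_star [simp]: "star (star f) = f"
  by (rule additive_map_eqI[where f = f]) (auto simp: star_add star_single bar_bar)

lemma homogeneous_star: "homogeneous n f \<Longrightarrow> homogeneous (- n) (star f)"
proof -
  assume f: "homogeneous n f"
  have "star f = (\<Sum>w\<in>Poly_Mapping.keys f. Poly_Mapping.single (word_star w) (bar (Poly_Mapping.lookup f w)))"
    by (simp add: star_def lin_ext_def)
  then show ?thesis
    using f by (auto simp: homogeneous_def[of n] intro!: homogeneous_sum homogeneous_single)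
qed

end

section \<open>Degree parts on the quotient\<close>

context lpa_graph
begin

lemma relator_homogeneous: "r \<in> lpa_relators E \<Longrightarrow> \<exists>n. homogeneous n r"
proof -
  assume "r \<in> lpa_relators E"
  then have "homogeneous 0 r \<or> homogeneous 1 r \<or> homogeneous (- 1) r"
    unfolding lpa_relators_def
    by (elim UnE CollectE exE conjE)
      (auto intro!: homogeneous_diff homogeneous_sum simp: homogeneous_word)
  then show ?thesis by blast
qed

lemma lpa_ideal_sandwich:
  "f \<in> lpa_ideal E \<Longrightarrow> x \<in> carrier F \<Longrightarrow> y \<in> carrier F \<Longrightarrow> x * f * y \<in> lpa_ideal E"
  by (intro lpa_ideal_closed(5) lpa_ideal_closed(4))

text \<open>An ideal generated by homogeneous elements is graded. This makes degree parts well
  defined on the algebra and is the source of the uniqueness of decompositions.\<close>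

lemma degree_part_lpa_ideal: "f \<in> lpa_ideal E \<Longrightarrow> degree_part n f \<in> lpa_ideal E"
proof (erule lpa_ideal_induct)
  fix r :: "('v, 'e, 'k::field) lpa_free" and a b k l
  assume r: "r \<in> lpa_relators E" "a \<in> lists (lpa_gens E)" "b \<in> lists (lpa_gens E)"
  obtain m where "homogeneous m r" using relator_homogeneous[OF r(1)] by blast
  then have "homogeneous (word_degree a + m + word_degree b) (Poly_Mapping.single a k * r * Poly_Mapping.single b l)"
    by (intro homogeneous_mult homogeneous_single refl)
  then show "degree_part n (Poly_Mapping.single a k * r * Poly_Mapping.single b l) \<in> lpa_ideal E"
    using lpa_ideal_sandwich[OF relator_in_ideal[OF r(1)] F_closed(6)[OF r(2)] F_closed(6)[OF r(3)]]
    by (simp add: degree_part_homogeneous lpa_ideal_closed(1))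
qed (auto simp: degree_part_add intro: lpa_ideal_closed)

lemma homogeneous_vertex_sum: "homogeneous 0 (vertex_sum E)"
  unfolding vertex_sum_def by (intro homogeneous_sum) (simp add: homogeneous_word)

lemma h_degree_part_zero: "h f = h 0 \<Longrightarrow> h (degree_part n f) = h 0"
  using degree_part_lpa_ideal[of "vertex_sum E * restrict_gens (lpa_gens E) f" n]
  by (simp add: lpa_of_eq_iff degree_part_mult_left[OF homogeneous_vertex_sum] degree_part_restrict_gens)

lemma h_degree_part:
  assumes "h f = h g"
  shows "h (degree_part n f) = h (degree_part n g)"
proof -
  have "degree_part n (f - g) = degree_part n f - degree_part n g"
    using degree_part_add[of n "f - g" g] by simp
  then show ?thesis using assms h_degree_part_zero[of "f - g" n] by (metis h_eq_zero_iff)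
qed

end

section \<open>The involution on the quotient\<close>

locale lpa_star_graph = lpa_graph E + field_involution bar
  for E :: "('v, 'e) pre_digraph" and bar :: "'k::field \<Rightarrow> 'k"
begin

text \<open>The involution exchanges the vertex relations of edges with those of ghost edges and
  maps each of the other families to itself.\<close>

lemma star_relator: "r \<in> lpa_relators E \<Longrightarrow> star r \<in> lpa_relators E"
  unfolding lpa_relators_def
  by (elim UnE CollectE exE conjE; simp add: star_diff star_sum if_distrib[of star] cong: if_cong)
    (blast | metis)+

lemma word_star_lists: "w \<in> lists (lpa_gens E) \<Longrightarrow> word_star w \<in> lists (lpa_gens E)"
proof (induct w)
  case (Cons x w)
  then show ?case by (cases x) auto
qed simp

lemma star_lpa_ideal: "f \<in> lpa_ideal E \<Longrightarrow> star f \<in> lpa_ideal E"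
proof (erule lpa_ideal_induct)
  fix r :: "('v, 'e, 'k) lpa_free" and a b k l
  assume r: "r \<in> lpa_relators E" "a \<in> lists (lpa_gens E)" "b \<in> lists (lpa_gens E)"
  show "star (Poly_Mapping.single a k * r * Poly_Mapping.single b l) \<in> lpa_ideal E"
    using lpa_ideal_sandwich[OF relator_in_ideal[OF star_relator[OF r(1)]]
        F_closed(6)[OF word_star_lists[OF r(3)]] F_closed(6)[OF word_star_lists[OF r(2)]]]
    by (simp add: star_mult star_single mult.assoc)
qed (auto simp: star_add intro: lpa_ideal_closed)

lemma star_restrict_gens:
  "star (restrict_gens (lpa_gens E) f) = restrict_gens (lpa_gens E) (star f)"
proof (rule additive_map_eqI[where f = f])
  fix w k
  have "word_star w \<in> lists (lpa_gens E) \<longleftrightarrow> w \<in> lists (lpa_gens E)"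
    using word_star_lists[of w] word_star_lists[of "word_star w"] by auto
  then show "star (restrict_gens (lpa_gens E) (Poly_Mapping.single w k)) =
      restrict_gens (lpa_gens E) (star (Poly_Mapping.single w k))"
    by (simp add: restrict_gens_single star_single)
qed (auto simp: star_add restrict_gens_add)

lemma star_vertex_sum: "star (vertex_sum E) = vertex_sum E"
  by (simp add: vertex_sum_def star_sum)

text \<open>Both products agree modulo the relations with the one that has the vertex sum on either
  side of \<open>f\<close>. The lemma is needed because \<open>star\<close> moves the vertex sum in
  \<open>lpa_of\<close> from the left to the right.\<close>

lemma vertex_sum_commute:
  fixes f :: "('v, 'e, 'k) lpa_free"
  assumes f: "f \<in> carrier F"
  shows "vertex_sum E * f - f * vertex_sum E \<in> lpa_ideal E"
proof -
  have "vertex_sum E * (f * vertex_sum E) - f * vertex_sum E \<in> lpa_ideal E"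
    by (rule vertex_sum_left_unit[OF F0_mult(1)[OF f vertex_sum_in_F0]])
  moreover have "vertex_sum E * f * vertex_sum E - vertex_sum E * f \<in> lpa_ideal E"
    by (rule vertex_sum_right_unit[OF F0_mult(2)[OF f vertex_sum_in_F0]])
  ultimately show ?thesis
    using lpa_ideal_diff[of "vertex_sum E * (f * vertex_sum E) - f * vertex_sum E"
        "vertex_sum E * f * vertex_sum E - vertex_sum E * f"]
    by (simp add: mult.assoc)
qed

lemma h_star_zero: "h f = h 0 \<Longrightarrow> h (star f) = h 0"
proof -
  assume "h f = h 0"
  then have "star (vertex_sum E * restrict_gens (lpa_gens E) f) \<in> lpa_ideal E"
    by (intro star_lpa_ideal) (simp add: lpa_of_eq_iff)
  then have "restrict_gens (lpa_gens E) (star f) * vertex_sum E \<in> lpa_ideal E"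
    by (simp add: star_mult star_restrict_gens star_vertex_sum)
  from lpa_ideal_closed(2)[OF vertex_sum_commute[OF restrict_in_carrier, of "star f"] this]
  show ?thesis by (simp add: lpa_of_eq_iff)
qed

lemma h_star:
  assumes "h f = h g"
  shows "h (star f) = h (star g)"
  using assms h_star_zero[of "f - g"] by (metis h_eq_zero_iff star_diff)

end


subsection \<open>Vertices are nonzero\<close>

text \<open>Functions on \<open>E\<^sup>0 \<times> \<nat>\<close> form a representation once, for every vertex \<open>v\<close> that is not a sink,
  the set \<open>{v} \<times> \<nat>\<close> is identified with the disjoint union of the sets \<open>{r(e)} \<times> \<nat>\<close> over
  the edges \<open>e\<close> emitted by \<open>v\<close>; \<open>glue\<close> and \<open>cut\<close> are this identification and its inverse.\<close>

locale branching =
  fixes E :: "('v, 'e) pre_digraph" and glue :: "'e \<times> nat \<Rightarrow> nat" and cut :: "'v \<Rightarrow> nat \<Rightarrow> 'e \<times> nat"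
  assumes cut_glue: "e \<in> arcs E \<Longrightarrow> cut (tail E e) (glue (e, n)) = (e, n)"
    and glue_cut: "out_arcs E v \<noteq> {} \<Longrightarrow> glue (cut v n) = n"
    and cut_out_arcs: "out_arcs E v \<noteq> {} \<Longrightarrow> fst (cut v n) \<in> out_arcs E v"
begin

fun act_domain :: "('v, 'e) lpa_gen \<Rightarrow> 'v \<times> nat \<Rightarrow> bool" where
  "act_domain (Vertex v) (u, n) \<longleftrightarrow> u = v"
| "act_domain (Edge e) (u, n) \<longleftrightarrow> u = tail E e \<and> fst (cut u n) = e"
| "act_domain (Ghost e) (u, n) \<longleftrightarrow> u = head E e"

fun act_point :: "('v, 'e) lpa_gen \<Rightarrow> 'v \<times> nat \<Rightarrow> 'v \<times> nat" where
  "act_point (Vertex v) (u, n) = (u, n)"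
| "act_point (Edge e) (u, n) = (head E e, snd (cut u n))"
| "act_point (Ghost e) (u, n) = (tail E e, glue (e, n))"

text \<open>A generator acts by composition with a partial map of points, extended by zero: an edge
  moves a point of its branch from the source to the range, and the ghost edge moves it
  back.\<close>

definition gen_act :: "('v, 'e) lpa_gen \<Rightarrow> ('v \<times> nat \<Rightarrow> 'k::field) \<Rightarrow> 'v \<times> nat \<Rightarrow> 'k" where
  "gen_act x \<xi> z = (if act_domain x z then \<xi> (act_point x z) else 0)"

definition word_act :: "('v, 'e) lpa_gen list \<Rightarrow> ('v \<times> nat \<Rightarrow> 'k::field) \<Rightarrow> 'v \<times> nat \<Rightarrow> 'k" where
  "word_act w = foldr gen_act w"

definition poly_act :: "('v, 'e, 'k::field) lpa_free \<Rightarrow> ('v \<times> nat \<Rightarrow> 'k) \<Rightarrow> 'v \<times> nat \<Rightarrow> 'k" where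
  "poly_act f \<xi> x = lin_ext (\<lambda>w k. k * word_act w \<xi> x) f"

lemma word_act_simps [simp]:
  "word_act [] \<xi> = \<xi>"
  "word_act (x # w) \<xi> = gen_act x (word_act w \<xi>)"
  "word_act (a @ b) \<xi> = word_act a (word_act b \<xi>)"
  by (simp_all add: word_act_def)

lemma gen_act_linear:
  "gen_act x (\<lambda>y. c * \<xi> y + \<eta> y) z = c * gen_act x \<xi> z + gen_act x \<eta> z"
  by (simp add: gen_act_def)

lemma word_act_linear:
  "word_act w (\<lambda>y. c * \<xi> y + \<eta> y) z = c * word_act w \<xi> z + word_act w \<eta> z"
proof (induct w arbitrary: z)
  case (Cons x w)
  have "word_act w (\<lambda>y. c * \<xi> y + \<eta> y) = (\<lambda>z. c * word_act w \<xi> z + word_act w \<eta> z)"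
    using Cons by blast
  then show ?case by (simp add: gen_act_linear)
qed simp

lemma word_act_zero: "word_act w (\<lambda>y. 0) z = 0"
  using word_act_linear[of w "- 1" "\<lambda>y. 0" "\<lambda>y. 0" z] by simp

lemma poly_act_add: "poly_act (f + g) \<xi> x = poly_act f \<xi> x + poly_act g \<xi> x"
  unfolding poly_act_def by (rule lin_ext_add) (auto simp: distrib_right)

lemma poly_act_zero: "poly_act 0 \<xi> x = 0"
  by (simp add: poly_act_def)

lemma poly_act_single: "poly_act (Poly_Mapping.single w k) \<xi> x = k * word_act w \<xi> x"
  by (simp add: poly_act_def lin_ext_single)

lemma poly_act_word: "poly_act (word w) \<xi> x = word_act w \<xi> x"
  by (simp add: word_def poly_act_single)

lemma poly_act_diff: "poly_act (f - g) \<xi> x = poly_act f \<xi> x - poly_act g \<xi> x"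
  using poly_act_add[of "f - g" g \<xi> x] by simp

lemma poly_act_sum: "poly_act (sum f A) \<xi> x = (\<Sum>i\<in>A. poly_act (f i) \<xi> x)"
  by (induct A rule: infinite_finite_induct) (auto simp: poly_act_add poly_act_zero)

lemma poly_act_mult_single:
  "poly_act (f * Poly_Mapping.single b l) \<xi> x = l * poly_act f (word_act b \<xi>) x"
  by (rule additive_map_eqI[where f = f])
    (auto simp: poly_act_add poly_act_zero distrib_left distrib_right poly_act_single single_mult_single)

lemma poly_act_single_mult:
  "poly_act (Poly_Mapping.single a k * f) \<xi> x = k * word_act a (poly_act f \<xi>) x"
proof (rule additive_map_eqI[where f = f])
  fix w and c :: 'a
  have "word_act a (\<lambda>y. c * word_act w \<xi> y) x = c * word_act a (word_act w \<xi>) x"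
    using word_act_linear[of a c "word_act w \<xi>" "\<lambda>y. 0" x] by (simp add: word_act_zero)
  moreover have "poly_act (Poly_Mapping.single w c) \<xi> = (\<lambda>y. c * word_act w \<xi> y)"
    by (simp add: fun_eq_iff poly_act_single)
  ultimately show "poly_act (Poly_Mapping.single a k * Poly_Mapping.single w c) \<xi> x =
      k * word_act a (poly_act (Poly_Mapping.single w c) \<xi>) x"
    by (simp add: poly_act_single single_mult_single)
next
  fix f g :: "('v, 'e, 'a) lpa_free"
  have "poly_act (f + g) \<xi> = (\<lambda>y. 1 * poly_act f \<xi> y + poly_act g \<xi> y)"
    by (simp add: fun_eq_iff poly_act_add)
  then have "word_act a (poly_act (f + g) \<xi>) x = word_act a (poly_act f \<xi>) x + word_act a (poly_act g \<xi>) x"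
    by (simp only: word_act_linear) simp
  then show "k * word_act a (poly_act (f + g) \<xi>) x =
      k * word_act a (poly_act f \<xi>) x + k * word_act a (poly_act g \<xi>) x"
    by (simp add: distrib_left)
next
  have "poly_act 0 \<xi> = (\<lambda>y. 0)" by (simp add: fun_eq_iff poly_act_zero)
  then show "k * word_act a (poly_act 0 \<xi>) x = 0" by (simp add: word_act_zero)
qed (auto simp: poly_act_add poly_act_zero distrib_left)

lemma relator_act:
  assumes "r \<in> lpa_relators E"
  shows "poly_act r \<xi> x = 0"
proof -
  obtain u n where x: "x = (u, n)" by (cases x)
  have CK: "poly_act ((\<Sum>e\<in>out_arcs E v. word [Edge e, Ghost e]) - word [Vertex v]) \<xi> x = 0"
    if v: "regular_vertex E v" for v
  proof (cases "u = v")
    case True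
    have v': "out_arcs E v \<noteq> {}" "finite (out_arcs E v)" using v by (auto simp: regular_vertex_def)
    \<comment> \<open>Only the edge whose branch contains the point contributes to the sum, and
      gluing undoes cutting.\<close>
    have "word_act [Edge e, Ghost e] \<xi> x = (if e = fst (cut v n) then \<xi> x else 0)"
      if "e \<in> out_arcs E v" for e
      using glue_cut[OF v'(1), of n] that x True by (cases "cut v n") (auto simp: gen_act_def)
    then show ?thesis
      using v' cut_out_arcs[OF v'(1), of n] x True
      by (simp add: poly_act_diff poly_act_sum poly_act_word del: word_act_simps) (simp add: gen_act_def)
  next
    case False
    then show ?thesis by (auto simp: poly_act_diff poly_act_sum poly_act_word x gen_act_def intro!: sum.neutral)
  qed
  show ?thesis
  proof (cases "\<exists>v. regular_vertex E v \<and> r = (\<Sum>e\<in>out_arcs E v. word [Edge e, Ghost e]) - word [Vertex v]")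
    case True
    then show ?thesis using CK by blast
  next
    case False
    then show ?thesis
      using assms unfolding lpa_relators_def
      by (elim UnE CollectE exE conjE)
        (auto simp: poly_act_diff poly_act_word poly_act_zero x cut_glue gen_act_def)
  qed
qed

end

context lpa_graph
begin

text \<open>A nonempty finite set of edges times the naturals is countably infinite and hence in
  bijection with the naturals.\<close>

lemma branching_exists: "\<exists>glue cut. branching E glue cut"
proof -
  have "\<exists>g. bij_betw g (out_arcs E v \<times> (UNIV :: nat set)) (UNIV :: nat set)"
    if v: "out_arcs E v \<noteq> {}" for v
  proof -
    have "countable (out_arcs E v \<times> (UNIV :: nat set))" using finite_out_arcs by (simp add: countable_finite)
    moreover have "infinite (out_arcs E v \<times> (UNIV :: nat set))"
      using v finite_cartesian_productD2 by blast
    ultimately show ?thesis by (metis countableE_infinite)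
  qed
  then obtain g where g: "\<And>v. out_arcs E v \<noteq> {} \<Longrightarrow>
      bij_betw (g v) (out_arcs E v \<times> (UNIV :: nat set)) (UNIV :: nat set)"
    by metis
  define glue where "glue = (\<lambda>(e, n). g (tail E e) (e, n))"
  define cut where "cut = (\<lambda>v. inv_into (out_arcs E v \<times> UNIV) (g v))"
  have "branching E glue cut"
  proof
    fix e and n :: nat assume e: "e \<in> arcs E"
    then have mem: "(e, n) \<in> out_arcs E (tail E e) \<times> UNIV" by simp
    then have "inj_on (g (tail E e)) (out_arcs E (tail E e) \<times> UNIV)"
      using g bij_betw_imp_inj_on by blast
    then show "cut (tail E e) (glue (e, n)) = (e, n)"
      unfolding cut_def glue_def using inv_into_f_f[OF _ mem] by simp
  next
    fix v and n :: nat assume v: "out_arcs E v \<noteq> {}"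
    have img: "g v ` (out_arcs E v \<times> UNIV) = UNIV" using g[OF v] by (rule bij_betw_imp_surj_on)
    have mem: "cut v n \<in> out_arcs E v \<times> UNIV"
      unfolding cut_def by (rule inv_into_into) (simp add: img)
    then show "fst (cut v n) \<in> out_arcs E v" by auto
    have "g v (cut v n) = n" unfolding cut_def by (rule f_inv_into_f) (simp add: img)
    then show "glue (cut v n) = n" using mem unfolding glue_def by (cases "cut v n") auto
  qed
  then show ?thesis by blast
qed

lemma vertex_not_in_ideal:
  "word [Vertex v] \<notin> (lpa_ideal E :: ('v, 'e, 'k::field) lpa_free set)"
proof
  obtain glue cut where "branching E glue cut" using branching_exists by blast
  then interpret branching E glue cut .
  assume "(word [Vertex v] :: ('v, 'e, 'k) lpa_free) \<in> lpa_ideal E"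
  then have "\<forall>\<xi> x. poly_act (word [Vertex v] :: ('v, 'e, 'k) lpa_free) \<xi> x = 0"
  proof (rule lpa_ideal_induct)
    fix r :: "('v, 'e, 'k) lpa_free" and a b k l
    assume "r \<in> lpa_relators E"
    then have "poly_act r \<xi> = (\<lambda>x. 0)" for \<xi> using relator_act by blast
    then show "\<forall>\<xi> x. poly_act (Poly_Mapping.single a k * r * Poly_Mapping.single b l) \<xi> x = 0"
      by (simp add: poly_act_mult_single poly_act_single_mult word_act_zero)
  qed (auto simp: poly_act_add poly_act_zero)
  \<comment> \<open>On the constant function one, \<open>v\<close> acts with value one at every
    point over \<open>v\<close>.\<close>
  from this[rule_format, of "\<lambda>_. 1" "(v, 0)"] show False by (simp add: poly_act_word gen_act_def)
qed

lemma h_F0_eq_iff: "f \<in> F0 \<Longrightarrow> g \<in> F0 \<Longrightarrow> h f = h g \<longleftrightarrow> f - g \<in> lpa_ideal E"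
  by (simp add: lpa_of_F0 lpa_class_eq_iff F0_carrier)

lemma word_in_F0: "w \<noteq> [] \<Longrightarrow> w \<in> lists (lpa_gens E) \<Longrightarrow> word w \<in> F0"
  by (simp add: F0_def word_def)

lemma zero_in_F0: "0 \<in> F0"
  by (simp add: F0_def)

end

context lpa_star_graph
begin

abbreviation hw :: "('v, 'e) lpa_gen list \<Rightarrow> ('v, 'e, 'k) lpa_free set" where
  "hw w \<equiv> h (word w)"

lemma vertex_nonzero: "v \<in> verts E \<Longrightarrow> hw [Vertex v] \<noteq> h 0"
  using vertex_not_in_ideal[of v] by (simp add: h_F0_eq_iff word_in_F0 zero_in_F0)


subsection \<open>Calculating with words\<close>

lemma hw_bad: "w \<notin> lists (lpa_gens E) \<Longrightarrow> hw w = h 0"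
  by (simp add: lpa_of_def word_def restrict_gens_single)

lemma hw_cong: "hw x = hw y \<Longrightarrow> hw (a @ x @ b) = hw (a @ y @ b)"
  using h_cong_mult[OF refl h_cong_mult[OF _ refl], of "word x" "word y" "word a" "word b"]
  by (simp add: word_mult_word)

lemma hw_cong_zero: "hw x = h 0 \<Longrightarrow> hw (a @ x @ b) = h 0"
  using h_cong_mult[OF refl h_cong_mult[OF _ refl], of "word x" 0 "word a" "word b"]
  by (simp add: word_mult_word)

text \<open>For symbols foreign to the graph both sides vanish, since \<open>h\<close> kills such
  words; this makes the equation a rewrite rule without side conditions.\<close>

lemma hw_left_vertex: "hw [Vertex v, x] = (if v = left_vertex x then hw [x] else h 0)"
proof (cases "v \<in> verts E \<and> x \<in> lpa_gens E")
  case True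
  then have "hw [Vertex v, x] = h (if v = left_vertex x then word [x] else 0)"
    using vertex_mult_gen[of v x] by (subst h_F0_eq_iff) (auto simp: word_in_F0 zero_in_F0)
  then show ?thesis by simp
next
  case False
  then have "hw [Vertex v, x] = h 0" by (intro hw_bad) auto
  moreover have "hw [x] = h 0" if "v = left_vertex x"
    using False that end_vertices_in_verts(1)[of x] by (intro hw_bad) auto
  ultimately show ?thesis by simp
qed

lemma hw_right_vertex: "hw [x, Vertex v] = (if v = right_vertex x then hw [x] else h 0)"
proof (cases "v \<in> verts E \<and> x \<in> lpa_gens E")
  case True
  then have "hw [x, Vertex v] = h (if v = right_vertex x then word [x] else 0)"
    using gen_mult_vertex[of v x] by (subst h_F0_eq_iff) (auto simp: word_in_F0 zero_in_F0)
  then show ?thesis by simp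
next
  case False
  then have "hw [x, Vertex v] = h 0" by (intro hw_bad) auto
  moreover have "hw [x] = h 0" if "v = right_vertex x"
    using False that end_vertices_in_verts(2)[of x] by (intro hw_bad) auto
  ultimately show ?thesis by simp
qed

lemma hw_ghost_edge:
  assumes "e \<in> arcs E"
  shows "hw [Ghost e, Edge e'] = (if e = e' then hw [Vertex (head E e)] else h 0)"
proof (cases "e' \<in> arcs E")
  case True
  then have "word [Ghost e, Edge e'] - (if e = e' then word [Vertex (head E e)] else 0) \<in> (lpa_ideal E :: ('v, 'e, 'k) lpa_free set)"
    using assms by (intro relator_in_ideal) (auto simp: lpa_relators_def)
  then have "hw [Ghost e, Edge e'] = h (if e = e' then word [Vertex (head E e)] else 0)"
    using True assms by (subst h_F0_eq_iff) (auto simp: word_in_F0 zero_in_F0)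
  then show ?thesis by simp
next
  case False
  then show ?thesis using assms by (auto simp: hw_bad)
qed

lemma h_CK2:
  assumes "v \<in> verts E" "out_arcs E v \<noteq> {}"
  shows "h (\<Sum>e\<in>out_arcs E v. word [Edge e, Ghost e]) = hw [Vertex v]"
proof -
  have "regular_vertex E v" using assms finite_out_arcs by (simp add: regular_vertex_def)
  then have "(\<Sum>e\<in>out_arcs E v. word [Edge e, Ghost e]) - word [Vertex v] \<in> (lpa_ideal E :: ('v, 'e, 'k) lpa_free set)"
    by (intro relator_in_ideal) (unfold lpa_relators_def, blast)
  moreover have "(\<Sum>e\<in>out_arcs E v. word [Edge e, Ghost e]) \<in> (F0 :: ('v, 'e, 'k) lpa_free set)"
    unfolding F0_iff by (auto simp: lookup_sum word_def lookup_single intro!: F_sum_closed F_closed)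
  ultimately show ?thesis using assms by (subst h_F0_eq_iff) (auto simp: word_in_F0)
qed

lemma h_vertex_sum: "h (vertex_sum E) = h (1 :: ('v, 'e, 'k) lpa_free)"
  using h_one by (simp add: leavitt_path_algebra_def lpa_of_F0[OF vertex_sum_in_F0] flip: vertex_sum_def)

lemma single_eq_scalar_word: "Poly_Mapping.single w k = Poly_Mapping.single [] k * word w"
  by (simp add: word_def single_mult_single)

lemma h_single_cong: "hw x = hw y \<Longrightarrow> h (Poly_Mapping.single x k) = h (Poly_Mapping.single y (k :: 'k))"
  using h_cong_mult[OF refl, of "word x" "word y" "Poly_Mapping.single [] k"]
  by (simp add: word_def single_mult_single)

lemma h_single_cong_zero: "hw x = h 0 \<Longrightarrow> h (Poly_Mapping.single x (k :: 'k)) = h 0"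
  using h_cong_mult[OF refl, of "word x" 0 "Poly_Mapping.single [] k"]
  by (simp add: word_def single_mult_single)

end


section \<open>Paths in the Leavitt path algebra\<close>

context lpa_star_graph
begin

text \<open>The monomial \<open>p q^*\<close> with both end vertices written out, so that empty
  lists need no separate treatment. The lists need not be walks; if they do not fit together, the
  word vanishes in the algebra.\<close>

abbreviation path_mon :: "'v \<Rightarrow> 'e list \<Rightarrow> 'e list \<Rightarrow> 'v \<Rightarrow> ('v, 'e) lpa_gen list" where
  "path_mon u p q v \<equiv> Vertex u # map Edge p @ map Ghost (rev q) @ [Vertex v]"

lemma hw_Cons_cong: "hw x = hw y \<Longrightarrow> hw (g # x) = hw (g # y)"
  using hw_cong[of x y "[g]" "[]"] by simp

lemma hw_Cons_zero: "hw x = h 0 \<Longrightarrow> hw (g # x) = h 0"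
  using hw_cong_zero[of x "[g]" "[]"] by simp

lemma hw_vertex_Cons: "hw (Vertex v # x # w) = (if v = left_vertex x then hw (x # w) else h 0)"
  using hw_cong[of "[Vertex v, x]" "[x]" "[]" w] hw_cong_zero[of "[Vertex v, x]" "[]" w]
  by (cases "v = left_vertex x") (simp_all add: hw_left_vertex)

lemma hw_Cons_vertex: "hw (x # Vertex v # w) = (if v = right_vertex x then hw (x # w) else h 0)"
  using hw_cong[of "[x, Vertex v]" "[x]" "[]" w] hw_cong_zero[of "[x, Vertex v]" "[]" w]
  by (cases "v = right_vertex x") (simp_all add: hw_right_vertex)

lemma hw_ghost_edge_Cons:
  "e \<in> arcs E \<Longrightarrow> hw (Ghost e # Edge e' # w) = (if e = e' then hw (Vertex (head E e) # w) else h 0)"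
  using hw_cong[of "[Ghost e, Edge e']" "[Vertex (head E e)]" "[]" w]
    hw_cong_zero[of "[Ghost e, Edge e']" "[]" w]
  by (cases "e = e'") (simp_all add: hw_ghost_edge)

lemma hw_star_zero: "hw (word_star w) = h 0 \<longleftrightarrow> hw w = h 0"
  using h_star_zero[of "word w"] h_star_zero[of "word (word_star w)"] by auto

text \<open>Symbols that do not fit together give zero, so a nonzero word certifies a walk. Later
  proofs extract paths of the graph from nonzero products in this way.\<close>

lemma real_path_nonzero:
  "hw (Vertex u # map Edge p @ [Vertex w]) \<noteq> h 0 \<Longrightarrow> awalk u p w"
proof (induct p arbitrary: u)
  case Nil
  then have "u = w" by (simp add: hw_left_vertex split: if_splits)
  moreover have "u \<in> verts E"
    using Nil hw_bad[of "[Vertex u, Vertex w]"] by auto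
  ultimately show ?case by (simp add: awalk_Nil_iff)
next
  case (Cons e p)
  let ?rest = "map Edge p @ [Vertex w]"
  have nz: "hw (Vertex u # Edge e # ?rest) \<noteq> h 0" using Cons(2) by simp
  then have u: "u = tail E e" by (auto simp: hw_vertex_Cons split: if_splits)
  have e: "e \<in> arcs E" using nz hw_bad[of "Vertex u # Edge e # ?rest"] by auto
  have "hw (Edge e # Vertex (head E e) # ?rest) \<noteq> h 0"
    using nz by (simp add: hw_vertex_Cons hw_Cons_vertex u)
  then have "hw (Vertex (head E e) # ?rest) \<noteq> h 0" using hw_Cons_zero by blast
  then have "awalk (head E e) p w" by (rule Cons(1))
  then show ?case using u e by (simp add: awalk_Cons_iff)
qed

lemma ghost_path_nonzero:
  "hw (Vertex w # map Ghost (rev p) @ [Vertex u]) \<noteq> h 0 \<Longrightarrow> awalk u p w"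
  using real_path_nonzero[of u p w] hw_star_zero[of "Vertex u # map Edge p @ [Vertex w]"] by simp

lemma hw_middle:
  assumes "e \<in> arcs E"
  shows "hw [Ghost e, Vertex u, Vertex u', Edge e'] =
    (if u = u' \<and> u = tail E e \<and> e = e' then hw [Vertex (head E e), Vertex (head E e)] else h 0)"
  using assms hw_Cons_vertex[of "Ghost e" u "[Vertex u', Edge e']"] hw_Cons_vertex[of "Ghost e" u' "[Edge e']"]
  by (cases "u = tail E e"; cases "u' = tail E e"; cases "e = e'") (simp_all add: hw_ghost_edge hw_left_vertex)

text \<open>Together with \<open>ghost_path_mult_path\<close> this is orthonormality of paths of one
  length. Equal length matters: if \<open>p\<close> were a proper prefix of \<open>p'\<close>, a
  path could remain.\<close>

lemma ghost_path_mult_path_zero: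
  assumes "length p = length p'" "set p \<subseteq> arcs E" "(u, p, w) \<noteq> (u', p', w')"
  shows "hw ((Vertex w # map Ghost (rev p) @ [Vertex u]) @ Vertex u' # map Edge p' @ [Vertex w']) = h 0"
  using assms
proof (induct p arbitrary: p' u u')
  case Nil
  then show ?case
    by (auto simp: hw_vertex_Cons hw_left_vertex)
next
  case (Cons e p)
  then obtain e' p'' where p': "p' = e' # p''" by (cases p') auto
  let ?X = "Vertex w # map Ghost (rev p)" and ?Y = "map Edge p'' @ [Vertex w']"
  have e: "e \<in> arcs E" using Cons by simp
  have "hw (?X @ [Ghost e, Vertex u, Vertex u', Edge e'] @ ?Y) = h 0"
  proof (cases "u = u' \<and> u = tail E e \<and> e = e'")
    case True
    have IH: "hw ((Vertex w # map Ghost (rev p) @ [Vertex (head E e)]) @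
        Vertex (head E e) # map Edge p'' @ [Vertex w']) = h 0"
      by (rule Cons(1)) (use Cons(2-) True p' in auto)
    have mid: "hw [Ghost e, Vertex u, Vertex u', Edge e'] = hw [Vertex (head E e), Vertex (head E e)]"
      using hw_middle[OF e, of u u' e'] if_P[OF True] by (rule trans)
    show ?thesis using hw_cong[OF mid, of ?X ?Y] IH by simp
  next
    case False
    have "hw [Ghost e, Vertex u, Vertex u', Edge e'] = h 0"
      using hw_middle[OF e, of u u' e'] if_not_P[OF False] by (rule trans)
    then show ?thesis by (rule hw_cong_zero)
  qed
  then show ?case by (simp add: p')
qed

lemma ghost_path_mult_path:
  "awalk u p w \<Longrightarrow>
    hw ((Vertex w # map Ghost (rev p) @ [Vertex u]) @ Vertex u # map Edge p @ [Vertex w]) = hw [Vertex w]"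
proof (induct p arbitrary: u)
  case Nil
  then show ?case by (auto simp: awalk_Nil_iff hw_vertex_Cons hw_left_vertex)
next
  case (Cons e p)
  let ?X = "Vertex w # map Ghost (rev p)" and ?Y = "map Edge p @ [Vertex w]"
  have e: "e \<in> arcs E" "u = tail E e" and p: "awalk (head E e) p w"
    using Cons by (auto simp: awalk_Cons_iff)
  have "hw (?X @ [Ghost e, Vertex u, Vertex u, Edge e] @ ?Y) =
      hw (?X @ [Vertex (head E e), Vertex (head E e)] @ ?Y)"
    by (rule hw_cong) (use hw_middle[OF e(1), of u u e] e in simp)
  then show ?case using Cons(1)[OF p] by simp
qed

text \<open>Induction by prepending a symbol to \<open>p q^*\<close>: an edge extends
  \<open>p\<close>; a ghost edge cancels the first edge of \<open>p\<close> or, if \<open>p\<close>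
  is empty, extends \<open>q\<close>. Each step respects the degree.\<close>

lemma word_normal_form:
  assumes "w \<noteq> []" "w \<in> lists (lpa_gens E)" "hw w \<noteq> h 0"
  shows "\<exists>u p q v. hw w = hw (path_mon u p q v) \<and> u \<in> verts E \<and> v \<in> verts E \<and>
    set p \<subseteq> arcs E \<and> set q \<subseteq> arcs E \<and> int (length p) - int (length q) = word_degree w"
  using assms
proof (induct w rule: list_nonempty_induct)
  case (single x)
  show ?case
  proof (cases x)
    case (Vertex v)
    then show ?thesis using single
      by (intro exI[of _ v] exI[of _ "[]"]) (simp add: hw_left_vertex)
  next
    case (Edge e)
    then show ?thesis using single
      by (intro exI[of _ "tail E e"] exI[of _ "[e]"] exI[of _ "[]"] exI[of _ "head E e"])
        (simp add: hw_vertex_Cons hw_right_vertex)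
  next
    case (Ghost e)
    then show ?thesis using single
      by (intro exI[of _ "head E e"] exI[of _ "[]"] exI[of _ "[e]"] exI[of _ "tail E e"])
        (simp add: hw_vertex_Cons hw_right_vertex)
  qed
next
  case (cons x w)
  have "hw w \<noteq> h 0" using cons hw_Cons_zero by blast
  then obtain u p q v where IH: "hw w = hw (path_mon u p q v)" "u \<in> verts E" "v \<in> verts E"
    "set p \<subseteq> arcs E" "set q \<subseteq> arcs E" "int (length p) - int (length q) = word_degree w"
    using cons by auto
  have xw: "hw (x # w) = hw (x # path_mon u p q v)" by (rule hw_Cons_cong[OF IH(1)])
  have nz: "hw (x # path_mon u p q v) \<noteq> h 0" using xw cons by simp
  have x: "x \<in> lpa_gens E" using cons by simp
  let ?rest = "map Edge p @ map Ghost (rev q) @ [Vertex v]"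
  show ?case
  proof (cases x)
    case (Vertex y)
    then have "hw (x # path_mon u p q v) = hw (path_mon u p q v)"
      using nz hw_vertex_Cons[of y "Vertex u" ?rest] by (simp split: if_splits)
    then show ?thesis using xw IH Vertex
      by (intro exI[of _ u] exI[of _ p] exI[of _ q] exI[of _ v]) simp
  next
    case (Edge e)
    then have "hw (x # path_mon u p q v) = hw (Edge e # ?rest)"
      using nz hw_Cons_vertex[of x u ?rest] by (simp split: if_splits)
    also have "\<dots> = hw (path_mon (tail E e) (e # p) q v)"
      by (simp add: hw_vertex_Cons)
    finally show ?thesis using xw IH Edge x
      by (intro exI[of _ "tail E e"] exI[of _ "e # p"] exI[of _ q] exI[of _ v]) simp
  next
    case (Ghost e)
    then have 1: "hw (x # path_mon u p q v) = hw (Ghost e # ?rest)"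
      using nz hw_Cons_vertex[of x u ?rest] by (simp split: if_splits)
    have e: "e \<in> arcs E" using x Ghost by simp
    show ?thesis
    proof (cases p)
      case Nil
      have "hw (Ghost e # ?rest) = hw (path_mon (head E e) [] (q @ [e]) v)"
        using Nil by (simp add: hw_vertex_Cons)
      then show ?thesis using 1 xw IH Ghost e Nil
        by (intro exI[of _ "head E e"] exI[of _ "[]"] exI[of _ "q @ [e]"] exI[of _ v]) simp
    next
      case (Cons e' p')
      have "hw (Ghost e # ?rest) = hw (path_mon (head E e) p' q v)"
        using nz 1 Cons hw_ghost_edge_Cons[OF e, of e' "map Edge p' @ map Ghost (rev q) @ [Vertex v]"]
        by (simp split: if_splits)
      then show ?thesis using 1 xw IH Ghost e Cons
        by (intro exI[of _ "head E e"] exI[of _ p'] exI[of _ q] exI[of _ v]) simp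
    qed
  qed
qed

lemma hw_path_word:
  assumes "hw (Vertex u # map Edge p) \<noteq> h 0"
  shows "(u, p) \<in> paths E" "hw (Vertex u # map Edge p) = hw (path_word (u, p))"
proof -
  show "(u, p) \<in> paths E"
  proof (cases p rule: rev_cases)
    case Nil
    then have "u \<in> verts E" using assms hw_bad[of "[Vertex u]"] by auto
    then show ?thesis using Nil by (auto simp: paths_def awalk_Nil_iff)
  next
    case (snoc q e)
    have "hw (Vertex u # map Edge p) = hw ((Vertex u # map Edge q) @ [Edge e, Vertex (head E e)] @ [])"
      using hw_cong[of "[Edge e, Vertex (head E e)]" "[Edge e]" "Vertex u # map Edge q" "[]"] snoc
      by (simp add: hw_right_vertex)
    then have "hw (Vertex u # map Edge p @ [Vertex (head E e)]) \<noteq> h 0" using assms snoc by simp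
    then show ?thesis using real_path_nonzero unfolding paths_def by blast
  qed
  show "hw (Vertex u # map Edge p) = hw (path_word (u, p))"
    using assms by (cases p) (auto simp: hw_vertex_Cons split: if_splits)
qed

lemma word_star_path_word: "word_star (path_word \<alpha>) = ghost_word \<alpha>" "word_star (ghost_word \<alpha>) = path_word \<alpha>"
  by (cases \<alpha>; auto)+

lemma hw_ghost_word:
  assumes "hw (map Ghost (rev p) @ [Vertex u]) \<noteq> h 0"
  shows "(u, p) \<in> paths E" "hw (map Ghost (rev p) @ [Vertex u]) = hw (ghost_word (u, p))"
proof -
  have nz: "hw (Vertex u # map Edge p) \<noteq> h 0"
    using assms hw_star_zero[of "Vertex u # map Edge p"] by simp
  show "(u, p) \<in> paths E" by (rule hw_path_word(1)[OF nz])
  have "h (star (word (Vertex u # map Edge p))) = h (star (word (path_word (u, p))))"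
    by (rule h_star[OF hw_path_word(2)[OF nz]])
  then show "hw (map Ghost (rev p) @ [Vertex u]) = hw (ghost_word (u, p))"
    by (simp only: star_word word_star_path_word) simp
qed

lemma path_mon_words:
  assumes "hw (path_mon u p q v) \<noteq> h 0"
  shows "(u, p) \<in> paths E" "(v, q) \<in> paths E"
    "hw (path_mon u p q v) = hw (path_word (u, p) @ ghost_word (v, q))"
proof -
  let ?a = "Vertex u # map Edge p" and ?b = "map Ghost (rev q) @ [Vertex v]"
  have a: "hw ?a \<noteq> h 0" using assms hw_cong_zero[of ?a "[]" ?b] by auto
  have b: "hw ?b \<noteq> h 0" using assms hw_cong_zero[of ?b ?a "[]"] by auto
  show "(u, p) \<in> paths E" "(v, q) \<in> paths E"
    by (rule hw_path_word(1)[OF a], rule hw_ghost_word(1)[OF b])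
  have "hw (?a @ ?b) = hw (path_word (u, p) @ ?b)"
    using hw_cong[OF hw_path_word(2)[OF a], of "[]" ?b] by simp
  also have "\<dots> = hw (path_word (u, p) @ ghost_word (v, q))"
    using hw_cong[OF hw_ghost_word(2)[OF b], of "path_word (u, p)" "[]"] by simp
  finally show "hw (path_mon u p q v) = hw (path_word (u, p) @ ghost_word (v, q))" by simp
qed


section \<open>The grading and the involution\<close>

abbreviation comb_poly :: "('k \<times> ('v \<times> 'e list) \<times> ('v \<times> 'e list)) list \<Rightarrow> ('v, 'e, 'k) lpa_free" where
  "comb_poly ts \<equiv> (\<Sum>(k, \<alpha>, \<beta>)\<leftarrow>ts. Poly_Mapping.single (path_word \<alpha> @ ghost_word \<beta>) k)"

lemma path_word_lists:
  assumes "\<alpha> \<in> paths E"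
  shows "path_word \<alpha> \<in> lists (lpa_gens E)" "ghost_word \<alpha> \<in> lists (lpa_gens E)" "path_word \<alpha> \<noteq> []"
proof -
  obtain u p where \<alpha>: "\<alpha> = (u, p)" by (cases \<alpha>)
  then have "u \<in> verts E" "set p \<subseteq> arcs E" using assms by (auto simp: paths_def awalk_def)
  then show "path_word \<alpha> \<in> lists (lpa_gens E)" "ghost_word \<alpha> \<in> lists (lpa_gens E)" "path_word \<alpha> \<noteq> []"
    by (auto simp: \<alpha> subset_iff)
qed

lemma lpa_comb_eq_h:
  assumes "set ts \<subseteq> UNIV \<times> paths E \<times> paths E"
  shows "lpa_comb E ts = h (comb_poly ts)"
proof -
  have "comb_poly ts \<in> F0"
    using assms
  proof (induct ts)
    case Nil
    then show ?case by (simp add: zero_in_F0)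
  next
    case (Cons t ts)
    obtain k \<alpha> \<beta> where t: "t = (k, \<alpha>, \<beta>)" by (cases t)
    then have "path_word \<alpha> @ ghost_word \<beta> \<in> lists (lpa_gens E) - {[]}"
      using Cons(2) path_word_lists[of \<alpha>] path_word_lists(2)[of \<beta>] by simp
    then have "Poly_Mapping.single (path_word \<alpha> @ ghost_word \<beta>) k \<in> F0" by (simp add: F0_def)
    from F0_add[OF this Cons(1)] show ?case using Cons(2) t by simp
  qed
  then show ?thesis unfolding lpa_comb_def by (simp add: lpa_of_F0)
qed

text \<open>The set \<open>D\<close> allows one statement to serve twice: a single degree for the
  grading, all degrees for the involution.\<close>

lemma comb_poly_exists:
  assumes "\<And>w. w \<in> Poly_Mapping.keys f \<Longrightarrow> word_degree w \<in> D"
  shows "\<exists>ts. (\<forall>(k, \<alpha>, \<beta>)\<in>set ts. \<alpha> \<in> paths E \<and> \<beta> \<in> paths E \<and>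
      int (length (snd \<alpha>)) - int (length (snd \<beta>)) \<in> D) \<and> h f = h (comb_poly ts)"
proof -
  define R where "R f \<longleftrightarrow> (\<exists>ts. (\<forall>(k, \<alpha>, \<beta>)\<in>set ts. \<alpha> \<in> paths E \<and> \<beta> \<in> paths E \<and>
      int (length (snd \<alpha>)) - int (length (snd \<beta>)) \<in> D) \<and> h f = h (comb_poly ts))"
    for f :: "('v, 'e, 'k) lpa_free"
  have R_zero: "R 0" unfolding R_def by (rule exI[of _ "[]"]) simp
  have R_add: "R (f + g)" if Rf: "R f" and Rg: "R g" for f g
  proof -
    obtain ts where ts: "\<forall>(k, \<alpha>, \<beta>)\<in>set ts. \<alpha> \<in> paths E \<and> \<beta> \<in> paths E \<and>
      int (length (snd \<alpha>)) - int (length (snd \<beta>)) \<in> D" "h f = h (comb_poly ts)"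
      using Rf unfolding R_def by blast
    obtain us where us: "\<forall>(k, \<alpha>, \<beta>)\<in>set us. \<alpha> \<in> paths E \<and> \<beta> \<in> paths E \<and>
      int (length (snd \<alpha>)) - int (length (snd \<beta>)) \<in> D" "h g = h (comb_poly us)"
      using Rg unfolding R_def by blast
    have "h (f + g) = h (comb_poly (ts @ us))" using h_cong_add[OF ts(2) us(2)] by simp
    then show ?thesis unfolding R_def using ts(1) us(1) by (intro exI[of _ "ts @ us"] conjI) auto
  qed
  have R_sum: "R (sum g A)" if "\<And>i. i \<in> A \<Longrightarrow> R (g i)" for g and A :: "'v set"
    using that by (induct A rule: infinite_finite_induct) (auto intro: R_zero R_add)
  have R_single: "R (Poly_Mapping.single w k)" if w: "word_degree w \<in> D" "w \<noteq> []" for w k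
  proof (cases "hw w = h 0")
    case True
    then show ?thesis using R_zero h_single_cong_zero[of w k] unfolding R_def by simp
  next
    case False
    then have "w \<in> lists (lpa_gens E)" using hw_bad by blast
    from word_normal_form[OF w(2) this False] obtain u p q v
      where 1: "hw w = hw (path_mon u p q v)" "int (length p) - int (length q) = word_degree w" by blast
    then have nz: "hw (path_mon u p q v) \<noteq> h 0" using False by simp
    have "h (Poly_Mapping.single w k) = h (comb_poly [(k, (u, p), (v, q))])"
      using h_single_cong[of w "path_word (u, p) @ ghost_word (v, q)" k] 1(1) path_mon_words(3)[OF nz]
      by simp
    then show ?thesis unfolding R_def
      using path_mon_words(1,2)[OF nz] 1 w by (intro exI[of _ "[(k, (u, p), (v, q))]"]) auto
  qed
  have R_cong: "R f \<longleftrightarrow> R g" if "h f = h g" for f g using that unfolding R_def by simp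
  have "R f"
  proof (rule poly_mapping_keys_induct[where f = f])
    fix w k assume w: "w \<in> Poly_Mapping.keys f"
    show "R (Poly_Mapping.single w k)"
    \<comment> \<open>The word of a path is never empty, so a constant is first replaced by the same
      multiple of the vertex sum.\<close>
    proof (cases "w = []")
      case True
      have "Poly_Mapping.single [] k * vertex_sum E = (\<Sum>v\<in>verts E. Poly_Mapping.single [Vertex v] k)"
        by (simp add: vertex_sum_def sum_distrib_left word_def single_mult_single)
      moreover have "h (Poly_Mapping.single [] k * vertex_sum E) = h (Poly_Mapping.single [] k)"
        using h_cong_mult[OF refl h_vertex_sum, of "Poly_Mapping.single [] k"] by simp
      ultimately have "h (Poly_Mapping.single w k) = h (\<Sum>v\<in>verts E. Poly_Mapping.single [Vertex v] k)"
        using True by simp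
      moreover have "R (\<Sum>v\<in>verts E. Poly_Mapping.single [Vertex v] k)"
        using assms[OF w] True by (intro R_sum R_single) auto
      ultimately show ?thesis using R_cong by blast
    qed (use assms[OF w] R_single in blast)
  qed (use R_zero R_add in blast)+
  then show ?thesis unfolding R_def .
qed

lemma word_degree_path_ghost:
  "word_degree (path_word \<alpha> @ ghost_word \<beta>) = int (length (snd \<alpha>)) - int (length (snd \<beta>))"
  by (cases \<alpha>; cases \<beta>) auto

text \<open>Moves questions about degrees from lists of paths to the free algebra.\<close>

lemma lpa_grading_eq: "lpa_grading E n = h ` {f :: ('v, 'e, 'k) lpa_free. homogeneous n f}"
proof (intro equalityI subsetI)
  fix x :: "('v, 'e, 'k) lpa_free set"
  assume "x \<in> lpa_grading E n"
  then obtain ts where ts: "x = lpa_comb E ts"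
    "\<forall>(k, \<alpha>, \<beta>)\<in>set ts. \<alpha> \<in> paths E \<and> \<beta> \<in> paths E \<and>
      int (length (snd \<alpha>)) - int (length (snd \<beta>)) = n"
    unfolding lpa_grading_def by blast
  have "homogeneous n (comb_poly ts)"
    using ts(2) by (induct ts)
      (auto intro!: homogeneous_add homogeneous_single simp: word_degree_path_ghost simp del: path_word.simps ghost_word.simps word_degree_simps(3))
  moreover have "x = h (comb_poly ts)" using ts by (subst lpa_comb_eq_h[symmetric]) auto
  ultimately show "x \<in> h ` {f. homogeneous n f}" by blast
next
  fix x :: "('v, 'e, 'k) lpa_free set"
  assume "x \<in> h ` {f. homogeneous n f}"
  then obtain f where f: "x = h f" "homogeneous n f" by blast
  then obtain ts where ts: "\<forall>(k, \<alpha>, \<beta>)\<in>set ts. \<alpha> \<in> paths E \<and> \<beta> \<in> paths E \<and>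
      int (length (snd \<alpha>)) - int (length (snd \<beta>)) \<in> {n}" "h f = h (comb_poly ts)"
    using comb_poly_exists[of f "{n}"] unfolding homogeneous_def by blast
  then have "x = lpa_comb E ts" using f by (subst lpa_comb_eq_h) auto
  then show "x \<in> lpa_grading E n"
    using ts(1) unfolding lpa_grading_def by (intro CollectI exI[of _ ts] conjI) simp_all
qed

lemma star_comb_poly: "star (comb_poly ts) = comb_poly (map (\<lambda>(k, \<alpha>, \<beta>). (bar k, \<beta>, \<alpha>)) ts)"
  by (induct ts) (auto simp: star_add star_single word_star_path_word simp del: path_word.simps ghost_word.simps)

text \<open>The definite description in \<open>lpa_star\<close> ranges over all representing lists:
  existence is \<open>comb_poly_exists\<close>, and independence of the list is
  \<open>h_star\<close>.\<close>

lemma lpa_star_h: "lpa_star E bar (h f) = h (star f)"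
proof -
  let ?swap = "map (\<lambda>(k, \<alpha>, \<beta>). (bar k, \<beta>, \<alpha>)) :: ('k \<times> ('v \<times> 'e list) \<times> ('v \<times> 'e list)) list \<Rightarrow> _"
  have *: "lpa_comb E (?swap ts) = h (star f)"
    if ts: "set ts \<subseteq> UNIV \<times> paths E \<times> paths E" "h f = lpa_comb E ts" for ts
  proof -
    have "set (?swap ts) \<subseteq> UNIV \<times> paths E \<times> paths E" using ts(1) by fastforce
    then have "lpa_comb E (?swap ts) = h (star (comb_poly ts))"
      by (simp only: lpa_comb_eq_h star_comb_poly)
    also have "\<dots> = h (star f)" using ts by (intro h_star) (simp add: lpa_comb_eq_h)
    finally show ?thesis .
  qed
  obtain ts where ts: "\<forall>(k, \<alpha>, \<beta>)\<in>set ts. \<alpha> \<in> paths E \<and> \<beta> \<in> paths E \<and>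
      int (length (snd \<alpha>)) - int (length (snd \<beta>)) \<in> UNIV" "h f = h (comb_poly ts)"
    using comb_poly_exists[of f UNIV] by blast
  then have "set ts \<subseteq> UNIV \<times> paths E \<times> paths E" by auto
  then have ts': "set ts \<subseteq> UNIV \<times> paths E \<times> paths E" "h f = lpa_comb E ts"
    using ts by (simp_all add: lpa_comb_eq_h)
  show ?thesis
    unfolding lpa_star_def
  proof (rule the_equality)
    show "\<exists>ts. set ts \<subseteq> UNIV \<times> paths E \<times> paths E \<and> h f = lpa_comb E ts \<and> h (star f) = lpa_comb E (?swap ts)"
      using ts' *[OF ts'] by metis
  qed (use * in blast)
qed

end


section \<open>Compressing elements by paths\<close>

context lpa_star_graph
begin

lemma scalar_commute: "Poly_Mapping.single [] k * f = f * Poly_Mapping.single [] k"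
  for f :: "('v, 'e, 'k) lpa_free"
  by (rule additive_map_eqI[where f = f])
    (auto simp: distrib_left distrib_right single_mult_single mult.commute)

lemma keys_scalar_mult: "Poly_Mapping.keys (Poly_Mapping.single [] k * f) \<subseteq> Poly_Mapping.keys f"
  for f :: "('v, 'e, 'k) lpa_free"
  using keys_mult_append[of "Poly_Mapping.single [] k" f] by (auto split: if_splits)

text \<open>Polynomials supported in \<open>T\<close> are closed under sums and scalars, and scalars
  pass through \<open>a\<close>; hence knowledge of \<open>a w b\<close> for single words
  suffices.\<close>

lemma h_lift:
  fixes a b f :: "('v, 'e, 'k) lpa_free"
  assumes f: "Poly_Mapping.keys f \<subseteq> S"
    and step: "\<And>w. w \<in> S \<Longrightarrow> \<exists>g. Poly_Mapping.keys g \<subseteq> T \<and> h (a * word w * b) = h g"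
  shows "\<exists>g. Poly_Mapping.keys g \<subseteq> T \<and> h (a * f * b) = h g"
proof (rule poly_mapping_keys_induct[where f = f])
  show "\<exists>g. Poly_Mapping.keys g \<subseteq> T \<and> h (a * 0 * b) = h g"
    by (rule exI[of _ 0]) simp
next
  fix w k assume "w \<in> Poly_Mapping.keys f"
  then obtain g where g: "Poly_Mapping.keys g \<subseteq> T" "h (a * word w * b) = h g"
    using f step by blast
  have "a * Poly_Mapping.single w k * b = Poly_Mapping.single [] k * (a * word w * b)"
    by (simp add: single_eq_scalar_word[of w k] scalar_commute[of k a] flip: mult.assoc)
  then have "h (a * Poly_Mapping.single w k * b) = h (Poly_Mapping.single [] k * g)"
    using h_cong_mult[OF refl g(2)] by metis
  then show "\<exists>g. Poly_Mapping.keys g \<subseteq> T \<and> h (a * Poly_Mapping.single w k * b) = h g"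
    using g(1) keys_scalar_mult[of k g] by blast
next
  fix f1 f2
  assume "\<exists>g. Poly_Mapping.keys g \<subseteq> T \<and> h (a * f1 * b) = h g"
    "\<exists>g. Poly_Mapping.keys g \<subseteq> T \<and> h (a * f2 * b) = h g"
  then obtain g1 g2 where g: "Poly_Mapping.keys g1 \<subseteq> T" "h (a * f1 * b) = h g1"
    "Poly_Mapping.keys g2 \<subseteq> T" "h (a * f2 * b) = h g2" by blast
  have "h (a * (f1 + f2) * b) = h (g1 + g2)"
    using h_cong_add[OF g(2) g(4)] by (simp add: distrib_left distrib_right)
  moreover have "Poly_Mapping.keys (g1 + g2) \<subseteq> T" using g keys_add[of g1 g2] by blast
  ultimately show "\<exists>g. Poly_Mapping.keys g \<subseteq> T \<and> h (a * (f1 + f2) * b) = h g" by blast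
qed

text \<open>The bound \<open>M\<close> on the ghost part is an induction parameter: it drops with
  every edge multiplied on the right.\<close>

definition mons :: "int \<Rightarrow> nat \<Rightarrow> ('v, 'e) lpa_gen list set" where
  "mons n M = {path_mon u p q v | u p q v. set p \<subseteq> arcs E \<and> set q \<subseteq> arcs E \<and>
    length q \<le> M \<and> int (length p) - int (length q) = n}"

text \<open>Length and final vertex are fixed so that distinct words are orthogonal in the sense of
  \<open>ghost_path_mult_path_zero\<close>.\<close>

definition real_mons :: "nat \<Rightarrow> 'v \<Rightarrow> ('v, 'e) lpa_gen list set" where
  "real_mons m w = {Vertex u # map Edge p @ [Vertex w] | u p. set p \<subseteq> arcs E \<and> length p = m}"

lemma monsI:
  "set p \<subseteq> arcs E \<Longrightarrow> set q \<subseteq> arcs E \<Longrightarrow> length q \<le> M \<Longrightarrow>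
    int (length p) - int (length q) = n \<Longrightarrow> path_mon u p q v \<in> mons n M"
  unfolding mons_def by blast

lemma monsE:
  assumes "w \<in> mons n M"
  obtains u p q v where "w = path_mon u p q v" "set p \<subseteq> arcs E" "set q \<subseteq> arcs E"
    "length q \<le> M" "int (length p) - int (length q) = n"
  using assms unfolding mons_def by blast

lemma homogeneous_eq_mons:
  assumes f: "homogeneous n f"
  shows "\<exists>M g. Poly_Mapping.keys g \<subseteq> mons n M \<and> h f = h (g :: ('v, 'e, 'k) lpa_free)"
proof -
  have step: "\<exists>g. Poly_Mapping.keys g \<subseteq> (\<Union>M. mons n M) \<and> h (1 * word w * 1) = h (g :: ('v, 'e, 'k) lpa_free)"
    if w: "w \<in> {w. word_degree w = n}" for w
  proof (cases "w = []")
    case True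
    have "h (1 * word w * 1) = h (vertex_sum E :: ('v, 'e, 'k) lpa_free)"
      using True h_vertex_sum by (simp add: word_def flip: zero_list_def)
    also have "\<dots> = h (\<Sum>v\<in>verts E. word (path_mon v [] [] v))"
      unfolding vertex_sum_def by (rule h_cong_sum) (simp add: hw_left_vertex)
    finally have "h (1 * word w * 1) = h (\<Sum>v\<in>verts E. word (path_mon v [] [] v) :: ('v, 'e, 'k) lpa_free)" .
    moreover have "Poly_Mapping.keys (\<Sum>v\<in>A. word (path_mon v [] [] v) :: ('v, 'e, 'k) lpa_free)
        \<subseteq> (\<Union>M. mons n M)" for A :: "'v set"
    proof (induct A rule: infinite_finite_induct)
      case (insert v A)
      have "path_mon v [] [] v \<in> mons n 0" by (rule monsI) (use w True in auto)
      then have "Poly_Mapping.keys (word (path_mon v [] [] v) :: ('v, 'e, 'k) lpa_free) \<subseteq> (\<Union>M. mons n M)"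
        by (auto simp: word_def)
      then show ?case using insert keys_add[of "word (path_mon v [] [] v)" "\<Sum>v\<in>A. word (path_mon v [] [] v)"]
        by (auto simp del: append.simps)
    qed auto
    ultimately show ?thesis by blast
  next
    case False
    show ?thesis
    proof (cases "hw w = h 0")
      case True
      then show ?thesis by (intro exI[of _ 0]) simp
    next
      case nz: False
      then have "w \<in> lists (lpa_gens E)" using hw_bad by blast
      from word_normal_form[OF False this nz] obtain u p q v where
        1: "hw w = hw (path_mon u p q v)" "set p \<subseteq> arcs E" "set q \<subseteq> arcs E"
          "int (length p) - int (length q) = word_degree w" by blast
      have "path_mon u p q v \<in> mons n (length q)" by (rule monsI) (use 1 w in auto)
      then have "Poly_Mapping.keys (word (path_mon u p q v) :: ('v, 'e, 'k) lpa_free) \<subseteq> (\<Union>M. mons n M)"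
        by (auto simp: word_def)
      then show ?thesis using 1(1) by (intro exI[of _ "word (path_mon u p q v)"]) simp
    qed
  qed
  have "Poly_Mapping.keys f \<subseteq> {w. word_degree w = n}" using f by (auto simp: homogeneous_def)
  from h_lift[OF this step] obtain g :: "('v, 'e, 'k) lpa_free"
    where g: "Poly_Mapping.keys g \<subseteq> (\<Union>M. mons n M)" "h f = h g" by auto
  \<comment> \<open>A crude common bound: no ghost part is longer than its word.\<close>
  define M where "M = (\<Sum>w\<in>Poly_Mapping.keys g. length w)"
  have "Poly_Mapping.keys g \<subseteq> mons n M"
  proof
    fix w assume w: "w \<in> Poly_Mapping.keys g"
    then obtain M' where "w \<in> mons n M'" using g by blast
    then obtain u p q v where 1: "w = path_mon u p q v" "set p \<subseteq> arcs E" "set q \<subseteq> arcs E"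
      "int (length p) - int (length q) = n" by (rule monsE)
    have "length q \<le> length w" using 1(1) by simp
    also have "\<dots> \<le> M" unfolding M_def using w by (intro member_le_sum) auto
    finally show "w \<in> mons n M" using 1 by (auto intro: monsI)
  qed
  then show ?thesis using g(2) by blast
qed

lemma h_sum_zero: "(\<And>i. i \<in> A \<Longrightarrow> h (f i) = h 0) \<Longrightarrow> h (sum f A) = h 0"
  using h_cong_sum[of A f "\<lambda>_. 0"] by simp

lemma h_mult_zero:
  "h f = h 0 \<Longrightarrow> h (f * g) = h 0" "h g = h 0 \<Longrightarrow> h (f * g) = h 0"
  using h_cong_mult[of f 0 g g] h_cong_mult[of f f g 0] by auto

lemma nonzero_mult_vertex:
  assumes "h x \<noteq> h 0"
  shows "\<exists>v\<in>verts E. h (x * word [Vertex v]) \<noteq> h (0 :: ('v, 'e, 'k) lpa_free)"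
proof (rule ccontr)
  assume "\<not> ?thesis"
  then have "h (\<Sum>v\<in>verts E. x * word [Vertex v]) = h 0" by (intro h_sum_zero) blast
  then have "h (x * vertex_sum E) = h 0" by (simp add: vertex_sum_def sum_distrib_left)
  then show False using assms h_cong_mult[OF refl h_vertex_sum, of x] by simp
qed

text \<open>The edge cancels the last ghost symbol or gives zero; with an empty ghost part it
  extends the real path.\<close>

lemma mons_mult_edge:
  assumes w: "w \<in> mons n (Suc M)" and e: "e \<in> arcs E"
  shows "\<exists>g. Poly_Mapping.keys g \<subseteq> mons (n + 1) M \<and> h (1 * word w * word [Edge e]) = h (g :: ('v, 'e, 'k) lpa_free)"
proof -
  obtain u p q v where 1: "w = path_mon u p q v" "set p \<subseteq> arcs E" "set q \<subseteq> arcs E"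
    "length q \<le> Suc M" "int (length p) - int (length q) = n" using w by (rule monsE)
  let ?a = "Vertex u # map Edge p"
  have prod: "1 * word w * word [Edge e] = (word (?a @ map Ghost (rev q) @ [Vertex v, Edge e]) :: ('v, 'e, 'k) lpa_free)"
    by (simp add: word_mult_word 1)
  have fin: ?thesis if "hw (?a @ map Ghost (rev q) @ [Vertex v, Edge e]) = hw w'" "w' \<in> mons (n + 1) M" for w'
    unfolding prod using that by (intro exI[of _ "word w'"]) (simp add: word_def)
  have fin0: ?thesis if "hw (?a @ map Ghost (rev q) @ [Vertex v, Edge e]) = h 0"
    unfolding prod using that by (intro exI[of _ 0]) simp
  show ?thesis
  proof (cases "v = tail E e")
    case False
    then have "hw [Vertex v, Edge e] = h 0" by (simp add: hw_left_vertex)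
    then show ?thesis using hw_cong_zero[of _ "?a @ map Ghost (rev q)" "[]"] by (intro fin0) simp
  next
    case True
    have ve: "hw [Vertex v, Edge e] = hw [Edge e]" using True by (simp add: hw_left_vertex)
    show ?thesis
    proof (cases q)
      case Nil
      have "hw [Vertex v, Edge e] = hw [Edge e, Vertex (head E e)]"
        using ve by (simp add: hw_right_vertex)
      from hw_cong[OF this, of ?a "[]"]
      have "hw (?a @ map Ghost (rev q) @ [Vertex v, Edge e]) = hw (path_mon u (p @ [e]) [] (head E e))"
        using Nil by simp
      then show ?thesis by (rule fin) (rule monsI, use 1 e Nil in auto)
    next
      case (Cons f q')
      have f: "f \<in> arcs E" using 1 Cons by simp
      have eq: "hw (?a @ map Ghost (rev q) @ [Vertex v, Edge e]) =
          hw ((?a @ map Ghost (rev q')) @ [Ghost f, Edge e] @ [])"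
        using hw_cong[OF ve, of "?a @ map Ghost (rev q)" "[]"] Cons by simp
      show ?thesis
      proof (cases "f = e")
        case True
        have "hw ((?a @ map Ghost (rev q')) @ [Ghost f, Edge e] @ []) = hw (path_mon u p q' (head E e))"
          using hw_cong[of "[Ghost f, Edge e]" "[Vertex (head E e)]" "?a @ map Ghost (rev q')" "[]"]
            hw_ghost_edge[OF f, of e] True by simp
        then show ?thesis using eq by (intro fin[OF _ monsI]) (use 1 Cons in auto)
      next
        case False
        then have "hw [Ghost f, Edge e] = h 0" using hw_ghost_edge[OF f, of e] by simp
        then show ?thesis using eq hw_cong_zero by (intro fin0) metis
      qed
    qed
  qed
qed

text \<open>A ghost part ending at \<open>v\<close> would need an edge emitted by \<open>v\<close>.
  Without a ghost part, the real path has length equal to the degree, whence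
  \<open>nat n\<close>.\<close>

lemma mons_mult_sink:
  assumes w: "w \<in> mons n M" and v: "M = 0 \<or> out_arcs E v = {}"
  shows "\<exists>g. Poly_Mapping.keys g \<subseteq> real_mons (nat n) v \<and>
    h (1 * word w * word [Vertex v]) = h (g :: ('v, 'e, 'k) lpa_free)"
proof -
  obtain u p q v' where 1: "w = path_mon u p q v'" "set p \<subseteq> arcs E" "set q \<subseteq> arcs E"
    "length q \<le> M" "int (length p) - int (length q) = n" using w by (rule monsE)
  let ?a = "Vertex u # map Edge p"
  have prod: "1 * word w * word [Vertex v] = (word (?a @ map Ghost (rev q) @ [Vertex v', Vertex v]) :: ('v, 'e, 'k) lpa_free)"
    by (simp add: word_mult_word 1)
  have fin0: ?thesis if "hw (?a @ map Ghost (rev q) @ [Vertex v', Vertex v]) = h 0"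
    unfolding prod using that by (intro exI[of _ 0]) simp
  show ?thesis
  proof (cases "v' = v")
    case False
    then have "hw [Vertex v', Vertex v] = h 0" by (simp add: hw_left_vertex)
    then show ?thesis using hw_cong_zero[of _ "?a @ map Ghost (rev q)" "[]"] by (intro fin0) simp
  next
    case True
    then have vv: "hw [Vertex v', Vertex v] = hw [Vertex v]" by (simp add: hw_left_vertex)
    show ?thesis
    proof (cases q)
      case Nil
      have "hw (?a @ map Ghost (rev q) @ [Vertex v', Vertex v]) = hw (?a @ [Vertex v])"
        using hw_cong[OF vv, of ?a "[]"] Nil by simp
      moreover have "?a @ [Vertex v] \<in> real_mons (nat n) v"
        unfolding real_mons_def using 1 Nil by auto
      ultimately show ?thesis unfolding prod
        by (intro exI[of _ "word (?a @ [Vertex v])"]) (simp add: word_def)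
    next
      case (Cons f q')
      then have "v \<noteq> tail E f" using 1 v by (auto simp: out_arcs_def)
      then have "hw [Ghost f, Vertex v] = h 0" by (simp add: hw_right_vertex)
      then have "hw ((?a @ map Ghost (rev q')) @ [Ghost f, Vertex v] @ []) = h 0" by (rule hw_cong_zero)
      then show ?thesis using hw_cong[OF vv, of "?a @ map Ghost (rev q)" "[]"] Cons
        by (intro fin0) simp
    qed
  qed
qed

text \<open>Some \<open>x v\<close> is nonzero because the vertices sum to one. If \<open>v\<close>
  is not a sink, \<open>v = \<Sum>e e^*\<close> makes some \<open>x e\<close> nonzero, and
  \<open>x e\<close> has shorter ghost parts; at a sink, or when \<open>M = 0\<close>, no ghost
  parts survive.\<close>

lemma nonzero_mult_path:
  fixes x :: "('v, 'e, 'k) lpa_free"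
  assumes "Poly_Mapping.keys x \<subseteq> mons n M" "h x \<noteq> h 0"
  shows "\<exists>q w m y. w \<in> verts E \<and> h (x * word (map Edge q @ [Vertex w])) = h y \<and> h y \<noteq> h 0 \<and>
    Poly_Mapping.keys y \<subseteq> real_mons m w"
  using assms
proof (induct M arbitrary: n x)
  case 0
  obtain v where v: "v \<in> verts E" "h (x * word [Vertex v]) \<noteq> h 0"
    using nonzero_mult_vertex[OF 0(2)] by blast
  obtain y where "Poly_Mapping.keys y \<subseteq> real_mons (nat n) v" "h (1 * x * word [Vertex v]) = h y"
    using h_lift[OF 0(1), of "real_mons (nat n) v" 1 "word [Vertex v]"] mons_mult_sink by blast
  then show ?case using v by (intro exI[of _ "[]"] exI[of _ v] exI[of _ "nat n"] exI[of _ y]) simp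
next
  case (Suc M)
  obtain v where v: "v \<in> verts E" "h (x * word [Vertex v]) \<noteq> h 0"
    using nonzero_mult_vertex[OF Suc(3)] by blast
  show ?case
  proof (cases "out_arcs E v = {}")
    case True
    obtain y where "Poly_Mapping.keys y \<subseteq> real_mons (nat n) v" "h (1 * x * word [Vertex v]) = h y"
      using h_lift[OF Suc(2), of "real_mons (nat n) v" 1 "word [Vertex v]"] mons_mult_sink True by blast
    then show ?thesis using v by (intro exI[of _ "[]"] exI[of _ v] exI[of _ "nat n"] exI[of _ y]) simp
  next
    case False
    have "\<exists>e\<in>out_arcs E v. h (x * word [Edge e]) \<noteq> h 0"
    proof (rule ccontr)
      assume no: "\<not> ?thesis"
      have "h (\<Sum>e\<in>out_arcs E v. x * word [Edge e] * word [Ghost e]) = h 0"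
        by (rule h_sum_zero, rule h_mult_zero(1)) (use no in blast)
      then have "h (x * (\<Sum>e\<in>out_arcs E v. word [Edge e, Ghost e])) = h 0"
        by (simp add: sum_distrib_left mult.assoc word_mult_word)
      then show False using v h_cong_mult[OF refl h_CK2[OF v(1) False], of x] by simp
    qed
    then obtain e where e: "e \<in> arcs E" "h (x * word [Edge e]) \<noteq> h 0"
      by (blast dest: in_out_arcs_conv[THEN iffD1])
    obtain x' where x': "Poly_Mapping.keys x' \<subseteq> mons (n + 1) M" "h (1 * x * word [Edge e]) = h x'"
      using h_lift[OF Suc(2), of "mons (n + 1) M" 1 "word [Edge e]"] mons_mult_edge[OF _ e(1)] by blast
    then have "h x' \<noteq> h 0" using e by simp
    from Suc(1)[OF x'(1) this] obtain q w m y where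
      y: "w \<in> verts E" "h (x' * word (map Edge q @ [Vertex w])) = h y" "h y \<noteq> h 0"
      "Poly_Mapping.keys y \<subseteq> real_mons m w" by blast
    have "h (x * word (map Edge (e # q) @ [Vertex w])) = h (x * word [Edge e] * word (map Edge q @ [Vertex w]))"
      by (simp add: mult.assoc word_mult_word)
    also have "\<dots> = h y" using h_cong_mult[of "x * word [Edge e]" x'] x'(2) y(2) by simp
    finally show ?thesis using y by blast
  qed
qed

text \<open>By orthogonality of paths with equal length, multiplication by the ghost of one path
  isolates the coefficient of that path.\<close>

lemma real_nonzero_compress:
  fixes y :: "('v, 'e, 'k) lpa_free"
  assumes y: "Poly_Mapping.keys y \<subseteq> real_mons m w" "h y \<noteq> h 0"
  shows "\<exists>u p k. k \<noteq> 0 \<and>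
    h (word (Vertex w # map Ghost (rev p) @ [Vertex u]) * y) = h (Poly_Mapping.single [Vertex w] k)"
proof -
  \<comment> \<open>The support may contain words that are zero in the algebra; the chosen one must
    not be, so that its edges form a walk.\<close>
  have "\<exists>t\<in>Poly_Mapping.keys y. hw t \<noteq> h 0"
  proof (rule ccontr)
    assume no: "\<not> ?thesis"
    have "h y = h 0"
    proof (rule poly_mapping_keys_induct[where f = y])
      fix t and k :: 'k assume "t \<in> Poly_Mapping.keys y"
      then have "hw t = h 0" using no by blast
      then show "h (Poly_Mapping.single t k) = h 0" by (rule h_single_cong_zero)
    next
      fix f g :: "('v, 'e, 'k) lpa_free"
      assume "h f = h 0" "h g = h 0"
      then show "h (f + g) = h 0" using h_cong_add[of f 0 g 0] by simp
    qed simp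
    then show False using y by blast
  qed
  then obtain t where t: "t \<in> Poly_Mapping.keys y" "hw t \<noteq> h 0" by blast
  then obtain u p where up: "t = Vertex u # map Edge p @ [Vertex w]" "set p \<subseteq> arcs E" "length p = m"
    using y unfolding real_mons_def by blast
  have walk: "awalk u p w" using t up real_path_nonzero by simp
  let ?g = "word (Vertex w # map Ghost (rev p) @ [Vertex u]) :: ('v, 'e, 'k) lpa_free"
  have "h (?g * y) = h (Poly_Mapping.single [Vertex w] (Poly_Mapping.lookup y t))"
  proof (rule poly_mapping_keys_induct[where f = y])
    fix t' and k :: 'k assume "t' \<in> Poly_Mapping.keys y"
    then obtain u' p' where t': "t' = Vertex u' # map Edge p' @ [Vertex w]" "length p' = m"
      using y unfolding real_mons_def by blast
    have "?g * Poly_Mapping.single t' k = Poly_Mapping.single [] k * (?g * word t')"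
      by (simp add: single_eq_scalar_word[of t' k] scalar_commute[of k ?g] flip: mult.assoc)
    also have "\<dots> = Poly_Mapping.single ((Vertex w # map Ghost (rev p) @ [Vertex u]) @ t') k"
      by (simp add: word_def single_mult_single)
    finally have prod: "?g * Poly_Mapping.single t' k =
        Poly_Mapping.single ((Vertex w # map Ghost (rev p) @ [Vertex u]) @ t') k" .
    show "h (?g * Poly_Mapping.single t' k) =
        h (Poly_Mapping.single [Vertex w] (Poly_Mapping.lookup (Poly_Mapping.single t' k) t))"
    proof (cases "t' = t")
      case True
      have "hw ((Vertex w # map Ghost (rev p) @ [Vertex u]) @ t') = hw [Vertex w]"
        using ghost_path_mult_path[OF walk] up True by simp
      from h_single_cong[OF this, of k] show ?thesis unfolding prod by (simp add: True)
    next
      case False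
      have "hw ((Vertex w # map Ghost (rev p) @ [Vertex u]) @ t') = h 0"
        unfolding t' by (rule ghost_path_mult_path_zero) (use up t' False in auto)
      from h_single_cong_zero[OF this, of k] show ?thesis unfolding prod using False by (simp add: lookup_single)
    qed
  next
    fix f g :: "('v, 'e, 'k) lpa_free"
    assume "h (?g * f) = h (Poly_Mapping.single [Vertex w] (Poly_Mapping.lookup f t))"
      "h (?g * g) = h (Poly_Mapping.single [Vertex w] (Poly_Mapping.lookup g t))"
    from h_cong_add[OF this]
    show "h (?g * (f + g)) = h (Poly_Mapping.single [Vertex w] (Poly_Mapping.lookup (f + g) t))"
      by (simp add: distrib_left lookup_add single_add)
  qed simp
  then show ?thesis using t(1) by (intro exI[of _ u] exI[of _ p] exI[of _ "Poly_Mapping.lookup y t"])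
      (simp add: in_keys_iff)
qed

text \<open>Hence every nonzero graded ideal contains a vertex.\<close>

lemma homogeneous_nonzero_compress:
  fixes x :: "('v, 'e, 'k) lpa_free"
  assumes "homogeneous n x" "h x \<noteq> h 0"
  shows "\<exists>w u p q k. w \<in> verts E \<and> k \<noteq> 0 \<and>
    h (word (Vertex w # map Ghost (rev p) @ [Vertex u]) * x * word (map Edge q @ [Vertex w])) =
      h (Poly_Mapping.single [Vertex w] k)"
proof -
  obtain M x' where x': "Poly_Mapping.keys x' \<subseteq> mons n M" "h x = h x'"
    using homogeneous_eq_mons[OF assms(1)] by blast
  then have "h x' \<noteq> h 0" using assms by simp
  from nonzero_mult_path[OF x'(1) this] obtain q w m y where
    y: "w \<in> verts E" "h (x' * word (map Edge q @ [Vertex w])) = h y" "h y \<noteq> h 0"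
    "Poly_Mapping.keys y \<subseteq> real_mons m w" by blast
  obtain u p k where k: "k \<noteq> 0"
    "h (word (Vertex w # map Ghost (rev p) @ [Vertex u]) * y) = h (Poly_Mapping.single [Vertex w] k)"
    using real_nonzero_compress[OF y(4) y(3)] by blast
  have "h (x * word (map Edge q @ [Vertex w])) = h y"
    using h_cong_mult[OF x'(2) refl] y(2) by simp
  from h_cong_mult[OF refl this] k
  have "h (word (Vertex w # map Ghost (rev p) @ [Vertex u]) * x * word (map Edge q @ [Vertex w])) =
      h (Poly_Mapping.single [Vertex w] k)"
    by (simp only: mult.assoc)
  then show ?thesis using y(1) k(1) by blast
qed

section \<open>Conjugating degree-zero elements by long paths\<close>

lemma mons_mono: "M \<le> M' \<Longrightarrow> mons n M \<subseteq> mons n M'"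
  unfolding mons_def by fastforce

lemma ghost_mult_mons:
  assumes w: "w \<in> mons 1 M" and e: "e \<in> arcs E"
  shows "\<exists>g. Poly_Mapping.keys g \<subseteq> mons 0 M \<and>
    h (word [Ghost e] * word w * 1) = h (g :: ('v, 'e, 'k) lpa_free)"
proof -
  obtain u p q v where 1: "w = path_mon u p q v" "set p \<subseteq> arcs E" "set q \<subseteq> arcs E"
    "length q \<le> M" "int (length p) - int (length q) = 1" using w by (rule monsE)
  \<comment> \<open>Degree one forces \<open>p\<close> to be nonempty, so the ghost edge always
    meets an edge.\<close>
  then obtain e' p' where p: "p = e' # p'" by (cases p) auto
  let ?rest = "map Edge p' @ map Ghost (rev q) @ [Vertex v]"
  have prod: "word [Ghost e] * word w * 1 = (word (Ghost e # Vertex u # Edge e' # ?rest) :: ('v, 'e, 'k) lpa_free)"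
    by (simp add: word_mult_word 1 p)
  show ?thesis
  proof (cases "u = tail E e \<and> e = e'")
    case True
    have "hw (Ghost e # Vertex u # Edge e' # ?rest) = hw (Ghost e # Edge e' # ?rest)"
      using True hw_Cons_vertex[of "Ghost e" u "Edge e' # ?rest"] by simp
    also have "\<dots> = hw (path_mon (head E e) p' q v)"
      using True hw_ghost_edge_Cons[OF e, of e' ?rest] by simp
    finally have "h (word [Ghost e] * word w * 1) = hw (path_mon (head E e) p' q v)"
      unfolding prod .
    moreover have "path_mon (head E e) p' q v \<in> mons 0 M" by (rule monsI) (use 1 p in auto)
    ultimately show ?thesis
      by (intro exI[of _ "word (path_mon (head E e) p' q v)"]) (simp add: word_def)
  next
    case False
    have "hw (Ghost e # Vertex u # Edge e' # ?rest) = h 0"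
    proof (cases "u = tail E e")
      case True
      then have "hw (Ghost e # Vertex u # Edge e' # ?rest) = hw (Ghost e # Edge e' # ?rest)"
        using hw_Cons_vertex[of "Ghost e" u "Edge e' # ?rest"] by simp
      also have "\<dots> = h 0" using True False hw_ghost_edge_Cons[OF e, of e' ?rest] by simp
      finally show ?thesis .
    next
      case False
      then show ?thesis using hw_Cons_vertex[of "Ghost e" u "Edge e' # ?rest"] by simp
    qed
    then show ?thesis unfolding prod by (intro exI[of _ 0]) simp
  qed
qed

text \<open>The path is peeled off from its start: an edge on the right shortens the ghost parts,
  and the matching ghost edge on the left restores degree zero. When the path is used up, so is the
  bound, and only products of two vertices remain.\<close>

lemma degree_zero_compress:
  fixes x :: "('v, 'e, 'k) lpa_free"
  assumes "Poly_Mapping.keys x \<subseteq> mons 0 M" "awalk u \<mu> w" "M \<le> length \<mu>"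
  shows "\<exists>k. h (word (Vertex w # map Ghost (rev \<mu>) @ [Vertex u]) * x *
      word (Vertex u # map Edge \<mu> @ [Vertex w])) = h (Poly_Mapping.single [Vertex w] k)"
  using assms
proof (induct \<mu> arbitrary: M u x)
  case Nil
  then have u: "u = w" and M: "M = 0" by (auto simp: awalk_Nil_iff)
  let ?e = "word [Vertex w, Vertex w] :: ('v, 'e, 'k) lpa_free"
  have "\<exists>g. Poly_Mapping.keys g \<subseteq> {[Vertex w]} \<and> h (?e * x * ?e) = h g"
  proof (rule h_lift[OF Nil(1)])
    fix t assume "t \<in> mons 0 M"
    then obtain a b where t: "t = [Vertex a, Vertex b]" unfolding M by (auto elim!: monsE)
    have prod: "?e * word t * ?e = word [Vertex w, Vertex w, Vertex a, Vertex b, Vertex w, Vertex w]"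
      by (simp add: t word_mult_word)
    show "\<exists>g. Poly_Mapping.keys g \<subseteq> {[Vertex w]} \<and> h (?e * word t * ?e) = h (g :: ('v, 'e, 'k) lpa_free)"
    proof (cases "a = w \<and> b = w")
      case True
      then have "hw [Vertex w, Vertex w, Vertex a, Vertex b, Vertex w, Vertex w] = hw [Vertex w]"
        by (simp add: hw_vertex_Cons)
      then show ?thesis unfolding prod by (intro exI[of _ "word [Vertex w]"]) (simp add: word_def)
    next
      case False
      then have "hw [Vertex w, Vertex w, Vertex a, Vertex b, Vertex w, Vertex w] = h 0"
        by (auto simp: hw_vertex_Cons del: equalityI)
      then show ?thesis unfolding prod by (intro exI[of _ 0]) simp
    qed
  qed
  then obtain g where g: "Poly_Mapping.keys g \<subseteq> {[Vertex w]}" "h (?e * x * ?e) = h g" by blast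
  have "g = Poly_Mapping.single [Vertex w] (Poly_Mapping.lookup g [Vertex w])"
    by (rule poly_mapping_eqI) (use g(1) in \<open>auto simp: lookup_single when_def in_keys_iff\<close>)
  then show ?case using g(2) u by (intro exI[of _ "Poly_Mapping.lookup g [Vertex w]"]) simp
next
  case (Cons e \<mu>)
  have e: "e \<in> arcs E" "u = tail E e" and \<mu>: "awalk (head E e) \<mu> w"
    using Cons(3) by (auto simp: awalk_Cons_iff)
  \<comment> \<open>With truncated subtraction a bound that is already zero stays zero for the rest
    of the path.\<close>
  have "M \<le> Suc (M - 1)" by simp
  from subset_trans[OF Cons(2) mons_mono[OF this]]
  have "Poly_Mapping.keys x \<subseteq> mons 0 (Suc (M - 1))" .
  from h_lift[OF this, of "mons 1 (M - 1)" 1 "word [Edge e]"] mons_mult_edge[of _ 0 "M - 1", OF _ e(1)]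
  have "\<exists>x1. Poly_Mapping.keys x1 \<subseteq> mons 1 (M - 1) \<and> h (1 * x * word [Edge e]) = h x1"
    by (simp only: add_0)
  then obtain x1 where x1: "Poly_Mapping.keys x1 \<subseteq> mons 1 (M - 1)" "h (1 * x * word [Edge e]) = h x1"
    by blast
  from h_lift[OF x1(1) ghost_mult_mons[OF _ e(1)]]
  obtain x2 where x2: "Poly_Mapping.keys x2 \<subseteq> mons 0 (M - 1)" "h (word [Ghost e] * x1 * 1) = h x2" by blast
  have mid: "h (word [Ghost e] * (x * word [Edge e])) = h x2"
    using h_cong_mult[OF refl x1(2), of "word [Ghost e]"] x2(2) by simp
  let ?l = "Vertex w # map Ghost (rev \<mu>)" and ?r = "map Edge \<mu> @ [Vertex w]"
  have "M - 1 \<le> length \<mu>" using Cons(4) by simp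
  from Cons(1)[OF x2(1) \<mu> this]
  obtain k where k: "h (word (?l @ [Vertex (head E e)]) * x2 * word (Vertex (head E e) # ?r)) =
      h (Poly_Mapping.single [Vertex w] k)"
    by auto
  have l: "hw (?l @ [Ghost e, Vertex u] @ []) = hw (?l @ [Vertex (head E e), Ghost e] @ [])"
    by (rule hw_cong) (simp add: hw_left_vertex hw_right_vertex e)
  have r: "hw ([] @ [Vertex u, Edge e] @ ?r) = hw ([] @ [Edge e, Vertex (head E e)] @ ?r)"
    by (rule hw_cong) (simp add: hw_left_vertex hw_right_vertex e)
  have "h (word (Vertex w # map Ghost (rev (e # \<mu>)) @ [Vertex u]) * x *
      word (Vertex u # map Edge (e # \<mu>) @ [Vertex w])) =
    h (word (?l @ [Vertex (head E e), Ghost e]) * x * word (Edge e # Vertex (head E e) # ?r))"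
    using l r by (intro h_cong_mult) auto
  also have "\<dots> = h (word (?l @ [Vertex (head E e)]) * (word [Ghost e] * (x * word [Edge e])) *
      word (Vertex (head E e) # ?r))"
    by (simp add: word_mult_word flip: mult.assoc) (simp add: mult.assoc word_mult_word)
  also have "\<dots> = h (Poly_Mapping.single [Vertex w] k)"
    using h_cong_mult[OF h_cong_mult[OF refl mid] refl] k by simp
  finally show ?case by blast
qed

end


section \<open>The graded ring with involution\<close>

context lpa_star_graph
begin

abbreviation R :: "('v, 'e, 'k) lpa_free set ring" where
  "R \<equiv> leavitt_path_algebra E"

abbreviation grading :: "int \<Rightarrow> ('v, 'e, 'k) lpa_free set set" where
  "grading \<equiv> lpa_grading E"

lemma ring_R: "ring R"
  by (rule ring_L)

lemma R_a_inv: "\<ominus>\<^bsub>R\<^esub> h f = h (- f)"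
proof -
  interpret ring R by (rule ring_R)
  show ?thesis by (rule minus_equality) (auto simp: h_add h_zero carrier_L)
qed

lemma R_finsum: "finite A \<Longrightarrow> finsum R (\<lambda>i. h (f i)) A = h (sum f A)"
proof -
  interpret ring R by (rule ring_R)
  show "finite A \<Longrightarrow> finsum R (\<lambda>i. h (f i)) A = h (sum f A)"
    by (induct rule: finite_induct) (auto simp: h_zero carrier_L finsum_insert h_add)
qed

text \<open>Uniqueness of decompositions: lift the components to homogeneous polynomials and compare
  degree parts through \<open>h_degree_part\<close>.\<close>

lemma decomposition_component:
  assumes "decomposition R grading (h f) d"
  shows "d m = h (degree_part m f)"
proof -
  interpret ring R by (rule ring_R)
  let ?A = "{n. d n \<noteq> \<zero>\<^bsub>R\<^esub>}"
  have d: "\<And>n. d n \<in> grading n" "finite ?A" "h f = finsum R d ?A"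
    using assms unfolding decomposition_def by auto
  obtain \<phi> where \<phi>: "\<And>n. homogeneous n (\<phi> n)" "\<And>n. d n = h (\<phi> n)"
    using d(1) unfolding lpa_grading_eq image_iff by (metis mem_Collect_eq)
  have "d = (\<lambda>n. h (\<phi> n))" using \<phi>(2) by blast
  then have "finsum R d ?A = h (sum \<phi> ?A)"
    using R_finsum[OF d(2), of \<phi>] by metis
  then have "h (degree_part m f) = h (degree_part m (sum \<phi> ?A))"
    using d(3) by (intro h_degree_part) simp
  also have "degree_part m (sum \<phi> ?A) = (\<Sum>n\<in>?A. if n = m then \<phi> m else 0)"
    unfolding degree_part_sum by (rule sum.cong) (auto simp: degree_part_homogeneous[OF \<phi>(1)])
  also have "\<dots> = (if m \<in> ?A then \<phi> m else 0)" using d(2) by simp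
  finally show ?thesis using \<phi>(2)[of m] by (auto simp: h_zero del: equalityI split: if_splits)
qed

text \<open>The set \<open>A\<close> may omit degrees in which the polynomial part is nonzero but
  its image is zero. Decompositions are indexed by the nonzero images.\<close>

lemma h_eq_sum_degree_parts:
  assumes "finite A" "\<And>n. n \<notin> A \<Longrightarrow> h (degree_part n f) = h (0 :: ('v, 'e, 'k) lpa_free)"
  shows "h f = h (\<Sum>n\<in>A. degree_part n f)"
proof -
  let ?B = "A \<union> {n. degree_part n f \<noteq> 0}"
  have B: "finite ?B" using assms(1) finite_degree_parts by simp
  have "h (\<Sum>n\<in>?B - A. degree_part n f) = h 0" using assms(2) by (intro h_sum_zero) auto
  from h_cong_add[OF this refl, of "\<Sum>n\<in>A. degree_part n f"]
  have "h ((\<Sum>n\<in>?B - A. degree_part n f) + (\<Sum>n\<in>A. degree_part n f)) = h (\<Sum>n\<in>A. degree_part n f)"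
    by simp
  moreover have "(\<Sum>n\<in>?B - A. degree_part n f) + (\<Sum>n\<in>A. degree_part n f) = (\<Sum>n\<in>?B. degree_part n f)"
    using B by (subst sum.subset_diff[of A ?B]) auto
  moreover have "(\<Sum>n\<in>?B. degree_part n f) = f" using B by (intro sum_degree_parts) auto
  ultimately show ?thesis by simp
qed

lemma degree_parts_zero: "(\<And>n. h (degree_part n f) = h 0) \<Longrightarrow> h f = h (0 :: ('v, 'e, 'k) lpa_free)"
  using h_eq_sum_degree_parts[of "{}" f] by simp

lemma decomposition_degree_parts: "decomposition R grading (h f) (\<lambda>n. h (degree_part n f))"
proof -
  let ?A = "{n. h (degree_part n f) \<noteq> \<zero>\<^bsub>R\<^esub>}"
  have A: "finite ?A"
    by (rule finite_subset[OF _ finite_degree_parts[of f]]) (auto simp: h_zero)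
  have "h f = h (\<Sum>n\<in>?A. degree_part n f)"
    by (rule h_eq_sum_degree_parts[OF A]) (simp add: h_zero)
  then have "h f = finsum R (\<lambda>n. h (degree_part n f)) ?A" by (simp only: R_finsum[OF A])
  moreover have "h (degree_part n f) \<in> grading n" for n
    unfolding lpa_grading_eq using homogeneous_degree_part by blast
  ultimately show ?thesis using A unfolding decomposition_def by blast
qed

lemma additive_subgroup_R:
  assumes "S \<subseteq> carrier R" "h 0 \<in> S" "\<And>f g. h f \<in> S \<Longrightarrow> h g \<in> S \<Longrightarrow> h (f + g) \<in> S"
    "\<And>f. h f \<in> S \<Longrightarrow> h (- f) \<in> S"
  shows "additive_subgroup S R"
proof (rule additive_subgroupI)
  interpret ring R by (rule ring_R)
  show "subgroup S (add_monoid R)"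
  proof (rule add.subgroupI)
    fix a assume a: "a \<in> S"
    then obtain f where "a = h f" using assms(1) by (auto simp: carrier_L)
    then show "\<ominus>\<^bsub>R\<^esub> a \<in> S" using a assms(4) R_a_inv by simp
    fix b assume b: "b \<in> S"
    then obtain g where "b = h g" using assms(1) by (auto simp: carrier_L)
    then show "a \<oplus>\<^bsub>R\<^esub> b \<in> S" using a b \<open>a = h f\<close> assms(3) h_add by metis
  qed (use assms in auto)
qed

lemma additive_subgroup_closed:
  assumes "additive_subgroup S R"
  shows "S \<subseteq> carrier R" "h 0 \<in> S" "h f \<in> S \<Longrightarrow> h g \<in> S \<Longrightarrow> h (f + g) \<in> S" "h f \<in> S \<Longrightarrow> h (- f) \<in> S"
proof -
  interpret ring R by (rule ring_R)
  show "S \<subseteq> carrier R" by (rule additive_subgroup.a_subset[OF assms])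
  show "h 0 \<in> S" using additive_subgroup.zero_closed[OF assms] by (simp add: h_zero)
  show "h f \<in> S \<Longrightarrow> h g \<in> S \<Longrightarrow> h (f + g) \<in> S"
    using additive_subgroup.a_closed[OF assms, of "h f" "h g"] by (simp add: h_add)
  show "h (- f) \<in> S" if "h f \<in> S"
    using subgroup.m_inv_closed[OF additive_subgroup.a_subgroup[OF assms] that] R_a_inv[of f]
    by (simp add: a_inv_def)
qed

lemma additive_subgroup_Int_grading:
  assumes S: "additive_subgroup S R"
  shows "additive_subgroup (S \<inter> grading n) R"
proof (rule additive_subgroup_R)
  have mem: "h f \<in> grading n \<longleftrightarrow> (\<exists>g. homogeneous n g \<and> h f = h g)" for f
    unfolding lpa_grading_eq by auto
  fix f g
  assume f: "h f \<in> S \<inter> grading n"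
  then obtain f' where f': "homogeneous n f'" "h f = h f'" using mem by blast
  have "h (- f) = h (- f')" using h_cong_diff[OF refl f'(2), of 0] by simp
  then show "h (- f) \<in> S \<inter> grading n"
    using additive_subgroup_closed(4)[OF S, of f] f homogeneous_uminus[OF f'(1)] mem by blast
  assume g: "h g \<in> S \<inter> grading n"
  then obtain g' where g': "homogeneous n g'" "h g = h g'" using mem by blast
  show "h (f + g) \<in> S \<inter> grading n"
    using additive_subgroup_closed(3)[OF S, of f g] f g h_cong_add[OF f'(2) g'(2)]
      homogeneous_add[OF f'(1) g'(1)] mem by blast
next
  show "h 0 \<in> S \<inter> grading n"
    using additive_subgroup_closed(2)[OF S] homogeneous_zero unfolding lpa_grading_eq by blast
qed (use additive_subgroup_closed(1)[OF S] in blast)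

lemma internal_direct_sum_R:
  assumes S: "additive_subgroup S R"
    and parts: "\<And>f n. h f \<in> S \<Longrightarrow> h (degree_part n f) \<in> S"
  shows "internal_direct_sum R S (\<lambda>n. S \<inter> grading n)"
  unfolding internal_direct_sum_def
proof (intro conjI allI ballI impI)
  fix n show "additive_subgroup (S \<inter> grading n) R" by (rule additive_subgroup_Int_grading[OF S])
next
  have dec: "decomposition R (\<lambda>n. S \<inter> grading n) x d \<longleftrightarrow> decomposition R grading x d \<and> (\<forall>n. d n \<in> S)" for x d
    unfolding decomposition_def by blast
  fix x assume x: "x \<in> S"
  then obtain f where f: "x = h f" using additive_subgroup_closed(1)[OF S] by (auto simp: carrier_L)
  show "\<exists>!d. decomposition R (\<lambda>n. S \<inter> grading n) x d"
  proof (rule ex1I[of _ "\<lambda>n. h (degree_part n f)"])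
    show "decomposition R (\<lambda>n. S \<inter> grading n) x (\<lambda>n. h (degree_part n f))"
      unfolding dec using decomposition_degree_parts[of f] parts x f by blast
    fix d assume "decomposition R (\<lambda>n. S \<inter> grading n) x d"
    then show "d = (\<lambda>n. h (degree_part n f))"
      unfolding dec f using decomposition_component by blast
  qed
next
  fix x d assume d: "decomposition R (\<lambda>n. S \<inter> grading n) x d"
  interpret ring R by (rule ring_R)
  have dS: "d n \<in> S" for n using d unfolding decomposition_def by blast
  have "finsum R d A \<in> S" if "finite A" for A
    using that
  proof (induct rule: finite_induct)
    case empty
    then show ?case using additive_subgroup.zero_closed[OF S] by simp
  next
    case (insert n A)
    have "finsum R d (insert n A) = d n \<oplus>\<^bsub>R\<^esub> finsum R d A"
      using insert dS additive_subgroup_closed(1)[OF S] by (intro finsum_insert) auto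
    then show ?case using additive_subgroup.a_closed[OF S dS insert(3)] by simp
  qed
  then show "x \<in> S" using d unfolding decomposition_def by blast
qed

lemma graded_ideal_parts:
  assumes "graded_ideal R grading I" "h f \<in> I"
  shows "h (degree_part n f) \<in> I"
proof -
  obtain d where d: "decomposition R (\<lambda>n. I \<inter> grading n) (h f) d"
    using assms unfolding graded_ideal_def internal_direct_sum_def by blast
  then have "decomposition R grading (h f) d" "d n \<in> I" unfolding decomposition_def by blast+
  then show ?thesis using decomposition_component by metis
qed

lemma graded_idealI:
  assumes I: "ideal I R" and parts: "\<And>f n. h f \<in> I \<Longrightarrow> h (degree_part n f) \<in> I"
  shows "graded_ideal R grading I"
  unfolding graded_ideal_def
  using I internal_direct_sum_R[OF ideal.axioms(1)[OF I] parts] by blast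

lemma graded_star_ring_R: "graded_star_ring R grading (lpa_star E bar)"
proof -
  have car: "additive_subgroup (carrier R) R"
    by (rule additive_subgroup_R) (auto simp: carrier_L)
  have sub: "carrier R \<inter> grading n = grading n" for n
    unfolding lpa_grading_eq by (auto simp: carrier_L)
  have "internal_direct_sum R (carrier R) grading"
    using internal_direct_sum_R[OF car] unfolding sub by (simp add: carrier_L)
  moreover have "x \<otimes>\<^bsub>R\<^esub> y \<in> grading (m + n)" if "x \<in> grading m" "y \<in> grading n" for x y m n
    using that homogeneous_mult unfolding lpa_grading_eq by (force simp: h_mult)
  ultimately have "graded_ring R grading" using ring_R unfolding graded_ring_def by blast
  moreover have "ring_involution R (lpa_star E bar)"
    unfolding ring_involution_def carrier_L
    by (auto simp: lpa_star_h h_add h_mult star_add star_mult del: equalityI)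
  moreover have "lpa_star E bar ` grading n \<subseteq> grading (- n)" for n
    unfolding lpa_grading_eq using homogeneous_star[of n]
    by (auto simp: lpa_star_h intro!: imageI del: equalityI)
  ultimately show ?thesis unfolding graded_star_ring_def by blast
qed


section \<open>Ideals and vertices\<close>

text \<open>Ideals of the algebra viewed as \<open>h\<close>-invariant predicates on polynomials,
  which spares carrier conditions. Closure under negation is multiplication by
  \<open>- 1\<close>.\<close>

definition two_sided :: "(('v, 'e, 'k) lpa_free \<Rightarrow> bool) \<Rightarrow> bool" where
  "two_sided P \<longleftrightarrow> P 0 \<and> (\<forall>f g. P f \<longrightarrow> P g \<longrightarrow> P (f + g)) \<and> (\<forall>f x. P f \<longrightarrow> P (x * f) \<and> P (f * x)) \<and>
    (\<forall>f g. h f = h g \<longrightarrow> P f \<longrightarrow> P g)"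

lemma two_sidedD:
  assumes "two_sided P"
  shows "P 0" "P f \<Longrightarrow> P g \<Longrightarrow> P (f + g)" "P f \<Longrightarrow> P (x * f)" "P f \<Longrightarrow> P (f * x)"
    "h f = h g \<Longrightarrow> P f \<Longrightarrow> P g"
  using assms unfolding two_sided_def by blast+

lemma two_sided_sum: "two_sided P \<Longrightarrow> (\<And>i. i \<in> A \<Longrightarrow> P (f i)) \<Longrightarrow> P (sum f A)"
  by (induct A rule: infinite_finite_induct) (auto intro: two_sidedD)

lemma two_sided_ideal: "ideal I R \<Longrightarrow> two_sided (\<lambda>f. h f \<in> I)"
  unfolding two_sided_def
  using additive_subgroup_closed[OF ideal.axioms(1), of I] ideal.I_l_closed[of I R] ideal.I_r_closed[of I R]
  by (auto simp: carrier_L h_mult[symmetric])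

lemma ideal_of_two_sided:
  assumes P: "two_sided P"
  shows "ideal (h ` {f. P f}) R" "h f \<in> h ` {f. P f} \<longleftrightarrow> P f"
proof -
  show mem: "h f \<in> h ` {f. P f} \<longleftrightarrow> P f" for f using two_sidedD(5)[OF P] by auto
  have neg: "P (- f)" if "P f" for f using two_sidedD(3)[OF P that, of "- 1"] by simp
  show "ideal (h ` {f. P f}) R"
  proof (rule idealI[OF ring_R])
    show "subgroup (h ` {f. P f}) (add_monoid R)"
      by (rule additive_subgroup.a_subgroup, rule additive_subgroup_R)
        (use neg two_sidedD[OF P] mem in \<open>auto simp: carrier_L\<close>)
  qed (use two_sidedD(3,4)[OF P] in \<open>auto simp: carrier_L h_mult\<close>)
qed

lemma two_sided_scalar:
  assumes P: "two_sided P" and k: "k \<noteq> 0" "P (Poly_Mapping.single w k)"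
  shows "P (word w)"
  using two_sidedD(3)[OF P k(2), of "Poly_Mapping.single [] (inverse k)"] k
  by (simp add: single_mult_single word_def)

text \<open>For a path \<open>p\<close> from \<open>v\<close> to \<open>w\<close> one has
  \<open>p^* v p = w\<close>.\<close>

lemma two_sided_walk:
  assumes P: "two_sided P" and v: "P (word [Vertex v])" "awalk v p w"
  shows "P (word [Vertex w])"
proof -
  have "h (word (Vertex w # map Ghost (rev p)) * word [Vertex v] * word (Vertex v # map Edge p @ [Vertex w])) =
      hw [Vertex w]"
    using ghost_path_mult_path[OF v(2)] by (simp add: word_mult_word)
  from two_sidedD(5)[OF P this two_sidedD(4)[OF P two_sidedD(3)[OF P v(1)]]] show ?thesis .
qed

text \<open>Heredity is \<open>two_sided_walk\<close>; saturation follows from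
  \<open>v = \<Sum>e r(e) e^*\<close>.\<close>

lemma hersat_vertices:
  assumes P: "two_sided P"
  shows "hersat E {v \<in> verts E. P (word [Vertex v])}"
proof -
  have "hereditary E {v \<in> verts E. P (word [Vertex v])}"
    unfolding hereditary_def emits_path_def using two_sided_walk[OF P] awalk_last_in_verts by blast
  moreover have "v \<in> {v \<in> verts E. P (word [Vertex v])}"
    if v: "regular_vertex E v" "head E ` out_arcs E v \<subseteq> {v \<in> verts E. P (word [Vertex v])}" for v
  proof -
    have v': "v \<in> verts E" "out_arcs E v \<noteq> {}" using v unfolding regular_vertex_def by auto
    have "P (\<Sum>e\<in>out_arcs E v. word [Edge e, Ghost e])"
    proof (rule two_sided_sum[OF P])
      fix e assume "e \<in> out_arcs E v"
      then have "P (word [Vertex (head E e)])" using v(2) by blast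
      from two_sidedD(4)[OF P two_sidedD(3)[OF P this]]
      have "P (word [Edge e] * word [Vertex (head E e)] * word [Ghost e])" .
      moreover have "h (word [Edge e] * word [Vertex (head E e)] * word [Ghost e]) = hw [Edge e, Ghost e]"
        by (simp add: hw_Cons_vertex word_mult_word)
      ultimately show "P (word [Edge e, Ghost e])" using two_sidedD(5)[OF P] by blast
    qed
    then show ?thesis using two_sidedD(5)[OF P h_CK2[OF v']] v' by simp
  qed
  ultimately show ?thesis unfolding hersat_def saturated_def by blast
qed

lemma vertex_square: "hw [Vertex v] = h (word [Vertex v] * word [Vertex v])"
  by (simp add: word_mult_word hw_left_vertex)

lemma scalar_vertex_nonzero:
  assumes "v \<in> verts E" "k \<noteq> 0"
  shows "h (Poly_Mapping.single [Vertex v] k) \<noteq> h (0 :: ('v, 'e, 'k) lpa_free)"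
proof
  assume "h (Poly_Mapping.single [Vertex v] k) = h 0"
  then have "h (Poly_Mapping.single [] (inverse k) * Poly_Mapping.single [Vertex v] k) = h 0"
    by (rule h_mult_zero(2))
  then show False using assms vertex_nonzero[OF assms(1)] by (simp add: single_mult_single word_def)
qed

text \<open>The common end \<open>z\<close> is the right end of the last symbol before the ghost
  part; inserting it there leaves the value unchanged and splits the word into two nonzero
  halves.\<close>

lemma path_mon_nonzero:
  assumes "hw (path_mon u p q v) \<noteq> h 0"
  shows "\<exists>z. awalk u p z \<and> awalk v q z"
proof -
  let ?b = "map Ghost (rev q) @ [Vertex v]"
  obtain a x where a: "Vertex u # map Edge p = a @ [x]" by (metis list.distinct(1) rev_exhaust)
  let ?z = "right_vertex x"
  have "hw (a @ [x, Vertex ?z] @ ?b) = hw (a @ [x] @ ?b)"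
    by (rule hw_cong) (simp add: hw_right_vertex)
  moreover have "path_mon u p q v = a @ [x] @ ?b"
    using arg_cong[OF a, of "\<lambda>t. t @ ?b"] by simp
  moreover have "(Vertex u # map Edge p) @ [Vertex ?z] @ ?b = a @ [x, Vertex ?z] @ ?b"
    unfolding a by simp
  ultimately have nz: "hw ((Vertex u # map Edge p) @ [Vertex ?z] @ ?b) \<noteq> h 0"
    using assms by metis
  have "hw (Vertex u # map Edge p @ [Vertex ?z]) \<noteq> h 0"
    using nz hw_cong_zero[of "Vertex u # map Edge p @ [Vertex ?z]" "[]" ?b] by auto
  moreover have "hw (Vertex ?z # ?b) \<noteq> h 0"
    using nz hw_cong_zero[of "Vertex ?z # ?b" "Vertex u # map Edge p" "[]"] by auto
  ultimately show ?thesis using real_path_nonzero ghost_path_nonzero by blast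
qed

text \<open>In degree \<open>m + n\<close>, the component of \<open>x y_n\<close> is
  \<open>x_m y_n\<close>. This and its mirror image show that annihilators of graded ideals are
  graded.\<close>

lemma degree_part_mult_left_zero:
  fixes x y :: "('v, 'e, 'k) lpa_free"
  assumes "\<And>n. h (x * degree_part n y) = h 0"
  shows "h (degree_part m x * y) = h 0"
proof -
  have "h (degree_part m x * degree_part n y) = h 0" for n
    using h_degree_part[OF assms[of n], of "m + n"]
    by (simp add: degree_part_mult_right[OF homogeneous_degree_part])
  then have "h (degree_part m x * (\<Sum>n\<in>{n. degree_part n y \<noteq> 0}. degree_part n y)) = h 0"
    by (simp add: sum_distrib_left h_sum_zero)
  then show ?thesis using sum_degree_parts[OF finite_degree_parts subset_refl, of y] by simp
qed

lemma degree_part_mult_right_zero: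
  fixes x y :: "('v, 'e, 'k) lpa_free"
  assumes "\<And>n. h (degree_part n x * y) = h 0"
  shows "h (x * degree_part m y) = h 0"
proof -
  have "h (degree_part n x * degree_part m y) = h 0" for n
    using h_degree_part[OF assms[of n], of "n + m"]
    by (simp add: degree_part_mult_left[OF homogeneous_degree_part])
  then have "h ((\<Sum>n\<in>{n. degree_part n x \<noteq> 0}. degree_part n x) * degree_part m y) = h 0"
    by (simp add: sum_distrib_right h_sum_zero)
  then show ?thesis using sum_degree_parts[OF finite_degree_parts subset_refl, of x] by simp
qed

lemma star_degree_part: "star (degree_part n f) = degree_part (- n) (star f)"
  by (rule additive_map_eqI[where f = f])
    (auto simp: star_add degree_part_add star_single degree_part_single)

end


section \<open>Annihilators of graded ideals\<close>

context lpa_star_graph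
begin

text \<open>Closure under left factors rests on \<open>y (x f) = (y x) f\<close>, where
  \<open>y x\<close> again satisfies \<open>P\<close>.\<close>

lemma annihilator_two_sided:
  assumes P: "two_sided P"
  shows "two_sided (\<lambda>f. \<forall>x. P x \<longrightarrow> h (x * f) = h 0)"
  unfolding two_sided_def
proof (intro conjI allI impI)
  fix f g x y
  assume f: "\<forall>x. P x \<longrightarrow> h (x * f) = h 0" and y: "P y"
  show "h (y * (x * f)) = h 0"
    using f[rule_format, OF two_sidedD(4)[OF P y, of x]] by (simp only: mult.assoc)
  show "h (y * (f * x)) = h 0"
    using h_mult_zero(1)[OF f[rule_format, OF y], of x] by (simp only: mult.assoc)
  show "h (y * g) = h 0" if "h f = h g"
    using f[rule_format, OF y] h_cong_mult[OF refl that, of y] by simp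
  show "h (y * (f + g)) = h 0" if "\<forall>x. P x \<longrightarrow> h (x * g) = h 0"
    using h_cong_add[OF f[rule_format, OF y] that[rule_format, OF y]] by (simp add: distrib_left)
qed simp

lemma annihilator_eq:
  assumes "I \<subseteq> carrier R"
  shows "h f \<in> right_annihilator R I \<longleftrightarrow> (\<forall>x. h x \<in> I \<longrightarrow> h (x * f) = h 0)"
  using assms unfolding right_annihilator_def carrier_L
  by (auto simp: h_mult h_zero del: equalityI)

text \<open>Along such a path \<open>w\<close> would be annihilated too, although it lies in the
  ideal, so that \<open>w = w w = 0\<close>.\<close>

lemma not_emits_annihilated_vertex:
  assumes P: "two_sided P" and u: "\<forall>x. P x \<longrightarrow> h (x * word [Vertex u]) = h 0"
    and w: "P (word [Vertex w])" "w \<in> verts E"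
  shows "\<not> emits_path E u w"
proof
  assume "emits_path E u w"
  then obtain p where p: "awalk u p w" unfolding emits_path_def by blast
  have "h (word [Vertex w] * word [Vertex w]) = h (0 :: ('v, 'e, 'k) lpa_free)"
    using two_sided_walk[OF annihilator_two_sided[OF P] u p] w(1) by blast
  then show False using vertex_square[of w] vertex_nonzero[OF w(2)] by simp
qed

text \<open>A nonzero component of \<open>x v\<close> compresses to a vertex \<open>w\<close> of the
  ideal. The path multiplied on the right leads from \<open>v\<close> to \<open>w\<close>, against
  the choice of \<open>v\<close>.\<close>

lemma perp_annihilates:
  assumes P: "two_sided P" and parts: "\<And>f n. P f \<Longrightarrow> P (degree_part n f)"
    and v: "v \<in> perp E {w \<in> verts E. P (word [Vertex w])}" and x: "P x"
  shows "h (x * word [Vertex v]) = h 0"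
proof (rule ccontr)
  assume "h (x * word [Vertex v]) \<noteq> h 0"
  then obtain n where n: "h (degree_part n (x * word [Vertex v])) \<noteq> h 0"
    using degree_parts_zero by blast
  let ?z = "degree_part n x * word [Vertex v]"
  have z: "degree_part n (x * word [Vertex v]) = ?z"
    by (subst degree_part_mult_right[of 0]) (auto simp: homogeneous_word)
  have hom: "homogeneous n ?z" unfolding z[symmetric] by (rule homogeneous_degree_part)
  have "h ?z \<noteq> h 0" using n unfolding z .
  from homogeneous_nonzero_compress[OF hom this]
  obtain w u p q k where c: "w \<in> verts E" "k \<noteq> 0"
    "h (word (Vertex w # map Ghost (rev p) @ [Vertex u]) * ?z * word (map Edge q @ [Vertex w])) =
      h (Poly_Mapping.single [Vertex w] k)"
    by blast
  let ?a = "word (Vertex w # map Ghost (rev p) @ [Vertex u]) :: ('v, 'e, 'k) lpa_free"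
    and ?b = "word (map Edge q @ [Vertex w]) :: ('v, 'e, 'k) lpa_free"
  have nz: "h (?a * ?z * ?b) \<noteq> h 0" using c scalar_vertex_nonzero[OF c(1,2)] by simp
  have "?a * ?z * ?b = ?a * degree_part n x * word (Vertex v # map Edge q @ [Vertex w])"
    by (simp add: mult.assoc word_mult_word)
  then have "hw (Vertex v # map Edge q @ [Vertex w]) \<noteq> h 0" using nz h_mult_zero(2) by metis
  then have "emits_path E v w" using real_path_nonzero unfolding emits_path_def by blast
  moreover have "P (Poly_Mapping.single [Vertex w] k)"
    using two_sidedD(5)[OF P c(3)] two_sidedD(3,4)[OF P] parts[OF x] by blast
  then have "P (word [Vertex w])" by (rule two_sided_scalar[OF P c(2)])
  ultimately show False using v c(1) unfolding perp_iff by blast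
qed

text \<open>The mirror image of \<open>perp_annihilates\<close>: the ghost path on the left now
  gives the path from \<open>v\<close> to \<open>w\<close>, and \<open>w\<close> lies in the
  annihilator, hence in the orthogonal set of the ideal's vertices.\<close>

lemma perp_perp_annihilates:
  assumes P: "two_sided P"
    and parts: "\<And>y n. (\<forall>x. P x \<longrightarrow> h (x * y) = h 0) \<Longrightarrow> (\<forall>x. P x \<longrightarrow> h (x * degree_part n y) = h 0)"
    and v: "v \<in> perp E (perp E {w \<in> verts E. P (word [Vertex w])})"
    and y: "\<forall>x. P x \<longrightarrow> h (x * y) = h 0"
  shows "h (word [Vertex v] * y) = h 0"
proof (rule ccontr)
  assume "h (word [Vertex v] * y) \<noteq> h 0"
  then obtain n where n: "h (degree_part n (word [Vertex v] * y)) \<noteq> h 0"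
    using degree_parts_zero by blast
  let ?Ann = "\<lambda>f. \<forall>x. P x \<longrightarrow> h (x * f) = h 0"
  note Ann = annihilator_two_sided[OF P]
  let ?z = "word [Vertex v] * degree_part n y"
  have z: "degree_part n (word [Vertex v] * y) = ?z"
    by (subst degree_part_mult_left[of 0]) (auto simp: homogeneous_word)
  have hom: "homogeneous n ?z" unfolding z[symmetric] by (rule homogeneous_degree_part)
  have "h ?z \<noteq> h 0" using n unfolding z .
  from homogeneous_nonzero_compress[OF hom this]
  obtain w u p q k where c: "w \<in> verts E" "k \<noteq> 0"
    "h (word (Vertex w # map Ghost (rev p) @ [Vertex u]) * ?z * word (map Edge q @ [Vertex w])) =
      h (Poly_Mapping.single [Vertex w] k)"
    by blast
  let ?a = "word (Vertex w # map Ghost (rev p) @ [Vertex u]) :: ('v, 'e, 'k) lpa_free"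
    and ?b = "word (map Edge q @ [Vertex w]) :: ('v, 'e, 'k) lpa_free"
  have nz: "h (?a * ?z * ?b) \<noteq> h 0" using c scalar_vertex_nonzero[OF c(1,2)] by simp
  have "?a * ?z * ?b = word ((Vertex w # map Ghost (rev p)) @ [Vertex u, Vertex v]) * (degree_part n y * ?b)"
    by (simp add: word_mult_word flip: mult.assoc)
  then have nz': "hw ((Vertex w # map Ghost (rev p)) @ [Vertex u, Vertex v]) \<noteq> h 0"
    using nz h_mult_zero(1) by metis
  then have "hw [Vertex u, Vertex v] \<noteq> h 0"
    using hw_cong_zero[of "[Vertex u, Vertex v]" "Vertex w # map Ghost (rev p)" "[]"] by auto
  then have uv: "u = v" using hw_left_vertex[of u "Vertex v"] by (auto split: if_splits del: equalityI)
  have "hw (Vertex w # map Ghost (rev p) @ [Vertex v]) \<noteq> h 0"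
    using nz' hw_cong[of "[Vertex u, Vertex v]" "[Vertex v]" "Vertex w # map Ghost (rev p)" "[]"] uv
    by (simp add: hw_left_vertex)
  then have "emits_path E v w" using ghost_path_nonzero unfolding emits_path_def by blast
  moreover have "?Ann (degree_part n y)" by (rule parts[OF y])
  from two_sidedD(4)[OF Ann two_sidedD(3)[OF Ann two_sidedD(3)[OF Ann this]]]
  have "?Ann (?a * ?z * ?b)" .
  from two_sidedD(5)[OF Ann c(3) this] have "?Ann (Poly_Mapping.single [Vertex w] k)" .
  then have wAnn: "?Ann (word [Vertex w])" by (rule two_sided_scalar[OF Ann c(2)])
  have "w \<in> perp E {w \<in> verts E. P (word [Vertex w])}"
    unfolding perp_iff using c(1) not_emits_annihilated_vertex[OF P wAnn] by blast
  ultimately show False using v unfolding perp_iff[of _ _ "perp _ _"] by blast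
qed

lemma annihilator_projection:
  assumes I: "graded_ideal R grading I"
    and closure: "\<And>H. hersat E H \<Longrightarrow> H \<noteq> {} \<Longrightarrow> saturated_closure E (perp E H \<union> perp E (perp E H)) = verts E"
  shows "\<exists>p\<in>homogeneous_elements grading. projection R (lpa_star E bar) p \<and>
    right_annihilator R I = (\<lambda>r. p \<otimes>\<^bsub>R\<^esub> r) ` carrier R"
proof -
  have ideal: "ideal I R" using I unfolding graded_ideal_def by blast
  define P where "P f \<longleftrightarrow> h f \<in> I" for f
  have P: "two_sided P" unfolding P_def by (rule two_sided_ideal[OF ideal])
  have Pparts: "P (degree_part n f)" if "P f" for f n
    using that graded_ideal_parts[OF I] unfolding P_def by blast
  define Ann where "Ann f \<longleftrightarrow> (\<forall>x. P x \<longrightarrow> h (x * f) = h 0)" for f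
  have Ann: "two_sided Ann" unfolding Ann_def by (rule annihilator_two_sided[OF P])
  have Annparts: "Ann (degree_part n f)" if "Ann f" for f n
    unfolding Ann_def
  proof (intro allI impI)
    fix x assume "P x"
    then show "h (x * degree_part n f) = h 0"
      using that Pparts unfolding Ann_def by (intro degree_part_mult_right_zero) blast
  qed
  \<comment> \<open>The condition is symmetric under \<open>star\<close>, and it is the half with
    \<open>star q\<close> that later makes the generator self-adjoint. It still defines an ideal
    because \<open>Ann\<close> absorbs factors on the left.\<close>
  define B where "B q \<longleftrightarrow> (\<forall>y. Ann y \<longrightarrow> h (q * y) = h 0 \<and> h (star q * y) = h 0)" for q
  have B: "two_sided B"
    unfolding two_sided_def
  proof (intro conjI allI impI)
    show "B 0" unfolding B_def by simp
    fix f g x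
    assume f: "B f"
    show "B (x * f)"
      unfolding B_def
    proof (intro allI impI conjI)
      fix y assume y: "Ann y"
      show "h (x * f * y) = h 0"
        using f y h_mult_zero(2)[of "f * y" x] unfolding B_def by (simp add: mult.assoc)
      show "h (star (x * f) * y) = h 0"
        using f two_sidedD(3)[OF Ann y, of "star x"] unfolding B_def by (simp add: mult.assoc star_mult)
    qed
    show "B (f * x)"
      unfolding B_def
    proof (intro allI impI conjI)
      fix y assume y: "Ann y"
      show "h (f * x * y) = h 0"
        using f two_sidedD(3)[OF Ann y, of x] unfolding B_def by (simp add: mult.assoc)
      show "h (star (f * x) * y) = h 0"
        using f y h_mult_zero(2)[of "star f * y" "star x"] unfolding B_def
        by (simp add: mult.assoc star_mult)
    qed
    show "B g" if fg: "h f = h g"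
      unfolding B_def
    proof (intro allI impI)
      fix y assume y: "Ann y"
      show "h (g * y) = h 0 \<and> h (star g * y) = h 0"
        using f y h_cong_mult[OF fg refl, of y] h_cong_mult[OF h_star[OF fg] refl, of y]
        unfolding B_def by simp
    qed
    show "B (f + g)" if g: "B g"
      unfolding B_def
    proof (intro allI impI)
      fix y assume y: "Ann y"
      show "h ((f + g) * y) = h 0 \<and> h (star (f + g) * y) = h 0"
        using f g y h_cong_add[of "f * y" 0 "g * y" 0] h_cong_add[of "star f * y" 0 "star g * y" 0]
        unfolding B_def by (simp add: distrib_right star_add)
    qed
  qed
  have Bparts: "B (degree_part n q)" if q: "B q" for q n
    unfolding B_def
  proof (intro allI impI conjI)
    fix y assume y: "Ann y"
    show "h (degree_part n q * y) = h 0"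
      by (rule degree_part_mult_left_zero) (use q Annparts[OF y] in \<open>simp add: B_def\<close>)
    show "h (star (degree_part n q) * y) = h 0"
      unfolding star_degree_part
      by (rule degree_part_mult_left_zero) (use q Annparts[OF y] in \<open>simp add: B_def\<close>)
  qed
  \<comment> \<open>The sum of the two ideals; its vertices form a hereditary and saturated set, to
    which the closure hypothesis applies.\<close>
  define C where "C f \<longleftrightarrow> (\<exists>a b. Ann a \<and> B b \<and> h f = h (a + b))" for f
  have C: "two_sided C"
    unfolding two_sided_def
  proof (intro conjI allI impI)
    show "C 0" unfolding C_def using two_sidedD(1)[OF Ann] two_sidedD(1)[OF B]
      by (intro exI[of _ 0]) simp
    fix f g x
    assume "C f"
    then obtain a b where ab: "Ann a" "B b" "h f = h (a + b)" unfolding C_def by blast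
    show "C (x * f)" unfolding C_def
      using two_sidedD(3)[OF Ann ab(1), of x] two_sidedD(3)[OF B ab(2), of x] h_cong_mult[OF refl ab(3), of x]
      by (intro exI[of _ "x * a"] exI[of _ "x * b"]) (simp add: distrib_left)
    show "C (f * x)" unfolding C_def
      using two_sidedD(4)[OF Ann ab(1), of x] two_sidedD(4)[OF B ab(2), of x] h_cong_mult[OF ab(3) refl, of x]
      by (intro exI[of _ "a * x"] exI[of _ "b * x"]) (simp add: distrib_right)
    show "C g" if "h f = h g" unfolding C_def using ab that by (intro exI[of _ a] exI[of _ b]) simp
    show "C (f + g)" if "C g"
    proof -
      obtain c d where cd: "Ann c" "B d" "h g = h (c + d)" using \<open>C g\<close> unfolding C_def by blast
      have "h (f + g) = h ((a + c) + (b + d))"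
        using h_cong_add[OF ab(3) cd(3)] by (simp add: algebra_simps)
      then show ?thesis unfolding C_def
        using two_sidedD(2)[OF Ann ab(1) cd(1)] two_sidedD(2)[OF B ab(2) cd(2)] by blast
    qed
  qed
  let ?H = "{w \<in> verts E. P (word [Vertex w])}"
  let ?S = "{w \<in> verts E. C (word [Vertex w])}"
  have sub: "perp E ?H \<union> perp E (perp E ?H) \<subseteq> ?S"
  proof
    fix v assume v: "v \<in> perp E ?H \<union> perp E (perp E ?H)"
    then have "v \<in> verts E" by (auto simp: perp_iff[of v])
    moreover have "C (word [Vertex v])"
      using v
    proof
      assume "v \<in> perp E ?H"
      then have "Ann (word [Vertex v])" unfolding Ann_def using perp_annihilates[OF P Pparts] by blast
      then show ?thesis unfolding C_def using two_sidedD(1)[OF B]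
        by (intro exI[of _ "word [Vertex v]"] exI[of _ 0]) simp
    next
      assume "v \<in> perp E (perp E ?H)"
      then have "h (word [Vertex v] * y) = h 0" if "Ann y" for y
        using perp_perp_annihilates[OF P Annparts[unfolded Ann_def] _ that[unfolded Ann_def]] by blast
      then have "B (word [Vertex v])" unfolding B_def by simp
      then show ?thesis unfolding C_def using two_sidedD(1)[OF Ann]
        by (intro exI[of _ 0] exI[of _ "word [Vertex v]"]) simp
    qed
    ultimately show "v \<in> ?S" by blast
  qed
  have "verts E \<subseteq> ?S"
  \<comment> \<open>The closure hypothesis covers nonempty sets only; an ideal without vertices has
    every vertex in its orthogonal set.\<close>
  proof (cases "?H = {}")
    case True
    then have "perp E ?H = verts E" unfolding True by (auto simp: perp_iff)
    then show ?thesis using sub by blast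
  next
    case False
    from closure[OF hersat_vertices[OF P] False] show ?thesis
      using sub hersat_vertices[OF C] unfolding saturated_closure_def by blast
  qed
  then have "C (vertex_sum E)" unfolding vertex_sum_def by (intro two_sided_sum[OF C]) blast
  then have "C 1" by (rule two_sidedD(5)[OF C h_vertex_sum])
  then obtain p q where pq: "Ann p" "B q" "h 1 = h (p + q)" unfolding C_def by blast
  \<comment> \<open>The unit has degree zero, so the degree-zero parts already sum to it; this makes
    the projection homogeneous.\<close>
  define p0 where "p0 = degree_part 0 p"
  define q0 where "q0 = degree_part 0 q"
  have "homogeneous 0 (1 :: ('v, 'e, 'k) lpa_free)"
    by (simp add: homogeneous_def zero_list_def)
  then have one: "h 1 = h (p0 + q0)"
    using h_degree_part[OF pq(3), of 0] unfolding p0_def q0_def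
    by (simp add: degree_part_homogeneous degree_part_add)
  have p0: "Ann p0" "homogeneous 0 p0"
    unfolding p0_def by (rule Annparts[OF pq(1)], rule homogeneous_degree_part)
  have q0: "B q0" unfolding q0_def by (rule Bparts[OF pq(2)])
  have unit: "h y = h (p0 * y)" if y: "Ann y" for y
  proof -
    have "h y = h ((p0 + q0) * y)" using h_cong_mult[OF one refl, of y] by simp
    also have "\<dots> = h (p0 * y)"
      using q0 y h_cong_add[of "p0 * y" "p0 * y" "q0 * y" 0] unfolding B_def by (simp add: distrib_right)
    finally show ?thesis .
  qed
  have "(1 :: ('v, 'e, 'k) lpa_free) = word []" by (simp add: word_def flip: zero_list_def)
  then have "star (1 :: ('v, 'e, 'k) lpa_free) = 1" by (metis star_word word_star_simps(1))
  \<comment> \<open>Multiplying by \<open>p0\<close> on the right removes \<open>star q0\<close> and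
    leaves \<open>p0 = star p0 * p0\<close>, whose right side is self-adjoint.\<close>
  then have "h 1 = h (star p0 + star q0)" using h_star[OF one] by (simp add: star_add)
  from h_cong_mult[OF this refl, of p0] have "h p0 = h (star p0 * p0 + star q0 * p0)"
    by (simp add: distrib_right)
  also have "\<dots> = h (star p0 * p0)"
    using q0 p0 h_cong_add[of "star p0 * p0" "star p0 * p0" "star q0 * p0" 0] unfolding B_def by simp
  finally have pstar: "h p0 = h (star p0 * p0)" .
  from h_star[OF this] have "h (star p0) = h (star p0 * p0)" by (simp add: star_mult)
  then have star: "h (star p0) = h p0" using pstar by simp
  have "h p0 \<in> homogeneous_elements grading"
    unfolding homogeneous_elements_def lpa_grading_eq using p0 by blast
  moreover have "projection R (lpa_star E bar) (h p0)"
    unfolding projection_def using unit[OF p0(1), symmetric] star by (simp add: carrier_L h_mult lpa_star_h)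
  moreover have "right_annihilator R I = (\<lambda>r. h p0 \<otimes>\<^bsub>R\<^esub> r) ` carrier R"
  proof -
    have IR: "I \<subseteq> carrier R" by (rule additive_subgroup_closed(1)[OF ideal.axioms(1)[OF ideal]])
    have mem: "h f \<in> right_annihilator R I \<longleftrightarrow> Ann f" for f
      unfolding annihilator_eq[OF IR] Ann_def P_def ..
    show ?thesis
    proof (intro equalityI subsetI)
      fix x assume x: "x \<in> right_annihilator R I"
      then obtain f where f: "x = h f" unfolding right_annihilator_def by (auto simp: carrier_L)
      then have "Ann f" using x mem by simp
      then have "x = h p0 \<otimes>\<^bsub>R\<^esub> h f" unfolding f h_mult by (rule unit)
      then show "x \<in> (\<lambda>r. h p0 \<otimes>\<^bsub>R\<^esub> r) ` carrier R" by (auto simp: carrier_L)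
    next
      fix x assume "x \<in> (\<lambda>r. h p0 \<otimes>\<^bsub>R\<^esub> r) ` carrier R"
      then obtain f where "x = h (p0 * f)" by (auto simp: carrier_L h_mult)
      then show "x \<in> right_annihilator R I" using two_sidedD(4)[OF Ann p0(1), of f] mem by simp
    qed
  qed
  ultimately show ?thesis by blast
qed

text \<open>A nonzero monomial between \<open>v\<close> and \<open>w\<close> would give both a path
  to a common vertex, which lies in \<open>H\<close> by heredity although \<open>w\<close> cannot
  reach \<open>H\<close>.\<close>

lemma vertex_annihilates_perp:
  assumes H: "hereditary E H" and v: "v \<in> H" and w: "w \<in> perp E H"
  shows "h (word [Vertex v] * g * word [Vertex w]) = h (0 :: ('v, 'e, 'k) lpa_free)"
proof (rule poly_mapping_keys_induct[where f = g])
  fix b and k :: 'k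
  have "hw (Vertex v # b @ [Vertex w]) = h 0"
  proof (rule ccontr)
    assume nz: "hw (Vertex v # b @ [Vertex w]) \<noteq> h 0"
    then have "Vertex v # b @ [Vertex w] \<in> lists (lpa_gens E)" using hw_bad by blast
    from word_normal_form[OF _ this nz] obtain u p q u'
      where eq: "hw (Vertex v # b @ [Vertex w]) = hw (path_mon u p q u')" by auto
    have "hw (Vertex v # b @ [Vertex w]) = hw (Vertex v # Vertex v # b @ [Vertex w])"
      by (simp add: hw_vertex_Cons)
    also have "\<dots> = hw (Vertex v # path_mon u p q u')" by (rule hw_Cons_cong[OF eq])
    finally have "v = u" using nz by (auto simp: hw_vertex_Cons split: if_splits del: equalityI)
    have "hw ((Vertex v # b) @ [Vertex w] @ []) = hw ((Vertex v # b) @ [Vertex w, Vertex w] @ [])"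
      by (rule hw_cong) (simp add: hw_left_vertex)
    also have "\<dots> = hw ([] @ path_mon u p q u' @ [Vertex w])"
      using hw_cong[OF eq, of "[]" "[Vertex w]"] by simp
    finally have "hw ((Vertex u # map Edge p @ map Ghost (rev q)) @ [Vertex u', Vertex w] @ []) \<noteq> h 0"
      using nz by simp
    then have "hw [Vertex u', Vertex w] \<noteq> h 0" using hw_cong_zero by blast
    then have "u' = w" by (auto simp: hw_left_vertex split: if_splits del: equalityI)
    have "hw (path_mon u p q u') \<noteq> h 0" using nz eq by simp
    from path_mon_nonzero[OF this] obtain z where "awalk v p z" "awalk w q z"
      using \<open>v = u\<close> \<open>u' = w\<close> by blast
    then have "emits_path E v z" "emits_path E w z" unfolding emits_path_def by blast+
    then show False using H v w unfolding hereditary_def perp_iff by blast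
  qed
  from h_single_cong_zero[OF this, of k]
  show "h (word [Vertex v] * Poly_Mapping.single b k * word [Vertex w]) = h 0"
    by (simp add: word_def single_mult_single)
next
  fix f g :: "('v, 'e, 'k) lpa_free"
  assume "h (word [Vertex v] * f * word [Vertex w]) = h 0" "h (word [Vertex v] * g * word [Vertex w]) = h 0"
  from h_cong_add[OF this] show "h (word [Vertex v] * (f + g) * word [Vertex w]) = h 0"
    by (simp add: distrib_left distrib_right)
qed simp

text \<open>That \<open>p R\<close> is a two-sided ideal gives \<open>r p = p r p\<close> for all \<open>r\<close>; applying the involution,
  \<open>p r = p r p\<close>, so \<open>p\<close> is central.\<close>

lemma quasi_Baer_no_cycle_between:
  assumes baer: "graded_quasi_Baer_star_ring R grading (lpa_star E bar)"
    and H: "hersat E H" and c: "cycle_outside E (H \<union> perp E H) c" and v: "v \<in> cycle_verts E c"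
    and w1: "w1 \<in> H" "emits_path E v w1" and w2: "w2 \<in> perp E H" "emits_path E v w2"
  shows False
proof -
  have her: "hereditary E H" using H unfolding hersat_def by blast
  \<comment> \<open>The left annihilator of the ideal generated by \<open>perp E H\<close>: it
    contains the vertices of \<open>H\<close>, and its right annihilator contains those of
    \<open>perp E H\<close>.\<close>
  define P where "P f \<longleftrightarrow> (\<forall>w\<in>perp E H. \<forall>g. h (f * g * word [Vertex w]) = h 0)"
    for f :: "('v, 'e, 'k) lpa_free"
  have P: "two_sided P"
    unfolding two_sided_def P_def
  proof (intro conjI allI impI ballI, goal_cases)
    case (2 f g w g')
    then show ?case using h_cong_add[of "f * g' * word [Vertex w]" 0 "g * g' * word [Vertex w]" 0]
      by (simp add: distrib_right)
  next
    case (3 f x w g)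
    then show ?case using h_mult_zero(2)[of "f * g * word [Vertex w]" x] by (simp add: mult.assoc)
  next
    case (4 f x w g)
    then have "h (f * (x * g) * word [Vertex w]) = h 0" by blast
    then show ?case by (simp add: mult.assoc)
  next
    case (5 f g w x)
    then show ?case using h_cong_mult[OF h_cong_mult[OF 5(1) refl] refl, of x "word [Vertex w]"] by simp
  qed simp
  have Pparts: "P (degree_part n f)" if f: "P f" for f n
    unfolding P_def
  proof (intro ballI allI)
    fix w g assume w: "w \<in> perp E H"
    show "h (degree_part n f * g * word [Vertex w]) = h 0"
    \<comment> \<open>The middle factor is split into words because the comparison of degrees needs
      a homogeneous right factor.\<close>
    proof (rule poly_mapping_keys_induct[where f = g])
      fix b :: "('v, 'e) lpa_gen list" and k :: 'k
      let ?y = "Poly_Mapping.single b k * word [Vertex w]"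
      have y: "homogeneous (word_degree b) ?y"
        using homogeneous_mult[OF homogeneous_single[OF refl, of b k], of 0 "word [Vertex w]"]
        by (simp add: homogeneous_word)
      have "h (f * ?y) = h 0" using f w unfolding P_def by (simp add: mult.assoc)
      from h_degree_part[OF this, of "n + word_degree b"]
      show "h (degree_part n f * Poly_Mapping.single b k * word [Vertex w]) = h 0"
        by (simp add: degree_part_mult_right[OF y] mult.assoc)
    next
      fix g1 g2 :: "('v, 'e, 'k) lpa_free"
      assume "h (degree_part n f * g1 * word [Vertex w]) = h 0" "h (degree_part n f * g2 * word [Vertex w]) = h 0"
      from h_cong_add[OF this] show "h (degree_part n f * (g1 + g2) * word [Vertex w]) = h 0"
        by (simp add: distrib_left distrib_right)
    qed simp
  qed
  define I where "I = h ` {f. P f}"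
  have I: "ideal I R" "\<And>f. h f \<in> I \<longleftrightarrow> P f"
    unfolding I_def by (rule ideal_of_two_sided(1)[OF P], rule ideal_of_two_sided(2)[OF P])
  have "graded_ideal R grading I" using graded_idealI[OF I(1)] Pparts I(2) by blast
  then obtain e where e: "e \<in> homogeneous_elements grading" "projection R (lpa_star E bar) e"
    "right_annihilator R I = (\<lambda>r. e \<otimes>\<^bsub>R\<^esub> r) ` carrier R"
    using baer unfolding graded_quasi_Baer_star_ring_def by blast
  obtain n p where p: "homogeneous n p" "e = h p"
    using e(1) unfolding homogeneous_elements_def lpa_grading_eq by blast
  have pp: "h (p * p) = h p" and sp: "h (star p) = h p"
    using e(2) unfolding projection_def p(2) by (simp_all add: h_mult lpa_star_h)
  define Ann where "Ann f \<longleftrightarrow> (\<forall>x. P x \<longrightarrow> h (x * f) = h 0)" for f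
  have Ann: "two_sided Ann" unfolding Ann_def by (rule annihilator_two_sided[OF P])
  have IR: "I \<subseteq> carrier R" unfolding I_def by (auto simp: carrier_L)
  have mem: "h f \<in> right_annihilator R I \<longleftrightarrow> Ann f" for f
    unfolding annihilator_eq[OF IR] I(2) Ann_def ..
  have Ann_p: "Ann (p * r)" for r
    unfolding mem[symmetric] e(3) p(2) h_mult[symmetric] by (simp add: carrier_L)
  have unit: "h f = h (p * f)" if f: "Ann f" for f
  proof -
    obtain r where "h f = h (p * r)"
      using f unfolding mem[symmetric] e(3) p(2) by (auto simp: carrier_L h_mult del: equalityI)
    then have "h (p * f) = h (p * (p * r))" by (rule h_cong_mult[OF refl])
    also have "\<dots> = h (p * r)" using h_cong_mult[OF pp refl, of r] by (simp add: mult.assoc)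
    finally show ?thesis using \<open>h f = h (p * r)\<close> by simp
  qed
  have left: "h (r * p) = h (p * (r * p))" for r
    using unit[OF two_sidedD(3)[OF Ann Ann_p[of 1]], of r] by simp
  have right: "h (p * r) = h (p * r * p)" for r
  proof -
    have "h (star (star r * p)) = h (star (p * (star r * p)))" by (rule h_star[OF left])
    then have "h (star p * r) = h (star p * r * star p)" by (simp add: star_mult mult.assoc)
    moreover have "h (star p * r) = h (p * r)" by (rule h_cong_mult[OF sp refl])
    moreover have "h (star p * r * star p) = h (p * r * p)" by (intro h_cong_mult sp refl)
    ultimately show ?thesis by simp
  qed
  have central: "h (p * r) = h (r * p)" for r
    using left[of r] right[of r] by (simp add: mult.assoc)
  \<comment> \<open>A homogeneous idempotent of degree \<open>n\<close> also has degree
    \<open>2 n\<close>, so it is zero unless \<open>n = 0\<close>.\<close>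
  obtain p0 where p0: "homogeneous 0 p0" "h p = h p0"
  proof (cases "n = 0")
    case True
    then show thesis using that p(1) by blast
  next
    case False
    have "h (degree_part n p) = h (degree_part n (p * p))" by (rule h_degree_part[OF pp[symmetric]])
    then have "h p = h 0"
      using False by (simp add: degree_part_homogeneous[OF p(1)] degree_part_homogeneous[OF homogeneous_mult[OF p(1) p(1)]])
    then show thesis using that[of 0] by simp
  qed
  obtain M x where x: "Poly_Mapping.keys x \<subseteq> mons 0 M" "h p0 = h x"
    using homogeneous_eq_mons[OF p0(1)] by blast
  have cyc: "cycle c" using c unfolding cycle_outside_def by blast
  then obtain u where u: "awalk u c u" "c \<noteq> []" unfolding cycle_def by blast
  then have uc: "u \<in> cycle_verts E c"
    unfolding cycle_verts_def by (cases c) (auto simp: awalk_Cons_iff)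
  have uV: "u \<in> verts E" using u by (auto simp: awalk_def)
  have uv: "emits_path E u v" by (rule cycle_emits_path[OF wf_digraph_axioms cyc uc v])
  \<comment> \<open>Since the cycle is nonempty, \<open>M\<close> turns have length at least the
    ghost bound \<open>M\<close> of \<open>x\<close>.\<close>
  define \<mu> where "\<mu> = concat (replicate M c)"
  have walk: "awalk u (concat (replicate m c)) u" for m
    by (induct m) (use u uV in \<open>auto simp: awalk_Nil_iff\<close>)
  have len: "m \<le> length (concat (replicate m c))" for m
  proof (induct m)
    case (Suc m)
    moreover have "1 \<le> length c" using u(2) by (cases c) auto
    ultimately show ?case by simp
  qed simp
  let ?a = "word (Vertex u # map Ghost (rev \<mu>) @ [Vertex u]) :: ('v, 'e, 'k) lpa_free"
    and ?b = "word (Vertex u # map Edge \<mu> @ [Vertex u]) :: ('v, 'e, 'k) lpa_free"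
  obtain k where k: "h (?a * x * ?b) = h (Poly_Mapping.single [Vertex u] k)"
    using degree_zero_compress[OF x(1) walk len] unfolding \<mu>_def by blast
  \<comment> \<open>Centrality turns \<open>p u = p \<mu>^* \<mu>\<close> into
    \<open>\<mu>^* p \<mu>\<close>, which \<open>degree_zero_compress\<close> evaluates.\<close>
  have "h (p * word [Vertex u]) = h (p * (?a * ?b))"
    using ghost_path_mult_path[OF walk[of M]] unfolding \<mu>_def
    by (intro h_cong_mult refl) (simp add: word_mult_word)
  also have "\<dots> = h (?a * p * ?b)" using h_cong_mult[OF central[of ?a] refl, of ?b] by (simp add: mult.assoc)
  also have "\<dots> = h (?a * x * ?b)" using p0(2) x(2) by (intro h_cong_mult refl) simp
  finally have pu: "h (p * word [Vertex u]) = h (Poly_Mapping.single [Vertex u] k)" using k by simp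
  have uw1: "emits_path E u w1" and uw2: "emits_path E u w2"
    using emits_path_trans[OF wf_digraph_axioms uv] w1(2) w2(2) by blast+
  show False
  \<comment> \<open>If \<open>k\<close> is nonzero, \<open>u\<close> is annihilated by the ideal and
    yet reaches its vertex \<open>w1\<close>. If \<open>k = 0\<close>, then \<open>p u = 0\<close>
    propagates along the path to \<open>p w2 = 0\<close>, whereas \<open>p\<close> fixes
    \<open>w2\<close>.\<close>
  proof (cases "k = 0")
    case False
    have "Ann (Poly_Mapping.single [Vertex u] k)" by (rule two_sidedD(5)[OF Ann pu Ann_p])
    then have "Ann (word [Vertex u])" by (rule two_sided_scalar[OF Ann False])
    moreover have "P (word [Vertex w1])"
      unfolding P_def using vertex_annihilates_perp[OF her w1(1)] by blast
    moreover have "w1 \<in> verts E" using her w1(1) unfolding hereditary_def by blast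
    ultimately show False using not_emits_annihilated_vertex[OF P] uw1 unfolding Ann_def by blast
  next
    case True
    then have pu0: "h (p * word [Vertex u]) = h 0" using pu by simp
    have "Ann (word [Vertex w2])" unfolding Ann_def
    proof (intro allI impI)
      fix x assume "P x"
      then have "h (x * 1 * word [Vertex w2]) = h 0" using w2(1) unfolding P_def by blast
      then show "h (x * word [Vertex w2]) = h 0" by simp
    qed
    then have w2p: "hw [Vertex w2] = h (p * word [Vertex w2])" by (rule unit)
    obtain q where q: "awalk u q w2" using uw2 unfolding emits_path_def by blast
    let ?s = "word (Vertex w2 # map Ghost (rev q)) :: ('v, 'e, 'k) lpa_free"
      and ?t = "word (Vertex u # map Edge q @ [Vertex w2]) :: ('v, 'e, 'k) lpa_free"
    have "h (p * word [Vertex w2]) = h (p * (?s * word [Vertex u] * ?t))"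
      using ghost_path_mult_path[OF q] by (intro h_cong_mult refl) (simp add: word_mult_word)
    also have "\<dots> = h (?s * (p * word [Vertex u]) * ?t)"
      using h_cong_mult[OF central[of ?s] refl, of "word [Vertex u] * ?t"] by (simp add: mult.assoc)
    also have "\<dots> = h 0" by (rule h_mult_zero(1)[OF h_mult_zero(2)[OF pu0]])
    finally have "hw [Vertex w2] = h 0" using w2p by simp
    moreover have "w2 \<in> verts E" using w2(1) unfolding perp_iff by blast
    ultimately show False using vertex_nonzero by blast
  qed
qed

end

theorem corollary4p3:
  fixes E :: "('v, 'e) pre_digraph" and bar :: "'k::field \<Rightarrow> 'k"
  assumes "fin_digraph E"
    and "\<And>x y. bar (x + y) = bar x + bar y"
    and "\<And>x y. bar (x * y) = bar y * bar x"
    and "\<And>x. bar (bar x) = x"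
  shows "let
         c1 = (graded_quasi_Baer_star_ring
           (leavitt_path_algebra E :: ('v, 'e, 'k) lpa_free set ring) (lpa_grading E) (lpa_star E bar));
         c2 = (\<forall>H. hersat E H \<and> H \<noteq> {} \<longrightarrow>
           (\<forall>c. cycle_outside E H c \<longrightarrow> \<not> cycle_leads_to E c H) \<or>
           (\<forall>c. cycle_outside E (perp E H) c \<longrightarrow> \<not> cycle_leads_to E c (perp E H)));
         c3 = (\<forall>H. hersat E H \<and> H \<noteq> {} \<longrightarrow>
           (\<forall>c. cycle_outside E (H \<union> perp E H) c \<longrightarrow>
              (\<forall>v\<in>cycle_verts E c.
                 \<not> ((\<exists>w\<in>H. emits_path E v w) \<and> (\<exists>w\<in>perp E H. emits_path E v w)))));
         c4 = (\<forall>H. hersat E H \<and> H \<noteq> {} \<longrightarrow>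
           saturated_closure E (perp E H \<union> perp E (perp E H)) = verts E);
         c5 = (\<forall>H. hersat E H \<and> H \<noteq> {} \<longrightarrow>
           perp E H \<squnion>\<^bsub>hersat_lattice E\<^esub> perp E (perp E H) = verts E)
       in (c1 \<longleftrightarrow> c2) \<and> (c2 \<longleftrightarrow> c3) \<and> (c3 \<longleftrightarrow> c4) \<and> (c4 \<longleftrightarrow> c5)"
proof -
  interpret fin_digraph E by (rule assms(1))
  interpret lpa_star_graph E bar
    by (intro lpa_star_graph.intro lpa_graph.intro field_involution.intro) (fact assms)+
  note wf = wf_digraph_axioms
  define c1 where "c1 \<longleftrightarrow> graded_quasi_Baer_star_ring
    (leavitt_path_algebra E :: ('v, 'e, 'k) lpa_free set ring) (lpa_grading E) (lpa_star E bar)"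
  define c2 where "c2 \<longleftrightarrow> (\<forall>H. hersat E H \<and> H \<noteq> {} \<longrightarrow>
    (\<forall>c. cycle_outside E H c \<longrightarrow> \<not> cycle_leads_to E c H) \<or>
    (\<forall>c. cycle_outside E (perp E H) c \<longrightarrow> \<not> cycle_leads_to E c (perp E H)))"
  define c3 where "c3 \<longleftrightarrow> (\<forall>H. hersat E H \<and> H \<noteq> {} \<longrightarrow>
    (\<forall>c. cycle_outside E (H \<union> perp E H) c \<longrightarrow>
      (\<forall>v\<in>cycle_verts E c.
        \<not> ((\<exists>w\<in>H. emits_path E v w) \<and> (\<exists>w\<in>perp E H. emits_path E v w)))))"
  define c4 where "c4 \<longleftrightarrow> (\<forall>H. hersat E H \<and> H \<noteq> {} \<longrightarrow>
    saturated_closure E (perp E H \<union> perp E (perp E H)) = verts E)"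
  define c5 where "c5 \<longleftrightarrow> (\<forall>H. hersat E H \<and> H \<noteq> {} \<longrightarrow>
    perp E H \<squnion>\<^bsub>hersat_lattice E\<^esub> perp E (perp E H) = verts E)"
  have 23: "c2 \<longleftrightarrow> c3"
    unfolding c2_def c3_def
    by (intro all_cong1 imp_cong refl no_cycle_leads_iff_no_cycle_between[OF wf]) blast
  have 34: "c3 \<longleftrightarrow> c4"
    unfolding c3_def c4_def
    by (intro all_cong1 imp_cong refl no_cycle_between_iff_closure[OF assms(1)]) blast
  have 45: "c4 \<longleftrightarrow> c5"
  proof -
    have "perp E H \<squnion>\<^bsub>hersat_lattice E\<^esub> perp E (perp E H) =
        saturated_closure E (perp E H \<union> perp E (perp E H))" if "hersat E H" for H
      using that hersat_perp[OF wf] unfolding hersat_def[of E H]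
      by (intro join_hersat_lattice[OF wf]) (auto simp: hersat_def)
    then show ?thesis unfolding c4_def c5_def by metis
  qed
  have 13: "c1 \<Longrightarrow> c3"
    unfolding c1_def c3_def using quasi_Baer_no_cycle_between by blast
  have 41: c1 if c4
    unfolding c1_def graded_quasi_Baer_star_ring_def
  proof (intro conjI allI impI graded_star_ring_R)
    fix I :: "('v, 'e, 'k) lpa_free set set"
    assume I: "graded_ideal R grading I"
    show "\<exists>p\<in>homogeneous_elements grading. projection R (lpa_star E bar) p \<and>
        right_annihilator R I = (\<lambda>r. p \<otimes>\<^bsub>R\<^esub> r) ` carrier R"
      by (rule annihilator_projection[OF I]) (use that c4_def in blast)
  qed
  have "(c1 \<longleftrightarrow> c2) \<and> (c2 \<longleftrightarrow> c3) \<and> (c3 \<longleftrightarrow> c4) \<and> (c4 \<longleftrightarrow> c5)"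
    using 23 34 45 13 41 by blast
  then show ?thesis unfolding Let_def c1_def c2_def c3_def c4_def c5_def .
qed

end
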